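(* Let $k$ be a field, $H$ a Hopf algebra over $k$, and $R$ an $H$-module algebra over $k$ with unit. Then: (1) $\bar r_{jH}(R)=r_{Hj}(R)$ and $r_j(r_{Hj}(R)\# H)=r_{Hj}(R)\# H$; (2) the following three conditions are equivalent: $r_j(R\# H)=r_{Hj}(R)\# H$; $\ r_j(r_{Hj}(R)\# H)=r_j(R\# H)$; $\ r_j\big((r_j(R\# H)\cap R)\# H\big)=r_j(R\# H)$; (3) if, furthermore, $H$ is finite-dimensional, then $r_j(R\# H)=r_{Hj}(R)\# H$ if and only if $r_j(r_{jH}(R)\# H)=r_j(R\# H)$.
   Context: $r_j(A)$ denotes the Jacobson radical of an algebra $A$ (possibly without unit). Sweedler notation $\Delta(h)=\sum h_1\otimes h_2$ is used. An $H$-module algebra is a $k$-algebra $R$ that is a unital left $H$-module with $h\cdot(ab)=\sum(h_1\cdot a)(h_2\cdot b)$ for $a,b\in R$, $h\in H$. The smash product $R\# H$ is $R\otimes H$ with multiplication $(a\# h)(b\# g)=\sum a(h_1\cdot b)\# h_2g$; $R$ is identified with $R\#1\subseteq R\# H$. For an $H$-ideal $I$ of $R$ (ideal with $h\cdot I\subseteq I$ for all $h\in H$), $I\# H$ is the corresponding subalgebra of $R\# H$. $\bar r_{jH}(R)=r_j(R\# H)\cap R$ and $r_{jH}(R)=(r_j(R):H)=\{x\in R\mid h\cdot x\in r_j(R)\text{ for all }h\in H\}$. An $R$-$H$-module is a left $R$-module $M$ that is also a unital left $H$-module with $h(am)=\sum(h_1\cdot a)(h_2m)$ for $h\in H$,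 $a\in R$, $m\in M$. It is $R$-$H$-irreducible if $RM\ne0$ and $M$ has no $R$-$H$-submodules other than $0$ and $M$. The $H$-Jacobson radical $r_{Hj}(R)$ is the intersection of the annihilators in $R$ of all $R$-$H$-irreducible modules (equal to $R$ if there are none). *)

theory Defs
  imports "HOL-Algebra.Free_Abelian_Groups" "Jordan_Normal_Form.Missing_VectorSpace"
begin

section \<open>Tensor products of vector spaces\<close>

type_synonym ('v, 'w) tensor = "('v \<times> 'w \<Rightarrow>\<^sub>0 int) set"

definition bilinear_map ::
    "('k, 'x) ring_scheme \<Rightarrow> ('k, 'v, 'y) module_scheme \<Rightarrow> ('k, 'w, 'z) module_scheme \<Rightarrow>
     ('k, 'p, 'q) module_scheme \<Rightarrow> ('v \<Rightarrow> 'w \<Rightarrow> 'p) \<Rightarrow> bool" where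
  "bilinear_map K V W P \<beta> \<longleftrightarrow>
     (\<forall>v\<in>carrier V. linear_map K W P (\<beta> v)) \<and>
     (\<forall>w\<in>carrier W. linear_map K V P (\<lambda>v. \<beta> v w))"

definition tensor_relations ::
    "('k, 'x) ring_scheme \<Rightarrow> ('k, 'v, 'y) module_scheme \<Rightarrow> ('k, 'w, 'z) module_scheme \<Rightarrow>
     ('v \<times> 'w \<Rightarrow>\<^sub>0 int) set" where
  "tensor_relations K V W =
     {frag_of (v \<oplus>\<^bsub>V\<^esub> v', w) - frag_of (v, w) - frag_of (v', w) | v v' w.
        v \<in> carrier V \<and> v' \<in> carrier V \<and> w \<in> carrier W} \<union>
     {frag_of (v, w \<oplus>\<^bsub>W\<^esub> w') - frag_of (v, w) - frag_of (v, w') | v w w'.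
        v \<in> carrier V \<and> w \<in> carrier W \<and> w' \<in> carrier W} \<union>
     {frag_of (c \<odot>\<^bsub>V\<^esub> v, w) - frag_of (v, c \<odot>\<^bsub>W\<^esub> w) | c v w.
        c \<in> carrier K \<and> v \<in> carrier V \<and> w \<in> carrier W}"

definition tensor_kernel ::
    "('k, 'x) ring_scheme \<Rightarrow> ('k, 'v, 'y) module_scheme \<Rightarrow> ('k, 'w, 'z) module_scheme \<Rightarrow>
     ('v \<times> 'w \<Rightarrow>\<^sub>0 int) set" where
  "tensor_kernel K V W =
     generate (free_Abelian_group (carrier V \<times> carrier W)) (tensor_relations K V W)"

text \<open>The tensor product as an abelian group, in the multiplicative notation of
  \<^theory>\<open>HOL-Algebra.Free_Abelian_Groups\<close>.\<close>

definition tensor_group ::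
    "('k, 'x) ring_scheme \<Rightarrow> ('k, 'v, 'y) module_scheme \<Rightarrow> ('k, 'w, 'z) module_scheme \<Rightarrow>
     ('v, 'w) tensor monoid" where
  "tensor_group K V W =
     free_Abelian_group (carrier V \<times> carrier W) Mod tensor_kernel K V W"

definition pure_tensor ::
    "('k, 'x) ring_scheme \<Rightarrow> ('k, 'v, 'y) module_scheme \<Rightarrow> ('k, 'w, 'z) module_scheme \<Rightarrow>
     'v \<Rightarrow> 'w \<Rightarrow> ('v, 'w) tensor" where
  "pure_tensor K V W v w =
     tensor_kernel K V W #>\<^bsub>free_Abelian_group (carrier V \<times> carrier W)\<^esub> frag_of (v, w)"

text \<open>The homomorphism out of the tensor product induced by a balanced map \<open>\<beta>\<close>, given by
  the universal property: it exists and is unique on the carrier by \<open>tensor_lift_hom\<close>,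
  \<open>tensor_lift_pure\<close> and \<open>tensor_hom_eqI\<close> below. It is unspecified when \<open>\<beta>\<close> is not balanced.\<close>

definition tensor_lift ::
    "('k, 'x) ring_scheme \<Rightarrow> ('k, 'v, 'y) module_scheme \<Rightarrow> ('k, 'w, 'z) module_scheme \<Rightarrow>
     ('g, 'q) monoid_scheme \<Rightarrow> ('v \<Rightarrow> 'w \<Rightarrow> 'g) \<Rightarrow> ('v, 'w) tensor \<Rightarrow> 'g" where
  "tensor_lift K V W G \<beta> =
     (SOME \<phi>. \<phi> \<in> hom (tensor_group K V W) G \<and>
        (\<forall>v\<in>carrier V. \<forall>w\<in>carrier W. \<phi> (pure_tensor K V W v w) = \<beta> v w))"

text \<open>The tensor product as a vector space; its \<^const>\<open>mult\<close> and \<^const>\<open>one\<close> are dummies.\<close>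

definition tensor_space ::
    "('k, 'x) ring_scheme \<Rightarrow> ('k, 'v, 'y) module_scheme \<Rightarrow> ('k, 'w, 'z) module_scheme \<Rightarrow>
     ('k, ('v, 'w) tensor) module" where
  "tensor_space K V W =
     \<lparr>carrier = carrier (tensor_group K V W),
      mult = (\<lambda>_ _. \<one>\<^bsub>tensor_group K V W\<^esub>),
      one = \<one>\<^bsub>tensor_group K V W\<^esub>,
      zero = \<one>\<^bsub>tensor_group K V W\<^esub>,
      add = mult (tensor_group K V W),
      smult = (\<lambda>c. tensor_lift K V W (tensor_group K V W)
                     (\<lambda>v w. pure_tensor K V W (c \<odot>\<^bsub>V\<^esub> v) w))\<rparr>"



section \<open>Hopf algebras and module algebras\<close>

text \<open>Unital associative algebras, not necessarily commutative, possibly zero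
  (\<^locale>\<open>algebra\<close> of the library is commutative).\<close>

locale unital_algebra = vectorspace K A + ring A for K and A (structure) +
  assumes smult_mult_left:
      "\<lbrakk>c \<in> carrier K; a \<in> carrier A; b \<in> carrier A\<rbrakk> \<Longrightarrow> (c \<odot> a) \<otimes> b = c \<odot> (a \<otimes> b)"
    and smult_mult_right:
      "\<lbrakk>c \<in> carrier K; a \<in> carrier A; b \<in> carrier A\<rbrakk> \<Longrightarrow> a \<otimes> (c \<odot> b) = c \<odot> (a \<otimes> b)"

definition tensor_algebra ::
    "('k, 'x) ring_scheme \<Rightarrow> ('k, 'a, 'y) module_scheme \<Rightarrow> ('k, 'b, 'z) module_scheme \<Rightarrow>
     ('k, ('a, 'b) tensor) module" where
  "tensor_algebra K A B =
     (tensor_space K A B)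
       \<lparr>mult := (\<lambda>s t.
          tensor_lift K A B (tensor_group K A B) (\<lambda>a b.
            tensor_lift K A B (tensor_group K A B) (\<lambda>a' b'.
              pure_tensor K A B (a \<otimes>\<^bsub>A\<^esub> a') (b \<otimes>\<^bsub>B\<^esub> b')) t) s),
        one := pure_tensor K A B \<one>\<^bsub>A\<^esub> \<one>\<^bsub>B\<^esub>\<rparr>"

text \<open>Sweedler notation: \<open>sweedler K H \<Delta> P h F\<close> is \<open>\<Sum> F h\<^sub>1 h\<^sub>2\<close>, a sum in the vector space
  \<open>P\<close>, for \<open>F\<close> bilinear.\<close>

definition sweedler ::
    "('k, 'x) ring_scheme \<Rightarrow> ('k, 'h, 'y) module_scheme \<Rightarrow> ('h \<Rightarrow> ('h, 'h) tensor) \<Rightarrow>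
     ('k, 'p, 'z) module_scheme \<Rightarrow> 'h \<Rightarrow> ('h \<Rightarrow> 'h \<Rightarrow> 'p) \<Rightarrow> 'p" where
  "sweedler K H \<Delta> P h F = tensor_lift K H H (add_monoid P) F (\<Delta> h)"

locale hopf_algebra = unital_algebra K H for K and H (structure) +
  fixes \<Delta> :: "'c \<Rightarrow> ('c, 'c) tensor" and \<epsilon> :: "'c \<Rightarrow> 'a" and S :: "'c \<Rightarrow> 'c"
  assumes comult_linear: "linear_map K H (tensor_space K H H) \<Delta>"
    and counit_ring_hom: "\<epsilon> \<in> ring_hom H K"
    and counit_smult: "\<lbrakk>c \<in> carrier K; h \<in> carrier H\<rbrakk> \<Longrightarrow> \<epsilon> (c \<odot> h) = c \<otimes>\<^bsub>K\<^esub> \<epsilon> h"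
    and coassociative:
      "h \<in> carrier H \<Longrightarrow>
         sweedler K H \<Delta> (tensor_space K H (tensor_space K H H)) h (\<lambda>x y.
           sweedler K H \<Delta> (tensor_space K H (tensor_space K H H)) x (\<lambda>x\<^sub>1 x\<^sub>2.
             pure_tensor K H (tensor_space K H H) x\<^sub>1 (pure_tensor K H H x\<^sub>2 y))) =
         sweedler K H \<Delta> (tensor_space K H (tensor_space K H H)) h (\<lambda>x y.
           pure_tensor K H (tensor_space K H H) x (\<Delta> y))"
    and counit_left: "h \<in> carrier H \<Longrightarrow> sweedler K H \<Delta> H h (\<lambda>x y. \<epsilon> x \<odot> y) = h"
    and counit_right: "h \<in> carrier H \<Longrightarrow> sweedler K H \<Delta> H h (\<lambda>x y. \<epsilon> y \<odot> x) = h"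
    and comult_one: "\<Delta> \<one> = pure_tensor K H H \<one> \<one>"
    and comult_mult:
      "\<lbrakk>g \<in> carrier H; h \<in> carrier H\<rbrakk> \<Longrightarrow>
         \<Delta> (g \<otimes> h) = \<Delta> g \<otimes>\<^bsub>tensor_algebra K H H\<^esub> \<Delta> h"
    and antipode_linear: "linear_map K H H S"
    and antipode_left: "h \<in> carrier H \<Longrightarrow> sweedler K H \<Delta> H h (\<lambda>x y. S x \<otimes> y) = \<epsilon> h \<odot> \<one>"
    and antipode_right: "h \<in> carrier H \<Longrightarrow> sweedler K H \<Delta> H h (\<lambda>x y. x \<otimes> S y) = \<epsilon> h \<odot> \<one>"

text \<open>The usual condition \<open>h \<cdot> 1 = \<epsilon>(h) 1\<close> is not listed: it follows by means of the antipode.\<close>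

locale module_algebra =
    H: hopf_algebra K H \<Delta> \<epsilon> S + R: unital_algebra K R for K H \<Delta> \<epsilon> S and R (structure) +
  fixes act :: "'c \<Rightarrow> 'e \<Rightarrow> 'e" (infixr \<open>\<cdot>\<close> 75)
  assumes act_bilinear: "bilinear_map K H R R (\<cdot>)"
    and act_one: "a \<in> carrier R \<Longrightarrow> \<one>\<^bsub>H\<^esub> \<cdot> a = a"
    and act_mult:
      "\<lbrakk>g \<in> carrier H; h \<in> carrier H; a \<in> carrier R\<rbrakk> \<Longrightarrow> (g \<otimes>\<^bsub>H\<^esub> h) \<cdot> a = g \<cdot> (h \<cdot> a)"
    and act_prod:
      "\<lbrakk>h \<in> carrier H; a \<in> carrier R; b \<in> carrier R\<rbrakk> \<Longrightarrow>
         h \<cdot> (a \<otimes> b) = sweedler K H \<Delta> R h (\<lambda>h\<^sub>1 h\<^sub>2. (h\<^sub>1 \<cdot> a) \<otimes> (h\<^sub>2 \<cdot> b))"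

definition smash_product ::
    "('k, 'x) ring_scheme \<Rightarrow> ('k, 'h, 'y) module_scheme \<Rightarrow> ('h \<Rightarrow> ('h, 'h) tensor) \<Rightarrow>
     ('k, 'r, 'z) module_scheme \<Rightarrow> ('h \<Rightarrow> 'r \<Rightarrow> 'r) \<Rightarrow> ('k, ('r, 'h) tensor) module" where
  "smash_product K H \<Delta> R act =
     (tensor_space K R H)
       \<lparr>mult := (\<lambda>s t.
          tensor_lift K R H (tensor_group K R H) (\<lambda>a h.
            tensor_lift K R H (tensor_group K R H) (\<lambda>b g.
              sweedler K H \<Delta> (tensor_space K R H) h (\<lambda>h\<^sub>1 h\<^sub>2.
                pure_tensor K R H (a \<otimes>\<^bsub>R\<^esub> act h\<^sub>1 b) (h\<^sub>2 \<otimes>\<^bsub>H\<^esub> g))) t) s),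
        one := pure_tensor K R H \<one>\<^bsub>R\<^esub> \<one>\<^bsub>H\<^esub>\<rparr>"

text \<open>For an \<open>H\<close>-ideal \<open>I\<close> of \<open>R\<close>, the subalgebra \<open>I # H\<close> of \<open>R # H\<close>: all finite sums of
  elements \<open>a # h\<close> with \<open>a \<in> I\<close>.\<close>

definition smash_ideal ::
    "('k, 'x) ring_scheme \<Rightarrow> ('k, 'h, 'y) module_scheme \<Rightarrow> ('k, 'r, 'z) module_scheme \<Rightarrow>
     'r set \<Rightarrow> ('r, 'h) tensor set" where
  "smash_ideal K H R I =
     generate (tensor_group K R H) {pure_tensor K R H a h | a h. a \<in> I \<and> h \<in> carrier H}"


section \<open>Radicals\<close>

text \<open>Modules over an algebra \<open>A\<close> that need not have a unit: \<^const>\<open>one\<close> of \<open>A\<close> is not used,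
  so that \<open>A\<close> may be \<open>B\<lparr>carrier := I\<rparr>\<close> for a subalgebra \<open>I\<close> of \<open>B\<close>. They carry a vector
  space structure over \<open>K\<close> for which the action is bilinear.\<close>

locale algebra_module = vectorspace K M for K and A and M (structure) +
  fixes act :: "'e \<Rightarrow> 'c \<Rightarrow> 'c"
  assumes act_bilinear: "bilinear_map K A M M act"
    and act_mult:
      "\<lbrakk>a \<in> carrier A; b \<in> carrier A; m \<in> carrier M\<rbrakk> \<Longrightarrow>
         act (a \<otimes>\<^bsub>A\<^esub> b) m = act a (act b m)"

locale irreducible_module = algebra_module +
  assumes act_nonzero: "\<exists>a\<in>carrier A. \<exists>m\<in>carrier M. act a m \<noteq> \<zero>"
    and no_proper_submodule:
      "\<lbrakk>VectorSpace.subspace K N M; \<And>a n. \<lbrakk>a \<in> carrier A; n \<in> N\<rbrakk> \<Longrightarrow> act a n \<in> N\<rbrakk> \<Longrightarrow>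
         N = {\<zero>} \<or> N = carrier M"

text \<open>The Jacobson radical: the intersection of the annihilators of the irreducible modules.
  The modules range over a type \<^typ>\<open>'a set\<close>, since HOL cannot quantify over all types
  here; by \<open>jacobson_radical_annihilates\<close> below this is no restriction.\<close>

definition jacobson_radical ::
    "('k, 'x) ring_scheme \<Rightarrow> ('k, 'a, 'y) module_scheme \<Rightarrow> 'a set" where
  "jacobson_radical K A =
     {a \<in> carrier A. \<forall>(M :: ('k, 'a set) module) act.
        irreducible_module K A M act \<longrightarrow> (\<forall>m\<in>carrier M. act a m = \<zero>\<^bsub>M\<^esub>)}"

text \<open>\<open>R\<close>-\<open>H\<close>-modules; \<open>act\<close> is the action of \<open>H\<close> on \<open>R\<close>.\<close>

locale RH_module = algebra_module K R M ract + HM: algebra_module K H M hact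
    for K H and \<Delta> :: "'h \<Rightarrow> ('h, 'h) tensor" and R and act :: "'h \<Rightarrow> 'r \<Rightarrow> 'r"
      and M (structure) and ract hact +
  assumes hact_one: "m \<in> carrier M \<Longrightarrow> hact \<one>\<^bsub>H\<^esub> m = m"
    and hact_ract:
      "\<lbrakk>h \<in> carrier H; a \<in> carrier R; m \<in> carrier M\<rbrakk> \<Longrightarrow>
         hact h (ract a m) = sweedler K H \<Delta> M h (\<lambda>h\<^sub>1 h\<^sub>2. ract (act h\<^sub>1 a) (hact h\<^sub>2 m))"

locale irreducible_RH_module = RH_module +
  assumes ract_nonzero: "\<exists>a\<in>carrier R. \<exists>m\<in>carrier M. ract a m \<noteq> \<zero>"
    and no_proper_RH_submodule:
      "\<lbrakk>VectorSpace.subspace K N M;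
        \<And>a n. \<lbrakk>a \<in> carrier R; n \<in> N\<rbrakk> \<Longrightarrow> ract a n \<in> N;
        \<And>h n. \<lbrakk>h \<in> carrier H; n \<in> N\<rbrakk> \<Longrightarrow> hact h n \<in> N\<rbrakk> \<Longrightarrow>
         N = {\<zero>} \<or> N = carrier M"

text \<open>The \<open>H\<close>-Jacobson radical \<open>r\<^sub>H\<^sub>j(R)\<close>. As above, the type over which the modules range is
  no restriction, by \<open>H_jacobson_radical_annihilates\<close> below.\<close>

definition H_jacobson_radical ::
    "('k, 'x) ring_scheme \<Rightarrow> ('k, 'h, 'y) module_scheme \<Rightarrow> ('h \<Rightarrow> ('h, 'h) tensor) \<Rightarrow>
     ('k, 'r, 'z) module_scheme \<Rightarrow> ('h \<Rightarrow> 'r \<Rightarrow> 'r) \<Rightarrow> 'r set" where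
  "H_jacobson_radical K H \<Delta> R act =
     {a \<in> carrier R. \<forall>(M :: ('k, ('r, 'h) tensor set) module) ract hact.
        irreducible_RH_module K H \<Delta> R act M ract hact \<longrightarrow>
          (\<forall>m\<in>carrier M. ract a m = \<zero>\<^bsub>M\<^esub>)}"

text \<open>\<open>r\<^sub>j(R # H) \<inter> R\<close>, where \<open>a \<in> R\<close> is identified with \<open>a # 1\<close>.\<close>

definition jacobson_contraction ::
    "('k, 'x) ring_scheme \<Rightarrow> ('k, 'h, 'y) module_scheme \<Rightarrow> ('h \<Rightarrow> ('h, 'h) tensor) \<Rightarrow>
     ('k, 'r, 'z) module_scheme \<Rightarrow> ('h \<Rightarrow> 'r \<Rightarrow> 'r) \<Rightarrow> 'r set" where
  "jacobson_contraction K H \<Delta> R act =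
     {a \<in> carrier R.
        pure_tensor K R H a \<one>\<^bsub>H\<^esub> \<in> jacobson_radical K (smash_product K H \<Delta> R act)}"

text \<open>\<open>(r\<^sub>j(R) : H)\<close>.\<close>

definition jacobson_H_core ::
    "('k, 'x) ring_scheme \<Rightarrow> ('k, 'h, 'y) module_scheme \<Rightarrow>
     ('k, 'r, 'z) module_scheme \<Rightarrow> ('h \<Rightarrow> 'r \<Rightarrow> 'r) \<Rightarrow> 'r set" where
  "jacobson_H_core K H R act =
     {x \<in> carrier R. \<forall>h\<in>carrier H. act h x \<in> jacobson_radical K R}"


section \<open>The universal property of the tensor product\<close>

context
  fixes K :: "('k, 'x) ring_scheme" and V :: "('k, 'v, 'y) module_scheme"
    and W :: "('k, 'w, 'z) module_scheme"
  assumes V: "vectorspace K V" and W: "vectorspace K W"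
begin

interpretation V: vectorspace K V by (rule V)
interpretation W: vectorspace K W by (rule W)

abbreviation (input) "FVW \<equiv> free_Abelian_group (carrier V \<times> carrier W)"

lemma tensor_relations_subset: "tensor_relations K V W \<subseteq> carrier FVW"
proof -
  have "x - y \<in> carrier FVW" if "x \<in> carrier FVW" "y \<in> carrier FVW" for x y
    using that keys_diff[of x y] by (auto simp: carrier_free_Abelian_group_iff)
  moreover have "frag_of (v, w) \<in> carrier FVW" if "v \<in> carrier V" "w \<in> carrier W" for v w
    using that by simp
  ultimately show ?thesis
    unfolding tensor_relations_def
    by (auto simp del: carrier_free_Abelian_group_iff frag_of_in_free_Abelian_group)
qed

lemma tensor_kernel_normal: "tensor_kernel K V W \<lhd> FVW"
proof -
  have "subgroup (tensor_kernel K V W) FVW"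
    unfolding tensor_kernel_def
    by (rule group.generate_is_subgroup[OF group_free_Abelian_group tensor_relations_subset])
  then show ?thesis
    using abelian_free_Abelian_group comm_group.normal_iff_subgroup by blast
qed

lemma comm_group_tensor_group: "comm_group (tensor_group K V W)"
  unfolding tensor_group_def
  using comm_group.abelian_FactGroup[OF abelian_free_Abelian_group]
    normal_imp_subgroup[OF tensor_kernel_normal] by blast

lemma pure_tensor_closed:
  "\<lbrakk>v \<in> carrier V; w \<in> carrier W\<rbrakk> \<Longrightarrow> pure_tensor K V W v w \<in> carrier (tensor_group K V W)"
  unfolding pure_tensor_def tensor_group_def by (auto simp: carrier_FactGroup)

lemma tensor_hom_eqI:
  assumes G: "group G"
    and \<phi>: "\<phi> \<in> hom (tensor_group K V W) G" and \<psi>: "\<psi> \<in> hom (tensor_group K V W) G"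
    and eq: "\<And>v w. \<lbrakk>v \<in> carrier V; w \<in> carrier W\<rbrakk> \<Longrightarrow>
               \<phi> (pure_tensor K V W v w) = \<psi> (pure_tensor K V W v w)"
    and t: "t \<in> carrier (tensor_group K V W)"
  shows "\<phi> t = \<psi> t"
proof -
  interpret T: comm_group "tensor_group K V W" by (rule comm_group_tensor_group)
  interpret phi: group_hom "tensor_group K V W" G \<phi>
    using G \<phi> by (simp add: group_hom_def group_hom_axioms_def T.is_group)
  interpret psi: group_hom "tensor_group K V W" G \<psi>
    using G \<psi> by (simp add: group_hom_def group_hom_axioms_def T.is_group)
  let ?q = "\<lambda>x. tensor_kernel K V W #>\<^bsub>FVW\<^esub> x"
  have q: "?q \<in> hom FVW (tensor_group K V W)"
    unfolding tensor_group_def by (rule normal.r_coset_hom_Mod[OF tensor_kernel_normal])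
  interpret q: group_hom FVW "tensor_group K V W" ?q
    using q by (simp add: group_hom_def group_hom_axioms_def T.is_group)
  obtain x where x: "x \<in> carrier FVW" "t = ?q x"
    using t by (auto simp: tensor_group_def carrier_FactGroup)
  have "Poly_Mapping.keys x \<subseteq> carrier V \<times> carrier W" using x(1) by simp
  then have "\<phi> (?q x) = \<psi> (?q x)"
  proof (rule free_Abelian_group_induct)
    have "?q 0 = \<one>\<^bsub>tensor_group K V W\<^esub>" using q.hom_one by simp
    then show "\<phi> (?q 0) = \<psi> (?q 0)" by simp
  next
    fix x y :: "'v \<times> 'w \<Rightarrow>\<^sub>0 int"
    assume *: "Poly_Mapping.keys x \<subseteq> carrier V \<times> carrier W"
        "Poly_Mapping.keys y \<subseteq> carrier V \<times> carrier W"
        "\<phi> (?q x) = \<psi> (?q x)" "\<phi> (?q y) = \<psi> (?q y)"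
    have xy: "x \<in> carrier FVW" "y \<in> carrier FVW" using * by simp_all
    have "?q (x \<otimes>\<^bsub>FVW\<^esub> inv\<^bsub>FVW\<^esub> y) =
            ?q x \<otimes>\<^bsub>tensor_group K V W\<^esub> inv\<^bsub>tensor_group K V W\<^esub> (?q y)"
      using xy by (simp only: q.hom_mult q.hom_inv q.G.inv_closed)
    moreover have "x \<otimes>\<^bsub>FVW\<^esub> inv\<^bsub>FVW\<^esub> y = x - y" using * by simp
    moreover have "?q x \<in> carrier (tensor_group K V W)" "?q y \<in> carrier (tensor_group K V W)"
      using xy q.hom_closed by blast+
    ultimately show "\<phi> (?q (x - y)) = \<psi> (?q (x - y))" using * by simp
  next
    fix a assume "a \<in> carrier V \<times> carrier W"
    then show "\<phi> (?q (frag_of a)) = \<psi> (?q (frag_of a))"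
      using eq by (auto simp: pure_tensor_def)
  qed
  then show ?thesis using x by simp
qed

context
  fixes G :: "('g, 'q) monoid_scheme" and \<beta> :: "'v \<Rightarrow> 'w \<Rightarrow> 'g"
  assumes G: "comm_group G"
    and closed: "\<And>v w. \<lbrakk>v \<in> carrier V; w \<in> carrier W\<rbrakk> \<Longrightarrow> \<beta> v w \<in> carrier G"
    and add_left: "\<And>v v' w. \<lbrakk>v \<in> carrier V; v' \<in> carrier V; w \<in> carrier W\<rbrakk> \<Longrightarrow>
           \<beta> (v \<oplus>\<^bsub>V\<^esub> v') w = \<beta> v w \<otimes>\<^bsub>G\<^esub> \<beta> v' w"
    and add_right: "\<And>v w w'. \<lbrakk>v \<in> carrier V; w \<in> carrier W; w' \<in> carrier W\<rbrakk> \<Longrightarrow>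
           \<beta> v (w \<oplus>\<^bsub>W\<^esub> w') = \<beta> v w \<otimes>\<^bsub>G\<^esub> \<beta> v w'"
    and balanced: "\<And>c v w. \<lbrakk>c \<in> carrier K; v \<in> carrier V; w \<in> carrier W\<rbrakk> \<Longrightarrow>
           \<beta> (c \<odot>\<^bsub>V\<^esub> v) w = \<beta> v (c \<odot>\<^bsub>W\<^esub> w)"
begin

lemma tensor_lift_exists:
  "\<exists>\<phi>. \<phi> \<in> hom (tensor_group K V W) G \<and>
     (\<forall>v\<in>carrier V. \<forall>w\<in>carrier W. \<phi> (pure_tensor K V W v w) = \<beta> v w)"
proof -
  interpret G: comm_group G by (rule G)
  have "case_prod \<beta> ` (carrier V \<times> carrier W) \<subseteq> carrier G" using closed by auto
  then obtain f where f: "f \<in> hom FVW G"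
      and "\<And>x. x \<in> carrier V \<times> carrier W \<Longrightarrow> f (frag_of x) = case_prod \<beta> x"
    using G.free_Abelian_group_universal by metis
  then have f_pure: "f (frag_of (v, w)) = \<beta> v w" if "v \<in> carrier V" "w \<in> carrier W" for v w
    using that by auto
  interpret f: group_hom FVW G f
    using f by (simp add: group_hom_def group_hom_axioms_def)
  have f_diff: "f (x - y) = f x \<otimes>\<^bsub>G\<^esub> inv\<^bsub>G\<^esub> (f y)" if "x \<in> carrier FVW" "y \<in> carrier FVW" for x y
  proof -
    have "f (x \<otimes>\<^bsub>FVW\<^esub> inv\<^bsub>FVW\<^esub> y) = f x \<otimes>\<^bsub>G\<^esub> inv\<^bsub>G\<^esub> (f y)"
      using that by (simp only: f.hom_mult f.hom_inv f.G.inv_closed)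
    moreover have "x \<otimes>\<^bsub>FVW\<^esub> inv\<^bsub>FVW\<^esub> y = x - y" using that by simp
    ultimately show ?thesis by simp
  qed
  have F_diff: "x - y \<in> carrier FVW" if "x \<in> carrier FVW" "y \<in> carrier FVW" for x y
    using that keys_diff[of x y] by (auto simp: carrier_free_Abelian_group_iff)
  have F_pure: "frag_of (v, w) \<in> carrier FVW" if "v \<in> carrier V" "w \<in> carrier W" for v w
    using that by simp
  have cancel: "a \<otimes>\<^bsub>G\<^esub> b \<otimes>\<^bsub>G\<^esub> inv\<^bsub>G\<^esub> a \<otimes>\<^bsub>G\<^esub> inv\<^bsub>G\<^esub> b = \<one>\<^bsub>G\<^esub>"
    if "a \<in> carrier G" "b \<in> carrier G" for a b
    using that by (metis G.inv_mult G.inv_closed G.m_assoc G.m_closed G.r_inv)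
  have "tensor_relations K V W \<subseteq> kernel FVW G f"
  proof
    fix x assume "x \<in> tensor_relations K V W"
    moreover from this have "x \<in> carrier FVW" using tensor_relations_subset by blast
    ultimately show "x \<in> kernel FVW G f"
      unfolding kernel_def tensor_relations_def
      by (auto simp del: carrier_free_Abelian_group_iff frag_of_in_free_Abelian_group
            simp: f_diff F_diff F_pure f_pure closed add_left add_right balanced cancel)
  qed
  then have "tensor_kernel K V W \<subseteq> kernel FVW G f"
    unfolding tensor_kernel_def
    by (intro f.G.generate_subgroup_incl f.subgroup_kernel)
  then obtain g where "g \<in> hom (FVW Mod tensor_kernel K V W) G"
      "\<And>x. x \<in> carrier FVW \<Longrightarrow> g (tensor_kernel K V W #>\<^bsub>FVW\<^esub> x) = f x"
    using f.FactGroup_universal_kernel[OF tensor_kernel_normal] by metis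
  then show ?thesis
    unfolding tensor_group_def pure_tensor_def
    by (intro exI[of _ g]) (auto simp: f_pure)
qed

lemma tensor_lift_hom: "tensor_lift K V W G \<beta> \<in> hom (tensor_group K V W) G"
  and tensor_lift_pure:
    "\<lbrakk>v \<in> carrier V; w \<in> carrier W\<rbrakk> \<Longrightarrow>
       tensor_lift K V W G \<beta> (pure_tensor K V W v w) = \<beta> v w"
  using someI_ex[OF tensor_lift_exists] unfolding tensor_lift_def by auto

end

end

context
  fixes K :: "('k, 'x) ring_scheme" and V :: "('k, 'v, 'y) module_scheme"
    and W :: "('k, 'w, 'z) module_scheme"
  assumes V: "vectorspace K V" and W: "vectorspace K W"
begin

interpretation V: vectorspace K V by (rule V)
interpretation W: vectorspace K W by (rule W)
interpretation T: comm_group "tensor_group K V W" by (rule comm_group_tensor_group[OF V W])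

lemma pure_tensor_relations:
  shows pure_tensor_add_left:
      "\<lbrakk>v \<in> carrier V; v' \<in> carrier V; w \<in> carrier W\<rbrakk> \<Longrightarrow>
         pure_tensor K V W (v \<oplus>\<^bsub>V\<^esub> v') w =
         pure_tensor K V W v w \<otimes>\<^bsub>tensor_group K V W\<^esub> pure_tensor K V W v' w"
    and pure_tensor_add_right:
      "\<lbrakk>v \<in> carrier V; w \<in> carrier W; w' \<in> carrier W\<rbrakk> \<Longrightarrow>
         pure_tensor K V W v (w \<oplus>\<^bsub>W\<^esub> w') =
         pure_tensor K V W v w \<otimes>\<^bsub>tensor_group K V W\<^esub> pure_tensor K V W v w'"
    and pure_tensor_balanced:
      "\<lbrakk>c \<in> carrier K; v \<in> carrier V; w \<in> carrier W\<rbrakk> \<Longrightarrow>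
         pure_tensor K V W (c \<odot>\<^bsub>V\<^esub> v) w = pure_tensor K V W v (c \<odot>\<^bsub>W\<^esub> w)"
proof -
  let ?q = "\<lambda>x. tensor_kernel K V W #>\<^bsub>FVW V W\<^esub> x"
  have N: "tensor_kernel K V W \<lhd> FVW V W" by (rule tensor_kernel_normal[OF V W])
  have "?q \<in> hom (FVW V W) (tensor_group K V W)"
    unfolding tensor_group_def by (rule normal.r_coset_hom_Mod[OF N])
  then interpret q: group_hom "FVW V W" "tensor_group K V W" ?q
    by (simp add: group_hom_def group_hom_axioms_def T.is_group)
  have pure: "?q (frag_of (v, w)) = pure_tensor K V W v w" for v w
    by (simp add: pure_tensor_def)
  have F_pure: "frag_of (v, w) \<in> carrier (FVW V W)" if "v \<in> carrier V" "w \<in> carrier W" for v w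
    using that by simp
  have F_diff: "x - y \<in> carrier (FVW V W)"
    if "x \<in> carrier (FVW V W)" "y \<in> carrier (FVW V W)" for x y
    using that keys_diff[of x y] by (auto simp: carrier_free_Abelian_group_iff)
  have q_diff: "?q (x - y) = ?q x \<otimes>\<^bsub>tensor_group K V W\<^esub> inv\<^bsub>tensor_group K V W\<^esub> ?q y"
    if "x \<in> carrier (FVW V W)" "y \<in> carrier (FVW V W)" for x y
  proof -
    have "?q (x \<otimes>\<^bsub>FVW V W\<^esub> inv\<^bsub>FVW V W\<^esub> y) =
        ?q x \<otimes>\<^bsub>tensor_group K V W\<^esub> inv\<^bsub>tensor_group K V W\<^esub> ?q y"
      using that by (simp only: q.hom_mult q.hom_inv q.G.inv_closed)
    moreover have "x \<otimes>\<^bsub>FVW V W\<^esub> inv\<^bsub>FVW V W\<^esub> y = x - y" using that by simp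
    ultimately show ?thesis by simp
  qed
  have rel: "?q x = \<one>\<^bsub>tensor_group K V W\<^esub>" if "x \<in> tensor_relations K V W" for x
  proof -
    have "x \<in> tensor_kernel K V W"
      using that unfolding tensor_kernel_def by (rule generate.incl)
    then have "?q x = tensor_kernel K V W"
      using q.G.coset_join2[OF _ normal_imp_subgroup[OF N]] tensor_relations_subset[OF V W] that
      by blast
    then show ?thesis by (simp add: tensor_group_def)
  qed
  note cl = pure_tensor_closed[OF V W]
  have solve: "a = b \<otimes>\<^bsub>tensor_group K V W\<^esub> d"
    if "a \<otimes>\<^bsub>tensor_group K V W\<^esub> inv\<^bsub>tensor_group K V W\<^esub> b
          \<otimes>\<^bsub>tensor_group K V W\<^esub> inv\<^bsub>tensor_group K V W\<^esub> d = \<one>\<^bsub>tensor_group K V W\<^esub>"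
      "a \<in> carrier (tensor_group K V W)" "b \<in> carrier (tensor_group K V W)"
      "d \<in> carrier (tensor_group K V W)" for a b d
    using that by (metis T.inv_closed T.inv_equality T.inv_inv T.inv_mult T.m_assoc T.m_closed)
  show "pure_tensor K V W (v \<oplus>\<^bsub>V\<^esub> v') w =
         pure_tensor K V W v w \<otimes>\<^bsub>tensor_group K V W\<^esub> pure_tensor K V W v' w"
    if "v \<in> carrier V" "v' \<in> carrier V" "w \<in> carrier W"
  proof (rule solve)
    have "?q (frag_of (v \<oplus>\<^bsub>V\<^esub> v', w) - frag_of (v, w) - frag_of (v', w)) = \<one>\<^bsub>tensor_group K V W\<^esub>"
      by (rule rel) (use that in \<open>auto simp: tensor_relations_def\<close>)
    then show "pure_tensor K V W (v \<oplus>\<^bsub>V\<^esub> v') w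
        \<otimes>\<^bsub>tensor_group K V W\<^esub> inv\<^bsub>tensor_group K V W\<^esub> pure_tensor K V W v w
        \<otimes>\<^bsub>tensor_group K V W\<^esub> inv\<^bsub>tensor_group K V W\<^esub> pure_tensor K V W v' w
        = \<one>\<^bsub>tensor_group K V W\<^esub>"
      using that by (simp only: q_diff F_diff F_pure pure V.M.a_closed)
  qed (use that in \<open>simp_all add: cl\<close>)
  show "pure_tensor K V W v (w \<oplus>\<^bsub>W\<^esub> w') =
         pure_tensor K V W v w \<otimes>\<^bsub>tensor_group K V W\<^esub> pure_tensor K V W v w'"
    if "v \<in> carrier V" "w \<in> carrier W" "w' \<in> carrier W"
  proof (rule solve)
    have "?q (frag_of (v, w \<oplus>\<^bsub>W\<^esub> w') - frag_of (v, w) - frag_of (v, w')) = \<one>\<^bsub>tensor_group K V W\<^esub>"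
      by (rule rel) (use that in \<open>auto simp: tensor_relations_def\<close>)
    then show "pure_tensor K V W v (w \<oplus>\<^bsub>W\<^esub> w')
        \<otimes>\<^bsub>tensor_group K V W\<^esub> inv\<^bsub>tensor_group K V W\<^esub> pure_tensor K V W v w
        \<otimes>\<^bsub>tensor_group K V W\<^esub> inv\<^bsub>tensor_group K V W\<^esub> pure_tensor K V W v w'
        = \<one>\<^bsub>tensor_group K V W\<^esub>"
      using that by (simp only: q_diff F_diff F_pure pure W.M.a_closed)
  qed (use that in \<open>simp_all add: cl\<close>)
  show "pure_tensor K V W (c \<odot>\<^bsub>V\<^esub> v) w = pure_tensor K V W v (c \<odot>\<^bsub>W\<^esub> w)"
    if "c \<in> carrier K" "v \<in> carrier V" "w \<in> carrier W"
  proof -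
    have "?q (frag_of (c \<odot>\<^bsub>V\<^esub> v, w) - frag_of (v, c \<odot>\<^bsub>W\<^esub> w)) = \<one>\<^bsub>tensor_group K V W\<^esub>"
      by (rule rel) (use that in \<open>auto simp: tensor_relations_def\<close>)
    then have "pure_tensor K V W (c \<odot>\<^bsub>V\<^esub> v) w \<otimes>\<^bsub>tensor_group K V W\<^esub>
        inv\<^bsub>tensor_group K V W\<^esub> pure_tensor K V W v (c \<odot>\<^bsub>W\<^esub> w) = \<one>\<^bsub>tensor_group K V W\<^esub>"
      using that by (simp only: q_diff F_pure pure V.smult_closed W.smult_closed)
    then show ?thesis
      using that cl by (metis T.inv_closed T.inv_equality T.inv_inv V.smult_closed W.smult_closed)
  qed
qed

lemma tensor_space_smult:
  assumes "c \<in> carrier K"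
  shows tensor_smult_hom:
      "(\<lambda>t. c \<odot>\<^bsub>tensor_space K V W\<^esub> t) \<in> hom (tensor_group K V W) (tensor_group K V W)"
    and tensor_smult_pure:
      "\<lbrakk>v \<in> carrier V; w \<in> carrier W\<rbrakk> \<Longrightarrow>
         c \<odot>\<^bsub>tensor_space K V W\<^esub> pure_tensor K V W v w = pure_tensor K V W (c \<odot>\<^bsub>V\<^esub> v) w"
proof -
  have comm: "d \<odot>\<^bsub>V\<^esub> (c \<odot>\<^bsub>V\<^esub> v) = c \<odot>\<^bsub>V\<^esub> (d \<odot>\<^bsub>V\<^esub> v)" if "d \<in> carrier K" "v \<in> carrier V" for d v
    using that assms by (metis V.m_comm V.smult_assoc1)
  have bal: "pure_tensor K V W (c \<odot>\<^bsub>V\<^esub> (d \<odot>\<^bsub>V\<^esub> v)) w = pure_tensor K V W (c \<odot>\<^bsub>V\<^esub> v) (d \<odot>\<^bsub>W\<^esub> w)"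
    if "d \<in> carrier K" "v \<in> carrier V" "w \<in> carrier W" for d v w
    using that assms pure_tensor_balanced[of d "c \<odot>\<^bsub>V\<^esub> v" w] comm by simp
  show "(\<lambda>t. c \<odot>\<^bsub>tensor_space K V W\<^esub> t) \<in> hom (tensor_group K V W) (tensor_group K V W)"
    unfolding tensor_space_def module.simps
    by (rule tensor_lift_hom[OF V W T.comm_group_axioms])
      (simp_all add: assms bal pure_tensor_closed[OF V W] V.smult_r_distr pure_tensor_add_left
        pure_tensor_add_right)
  show "c \<odot>\<^bsub>tensor_space K V W\<^esub> pure_tensor K V W v w = pure_tensor K V W (c \<odot>\<^bsub>V\<^esub> v) w"
    if "v \<in> carrier V" "w \<in> carrier W"
    unfolding tensor_space_def module.simps
    by (rule tensor_lift_pure[OF V W T.comm_group_axioms _ _ _ _ that])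
      (simp_all add: assms bal pure_tensor_closed[OF V W] V.smult_r_distr pure_tensor_add_left
        pure_tensor_add_right)
qed

lemma vectorspace_tensor_space: "vectorspace K (tensor_space K V W)"
proof -
  let ?T = "tensor_space K V W"
  have simps: "carrier ?T = carrier (tensor_group K V W)" "add ?T = mult (tensor_group K V W)"
      "zero ?T = one (tensor_group K V W)"
    by (simp_all add: tensor_space_def)
  note hom = tensor_smult_hom and pure = tensor_smult_pure and eqI = tensor_hom_eqI[OF V W T.is_group]
  have closed: "c \<odot>\<^bsub>?T\<^esub> t \<in> carrier (tensor_group K V W)"
    if "c \<in> carrier K" "t \<in> carrier (tensor_group K V W)" for c t
    using hom[OF that(1)] that(2) by (auto simp: hom_def)
  have distr: "c \<odot>\<^bsub>?T\<^esub> (s \<otimes>\<^bsub>tensor_group K V W\<^esub> t) =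
      (c \<odot>\<^bsub>?T\<^esub> s) \<otimes>\<^bsub>tensor_group K V W\<^esub> (c \<odot>\<^bsub>?T\<^esub> t)"
    if "c \<in> carrier K" "s \<in> carrier (tensor_group K V W)" "t \<in> carrier (tensor_group K V W)" for c s t
    using hom_mult[OF hom[OF that(1)] that(2,3)] by simp
  have assoc: "(a \<otimes>\<^bsub>K\<^esub> b) \<odot>\<^bsub>?T\<^esub> t = a \<odot>\<^bsub>?T\<^esub> (b \<odot>\<^bsub>?T\<^esub> t)"
    if ab: "a \<in> carrier K" "b \<in> carrier K" and t: "t \<in> carrier (tensor_group K V W)" for a b t
  proof (rule eqI[OF _ _ _ t])
    show "(\<lambda>t. a \<odot>\<^bsub>?T\<^esub> (b \<odot>\<^bsub>?T\<^esub> t)) \<in> hom (tensor_group K V W) (tensor_group K V W)"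
      using ab by (intro homI) (simp_all add: closed distr)
  qed (simp_all add: ab hom pure V.smult_assoc1)
  have l_distr: "(a \<oplus>\<^bsub>K\<^esub> b) \<odot>\<^bsub>?T\<^esub> t = (a \<odot>\<^bsub>?T\<^esub> t) \<otimes>\<^bsub>tensor_group K V W\<^esub> (b \<odot>\<^bsub>?T\<^esub> t)"
    if ab: "a \<in> carrier K" "b \<in> carrier K" and t: "t \<in> carrier (tensor_group K V W)" for a b t
  proof (rule eqI[OF _ _ _ t])
    show "(\<lambda>t. (a \<odot>\<^bsub>?T\<^esub> t) \<otimes>\<^bsub>tensor_group K V W\<^esub> (b \<odot>\<^bsub>?T\<^esub> t))
        \<in> hom (tensor_group K V W) (tensor_group K V W)"
      using ab by (intro homI) (simp_all add: closed distr T.m_ac)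
  qed (simp_all add: ab hom pure V.smult_l_distr pure_tensor_add_left)
  have one: "\<one>\<^bsub>K\<^esub> \<odot>\<^bsub>?T\<^esub> t = t" if t: "t \<in> carrier (tensor_group K V W)" for t
  proof (rule eqI[OF _ _ _ t])
    show "(\<lambda>t. t) \<in> hom (tensor_group K V W) (tensor_group K V W)" by (intro homI) simp_all
  qed (simp_all add: hom pure)
  show ?thesis
  proof (rule vs_criteria)
    show "\<forall>v\<in>carrier ?T. \<exists>neg_v\<in>carrier ?T. v \<oplus>\<^bsub>?T\<^esub> neg_v = \<zero>\<^bsub>?T\<^esub>"
      unfolding simps using T.r_inv T.inv_closed by blast
  qed (auto simp: simps V.field_axioms closed distr assoc l_distr one T.m_ac)
qed

end


section \<open>The radicals annihilate irreducible modules of every type\<close>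

lemma linear_mapD:
  assumes "linear_map K V W T"
  shows "vectorspace K V" "vectorspace K W"
    and "v \<in> carrier V \<Longrightarrow> T v \<in> carrier W"
    and "\<lbrakk>v \<in> carrier V; v' \<in> carrier V\<rbrakk> \<Longrightarrow> T (v \<oplus>\<^bsub>V\<^esub> v') = T v \<oplus>\<^bsub>W\<^esub> T v'"
    and "\<lbrakk>c \<in> carrier K; v \<in> carrier V\<rbrakk> \<Longrightarrow> T (c \<odot>\<^bsub>V\<^esub> v) = c \<odot>\<^bsub>W\<^esub> T v"
    and "T \<zero>\<^bsub>V\<^esub> = \<zero>\<^bsub>W\<^esub>"
proof -
  interpret T: linear_map K V W T by fact
  show "vectorspace K V" "vectorspace K W" by unfold_locales
  show "v \<in> carrier V \<Longrightarrow> T v \<in> carrier W"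
    and "\<lbrakk>v \<in> carrier V; v' \<in> carrier V\<rbrakk> \<Longrightarrow> T (v \<oplus>\<^bsub>V\<^esub> v') = T v \<oplus>\<^bsub>W\<^esub> T v'"
    and "\<lbrakk>c \<in> carrier K; v \<in> carrier V\<rbrakk> \<Longrightarrow> T (c \<odot>\<^bsub>V\<^esub> v) = c \<odot>\<^bsub>W\<^esub> T v"
    and "T \<zero>\<^bsub>V\<^esub> = \<zero>\<^bsub>W\<^esub>" by simp_all
qed

lemma linear_mapI:
  assumes "vectorspace K V" "vectorspace K W"
    and "\<And>v. v \<in> carrier V \<Longrightarrow> T v \<in> carrier W"
    and "\<And>v v'. \<lbrakk>v \<in> carrier V; v' \<in> carrier V\<rbrakk> \<Longrightarrow> T (v \<oplus>\<^bsub>V\<^esub> v') = T v \<oplus>\<^bsub>W\<^esub> T v'"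
    and "\<And>c v. \<lbrakk>c \<in> carrier K; v \<in> carrier V\<rbrakk> \<Longrightarrow> T (c \<odot>\<^bsub>V\<^esub> v) = c \<odot>\<^bsub>W\<^esub> T v"
  shows "linear_map K V W T"
  using assms
  unfolding linear_map_def mod_hom_def mod_hom_axioms_def module_hom_def vectorspace_def by auto

lemma bilinear_mapD:
  assumes "bilinear_map K V W P \<beta>"
  shows "v \<in> carrier V \<Longrightarrow> linear_map K W P (\<beta> v)"
    and "w \<in> carrier W \<Longrightarrow> linear_map K V P (\<lambda>v. \<beta> v w)"
  using assms by (auto simp: bilinear_map_def)

lemma bilinear_tensor_lift:
  assumes "vectorspace K V" "vectorspace K W" "vectorspace K P" "bilinear_map K V W P \<beta>"
  shows "tensor_lift K V W (add_monoid P) \<beta> \<in> hom (tensor_group K V W) (add_monoid P)"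
    and "\<lbrakk>v \<in> carrier V; w \<in> carrier W\<rbrakk> \<Longrightarrow>
           tensor_lift K V W (add_monoid P) \<beta> (pure_tensor K V W v w) = \<beta> v w"
proof -
  interpret P: vectorspace K P by fact
  note \<beta> = bilinear_mapD[OF assms(4)]
  have G: "comm_group (add_monoid P)" by (rule P.M.a_comm_group)
  note lin = linear_mapD(3-5)[OF \<beta>(1)] linear_mapD(3-5)[OF \<beta>(2)]
  show "tensor_lift K V W (add_monoid P) \<beta> \<in> hom (tensor_group K V W) (add_monoid P)"
    by (rule tensor_lift_hom[OF assms(1,2) G]) (simp_all add: lin)
  show "tensor_lift K V W (add_monoid P) \<beta> (pure_tensor K V W v w) = \<beta> v w"
    if "v \<in> carrier V" "w \<in> carrier W"
    by (rule tensor_lift_pure[OF assms(1,2) G _ _ _ _ that]) (simp_all add: lin)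
qed

lemma tensor_hom_in_subgroup:
  assumes V: "vectorspace K V" and W: "vectorspace K W" and G: "comm_group G"
    and \<phi>: "\<phi> \<in> hom (tensor_group K V W) G" and N: "subgroup N G"
    and pure: "\<And>v w. \<lbrakk>v \<in> carrier V; w \<in> carrier W\<rbrakk> \<Longrightarrow> \<phi> (pure_tensor K V W v w) \<in> N"
    and t: "t \<in> carrier (tensor_group K V W)"
  shows "\<phi> t \<in> N"
proof -
  interpret G: comm_group G by (rule G)
  have normal: "N \<lhd> G" using N G.normal_iff_subgroup by blast
  interpret N: normal N G by (rule normal)
  have q: "(\<lambda>x. N #>\<^bsub>G\<^esub> x) \<in> hom G (G Mod N)" by (rule N.r_coset_hom_Mod)
  interpret Q: group "G Mod N" by (rule N.factorgroup_is_group)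
  have "((\<lambda>x. N #>\<^bsub>G\<^esub> x) \<circ> \<phi>) t = (\<lambda>_. \<one>\<^bsub>G Mod N\<^esub>) t"
  proof (rule tensor_hom_eqI[OF V W N.factorgroup_is_group _ _ _ t])
    show "(\<lambda>x. N #>\<^bsub>G\<^esub> x) \<circ> \<phi> \<in> hom (tensor_group K V W) (G Mod N)"
      using \<phi> q by (rule hom_compose)
    show "(\<lambda>_. \<one>\<^bsub>G Mod N\<^esub>) \<in> hom (tensor_group K V W) (G Mod N)"
      by (rule homI) (simp_all only: Q.one_closed Q.l_one)
    show "((\<lambda>x. N #>\<^bsub>G\<^esub> x) \<circ> \<phi>) (pure_tensor K V W v w) = \<one>\<^bsub>G Mod N\<^esub>"
      if "v \<in> carrier V" "w \<in> carrier W" for v w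
      using pure[OF that] N G.coset_join2[OF _ N] N.subset by auto
  qed
  then have "N #>\<^bsub>G\<^esub> \<phi> t = N" by simp
  moreover have "\<phi> t \<in> carrier G" using \<phi> t by (auto simp: hom_def)
  ultimately show ?thesis using G.rcos_self N by blast
qed

text \<open>Transport of structure along an injection \<open>f\<close>.\<close>

definition transport_space ::
    "('v \<Rightarrow> 'w) \<Rightarrow> ('k, 'v, 'y) module_scheme \<Rightarrow> ('k, 'w) module" where
  "transport_space f V =
     \<lparr>carrier = f ` carrier V, mult = (\<lambda>_ _. f \<zero>\<^bsub>V\<^esub>), one = f \<zero>\<^bsub>V\<^esub>, zero = f \<zero>\<^bsub>V\<^esub>,
      add = (\<lambda>x y. f (inv_into (carrier V) f x \<oplus>\<^bsub>V\<^esub> inv_into (carrier V) f y)),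
      smult = (\<lambda>c x. f (c \<odot>\<^bsub>V\<^esub> inv_into (carrier V) f x))\<rparr>"

definition transport_action ::
    "('v \<Rightarrow> 'w) \<Rightarrow> ('k, 'v, 'y) module_scheme \<Rightarrow> ('a \<Rightarrow> 'v \<Rightarrow> 'v) \<Rightarrow> 'a \<Rightarrow> 'w \<Rightarrow> 'w" where
  "transport_action f V act a x = f (act a (inv_into (carrier V) f x))"

context
  fixes K :: "('k, 'x) ring_scheme" and V :: "('k, 'v, 'y) module_scheme" and f :: "'v \<Rightarrow> 'w"
  assumes V: "vectorspace K V" and inj: "inj_on f (carrier V)"
begin

interpretation V: vectorspace K V by (rule V)

lemma transport_simps:
  "carrier (transport_space f V) = f ` carrier V"
  "\<zero>\<^bsub>transport_space f V\<^esub> = f \<zero>\<^bsub>V\<^esub>"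
  "\<lbrakk>v \<in> carrier V; v' \<in> carrier V\<rbrakk> \<Longrightarrow> f v \<oplus>\<^bsub>transport_space f V\<^esub> f v' = f (v \<oplus>\<^bsub>V\<^esub> v')"
  "v \<in> carrier V \<Longrightarrow> c \<odot>\<^bsub>transport_space f V\<^esub> f v = f (c \<odot>\<^bsub>V\<^esub> v)"
  "v \<in> carrier V \<Longrightarrow> transport_action f V act a (f v) = f (act a v)"
  using inj by (simp_all add: transport_space_def transport_action_def)

lemma vectorspace_transport: "vectorspace K (transport_space f V)"
proof (rule vs_criteria)
  show "\<forall>v\<in>carrier (transport_space f V). \<exists>neg_v\<in>carrier (transport_space f V).
      v \<oplus>\<^bsub>transport_space f V\<^esub> neg_v = \<zero>\<^bsub>transport_space f V\<^esub>"
  proof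
    fix x assume "x \<in> carrier (transport_space f V)"
    then obtain v where "v \<in> carrier V" "x = f v" by (auto simp: transport_simps)
    then show "\<exists>neg_v\<in>carrier (transport_space f V).
        x \<oplus>\<^bsub>transport_space f V\<^esub> neg_v = \<zero>\<^bsub>transport_space f V\<^esub>"
      by (intro bexI[of _ "f (\<ominus>\<^bsub>V\<^esub> v)"]) (auto simp: transport_simps V.r_neg)
  qed
qed (auto simp: transport_simps V.field_axioms V.M.a_ac V.smult_assoc1 V.smult_l_distr
        V.smult_r_distr)

lemma bilinear_map_transport:
  assumes "vectorspace K A" "bilinear_map K A V V act"
  shows "bilinear_map K A (transport_space f V) (transport_space f V) (transport_action f V act)"
  unfolding bilinear_map_def
proof (intro conjI ballI linear_mapI vectorspace_transport assms(1))
qed (use linear_mapD[OF bilinear_mapD(1)[OF assms(2)]] linear_mapD[OF bilinear_mapD(2)[OF assms(2)]]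
     in \<open>auto simp: transport_simps\<close>)

lemma subspace_transport:
  assumes "VectorSpace.subspace K N (transport_space f V)"
  obtains N' where "VectorSpace.subspace K N' V" "N = f ` N'"
proof
  define N' where "N' = {v \<in> carrier V. f v \<in> N}"
  have N: "submodule K N (transport_space f V)"
    using assms by (simp add: VectorSpace.subspace_def)
  show "VectorSpace.subspace K N' V"
    unfolding VectorSpace.subspace_def submodule_def
    using submodule.m_closed[OF N] submodule.zero_closed[OF N] submodule.smult_closed[OF N]
    by (auto simp: V V.module_axioms N'_def transport_simps
          simp flip: transport_simps(3,4))
  show "N = f ` N'"
    using submodule.subset[OF N] by (auto simp: N'_def transport_simps)
qed

end

lemma (in irreducible_module) irreducible_module_transport:
  assumes inj: "inj_on f (carrier M)" and A: "vectorspace K A"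
    and A_mult: "\<And>a b. \<lbrakk>a \<in> carrier A; b \<in> carrier A\<rbrakk> \<Longrightarrow> a \<otimes>\<^bsub>A\<^esub> b \<in> carrier A"
  shows "irreducible_module K A (transport_space f M) (transport_action f M act)"
proof -
  note smp = transport_simps[OF vectorspace_axioms inj]
  note act_closed = linear_mapD(3)[OF bilinear_mapD(1)[OF act_bilinear]]
  show ?thesis
  proof (intro irreducible_module.intro algebra_module.intro algebra_module_axioms.intro
      irreducible_module_axioms.intro vectorspace_transport[OF vectorspace_axioms inj]
      bilinear_map_transport[OF vectorspace_axioms inj A act_bilinear])
    show "transport_action f M act (a \<otimes>\<^bsub>A\<^esub> b) m =
        transport_action f M act a (transport_action f M act b m)"
      if "a \<in> carrier A" "b \<in> carrier A" "m \<in> carrier (transport_space f M)" for a b m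
      using that by (auto simp: smp act_mult act_closed)
    obtain a m where am: "a \<in> carrier A" "m \<in> carrier M" "act a m \<noteq> \<zero>" using act_nonzero by blast
    then have "f (act a m) \<noteq> f \<zero>" using inj act_closed by (auto dest: inj_onD)
    with am show "\<exists>a\<in>carrier A. \<exists>m\<in>carrier (transport_space f M).
        transport_action f M act a m \<noteq> \<zero>\<^bsub>transport_space f M\<^esub>"
      by (auto simp: smp)
    fix N assume sub: "VectorSpace.subspace K N (transport_space f M)"
      and closed: "\<And>a n. \<lbrakk>a \<in> carrier A; n \<in> N\<rbrakk> \<Longrightarrow> transport_action f M act a n \<in> N"
    obtain N' where N': "VectorSpace.subspace K N' M" "N = f ` N'"
      using subspace_transport[OF vectorspace_axioms inj sub] .
    then have N'_sub: "N' \<subseteq> carrier M"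
      by (auto simp: VectorSpace.subspace_def submodule_def)
    have "act a n \<in> N'" if "a \<in> carrier A" "n \<in> N'" for a n
      using closed[of a "f n"] that N' N'_sub inj act_closed[of a n]
      by (auto simp: smp subset_iff inj_on_image_mem_iff[OF inj])
    from no_proper_submodule[OF N'(1) this]
    show "N = {\<zero>\<^bsub>transport_space f M\<^esub>} \<or> N = carrier (transport_space f M)"
      using N'(2) by (auto simp: smp)
  qed
qed

lemma jacobson_radical_annihilates:
  fixes A :: "('k, 'a, 'y) module_scheme" and M :: "('k, 'm, 'z) module_scheme"
  assumes A_mult: "\<And>a b. \<lbrakk>a \<in> carrier A; b \<in> carrier A\<rbrakk> \<Longrightarrow> a \<otimes>\<^bsub>A\<^esub> b \<in> carrier A"
    and M: "irreducible_module K A M act"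
    and x: "x \<in> jacobson_radical K A" and n: "n \<in> carrier M"
  shows "act x n = \<zero>\<^bsub>M\<^esub>"
proof -
  interpret M: irreducible_module K A M act by (rule M)
  note act_lin = bilinear_mapD[OF M.act_bilinear]
  obtain a m where am: "a \<in> carrier A" "m \<in> carrier M" "act a m \<noteq> \<zero>\<^bsub>M\<^esub>"
    using M.act_nonzero by blast
  have lin: "linear_map K A M (\<lambda>a. act a m)" by (rule act_lin(2)[OF am(2)])
  note act_closed = linear_mapD(3)[OF act_lin(1)]
  let ?N = "(\<lambda>a. act a m) ` carrier A"
  have "VectorSpace.subspace K ?N M"
    using linear_map.imT_is_subspace[OF lin] mod_hom.im_def linear_map.axioms(3)[OF lin] by metis
  moreover have "act b k \<in> ?N" if "b \<in> carrier A" "k \<in> ?N" for b k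
    using that am(2) A_mult by (auto simp flip: M.act_mult)
  ultimately have N: "?N = carrier M" using M.no_proper_submodule am by blast
  define f where "f k = {a \<in> carrier A. act a m = k}" for k
  have inj: "inj_on f (carrier M)"
  proof (rule inj_onI)
    fix k l assume "k \<in> carrier M" "f k = f l"
    moreover from this obtain a where "a \<in> carrier A" "act a m = k" unfolding N[symmetric] by blast
    ultimately show "k = l" unfolding f_def by blast
  qed
  have "irreducible_module K A (transport_space f M) (transport_action f M act)"
    using linear_mapD(1)[OF lin] by (rule M.irreducible_module_transport[OF inj _ A_mult])
  then have "\<forall>y\<in>carrier (transport_space f M).
      transport_action f M act x y = \<zero>\<^bsub>transport_space f M\<^esub>"
    using x unfolding jacobson_radical_def by blast
  then have "f (act x n) = f \<zero>\<^bsub>M\<^esub>"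
    using n by (simp add: transport_simps[OF M.vectorspace_axioms inj])
  then show ?thesis
    using x n act_closed[of x n] inj_onD[OF inj] by (auto simp: jacobson_radical_def)
qed

lemma tensor_lift_cong:
  assumes "\<And>v w. \<lbrakk>v \<in> carrier V; w \<in> carrier W\<rbrakk> \<Longrightarrow> \<beta> v w = \<gamma> v w"
  shows "tensor_lift K V W G \<beta> = tensor_lift K V W G \<gamma>"
  unfolding tensor_lift_def using assms by (simp cong: ball_cong)

lemma (in RH_module) hact_ract_bilinear:
  assumes act: "bilinear_map K H R R act" and a: "a \<in> carrier R" and m: "m \<in> carrier M"
  shows "bilinear_map K H H M (\<lambda>h\<^sub>1 h\<^sub>2. ract (act h\<^sub>1 a) (hact h\<^sub>2 m))"
proof -
  note ac = bilinear_mapD(2)[OF act a]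
  note ha = bilinear_mapD(2)[OF HM.act_bilinear m]
  note ra = bilinear_mapD[OF act_bilinear]
  show ?thesis
    unfolding bilinear_map_def
  proof (intro conjI ballI linear_mapI)
  qed (simp_all add: linear_mapD(1,2)[OF ac] linear_mapD(1,2)[OF ha] linear_mapD(3-5)[OF ac]
        linear_mapD(3-5)[OF ha] linear_mapD(3-5)[OF ra(1)] linear_mapD(3-5)[OF ra(2)])
qed

lemma (in irreducible_RH_module) irreducible_RH_module_transport:
  assumes inj: "inj_on f (carrier M)" and H: "unital_algebra K H" and R: "unital_algebra K R"
    and \<Delta>: "\<And>h. h \<in> carrier H \<Longrightarrow> \<Delta> h \<in> carrier (tensor_group K H H)"
    and act: "bilinear_map K H R R act"
  shows "irreducible_RH_module K H \<Delta> R act (transport_space f M)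
           (transport_action f M ract) (transport_action f M hact)"
proof -
  interpret H: unital_algebra K H by (rule H)
  interpret R: unital_algebra K R by (rule R)
  have M: "vectorspace K M" by unfold_locales
  have V: "vectorspace K H" "vectorspace K R" by unfold_locales
  note smp = transport_simps[OF M inj]
  note T = vectorspace_transport[OF M inj]
  interpret T: vectorspace K "transport_space f M" by (rule T)
  note r_closed = linear_mapD(3)[OF bilinear_mapD(1)[OF act_bilinear]]
  note h_closed = linear_mapD(3)[OF bilinear_mapD(1)[OF HM.act_bilinear]]
  note a_closed = linear_mapD(3)[OF bilinear_mapD(1)[OF act]]
  have sweedler_eq: "transport_action f M hact h (transport_action f M ract a (f m)) =
      sweedler K H \<Delta> (transport_space f M) h (\<lambda>h\<^sub>1 h\<^sub>2.
        transport_action f M ract (act h\<^sub>1 a) (transport_action f M hact h\<^sub>2 (f m)))"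
    if h: "h \<in> carrier H" and a: "a \<in> carrier R" and m: "m \<in> carrier M" for h a m
  proof -
    let ?F = "\<lambda>h\<^sub>1 h\<^sub>2. ract (act h\<^sub>1 a) (hact h\<^sub>2 m)"
    let ?F' = "\<lambda>h\<^sub>1 h\<^sub>2. f (?F h\<^sub>1 h\<^sub>2)"
    have F: "bilinear_map K H H M ?F" by (rule hact_ract_bilinear[OF act a m])
    note Fl = bilinear_mapD[OF F]
    have F': "bilinear_map K H H (transport_space f M) ?F'"
      unfolding bilinear_map_def
    proof (intro conjI ballI linear_mapI T V)
    qed (simp_all add: smp linear_mapD(3-5)[OF Fl(1)] linear_mapD(3-5)[OF Fl(2)])
    have "f \<in> hom (add_monoid M) (add_monoid (transport_space f M))"
      by (rule homI) (auto simp: smp)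
    then have hom: "f \<circ> tensor_lift K H H (add_monoid M) ?F
        \<in> hom (tensor_group K H H) (add_monoid (transport_space f M))"
      using bilinear_tensor_lift(1)[OF V(1) V(1) M F] hom_compose by blast
    have "(f \<circ> tensor_lift K H H (add_monoid M) ?F) (\<Delta> h) =
        tensor_lift K H H (add_monoid (transport_space f M)) ?F' (\<Delta> h)"
      by (rule tensor_hom_eqI[OF V(1) V(1) T.M.a_group hom
            bilinear_tensor_lift(1)[OF V(1) V(1) T F'] _ \<Delta>[OF h]])
        (simp add: bilinear_tensor_lift(2)[OF V(1) V(1) M F]
          bilinear_tensor_lift(2)[OF V(1) V(1) T F'])
    moreover have "tensor_lift K H H (add_monoid (transport_space f M)) ?F' =
        tensor_lift K H H (add_monoid (transport_space f M)) (\<lambda>h\<^sub>1 h\<^sub>2.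
          transport_action f M ract (act h\<^sub>1 a) (transport_action f M hact h\<^sub>2 (f m)))"
      by (rule tensor_lift_cong) (simp add: smp a m h_closed)
    ultimately show ?thesis
      using h a m by (simp add: sweedler_def smp r_closed hact_ract)
  qed
  show ?thesis
  proof (intro irreducible_RH_module.intro RH_module.intro algebra_module.intro
        RH_module_axioms.intro algebra_module_axioms.intro irreducible_RH_module_axioms.intro
        T bilinear_map_transport[OF M inj V(2) act_bilinear]
        bilinear_map_transport[OF M inj V(1) HM.act_bilinear])
    show "transport_action f M ract (a \<otimes>\<^bsub>R\<^esub> b) m =
        transport_action f M ract a (transport_action f M ract b m)"
      if "a \<in> carrier R" "b \<in> carrier R" "m \<in> carrier (transport_space f M)" for a b m
      using that by (auto simp: smp act_mult r_closed)
    show "transport_action f M hact (a \<otimes>\<^bsub>H\<^esub> b) m =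
        transport_action f M hact a (transport_action f M hact b m)"
      if "a \<in> carrier H" "b \<in> carrier H" "m \<in> carrier (transport_space f M)" for a b m
      using that by (auto simp: smp HM.act_mult h_closed)
    show "transport_action f M hact \<one>\<^bsub>H\<^esub> m = m" if "m \<in> carrier (transport_space f M)" for m
      using that by (auto simp: smp hact_one)
    show "transport_action f M hact h (transport_action f M ract a m) =
        sweedler K H \<Delta> (transport_space f M) h (\<lambda>h\<^sub>1 h\<^sub>2.
          transport_action f M ract (act h\<^sub>1 a) (transport_action f M hact h\<^sub>2 m))"
      if "h \<in> carrier H" "a \<in> carrier R" "m \<in> carrier (transport_space f M)" for h a m
      using that sweedler_eq by (auto simp: smp(1))
    obtain a m where am: "a \<in> carrier R" "m \<in> carrier M" "ract a m \<noteq> \<zero>"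
      using ract_nonzero by blast
    then have "f (ract a m) \<noteq> f \<zero>" using inj r_closed by (auto dest: inj_onD)
    with am show "\<exists>a\<in>carrier R. \<exists>m\<in>carrier (transport_space f M).
        transport_action f M ract a m \<noteq> \<zero>\<^bsub>transport_space f M\<^esub>"
      by (auto simp: smp)
    fix N assume sub: "VectorSpace.subspace K N (transport_space f M)"
      and closed: "\<And>a n. \<lbrakk>a \<in> carrier R; n \<in> N\<rbrakk> \<Longrightarrow> transport_action f M ract a n \<in> N"
        "\<And>h n. \<lbrakk>h \<in> carrier H; n \<in> N\<rbrakk> \<Longrightarrow> transport_action f M hact h n \<in> N"
    obtain N' where N': "VectorSpace.subspace K N' M" "N = f ` N'"
      using subspace_transport[OF M inj sub] .
    then have N'_sub: "N' \<subseteq> carrier M"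
      by (auto simp: VectorSpace.subspace_def submodule_def)
    have 1: "ract a n \<in> N'" if "a \<in> carrier R" "n \<in> N'" for a n
      using closed(1)[of a "f n"] that N' N'_sub inj r_closed[of a n]
      by (auto simp: smp subset_iff inj_on_image_mem_iff[OF inj])
    have 2: "hact a n \<in> N'" if "a \<in> carrier H" "n \<in> N'" for a n
      using closed(2)[of a "f n"] that N' N'_sub inj h_closed[of a n]
      by (auto simp: smp subset_iff inj_on_image_mem_iff[OF inj])
    from no_proper_RH_submodule[OF N'(1) 1 2]
    show "N = {\<zero>\<^bsub>transport_space f M\<^esub>} \<or> N = carrier (transport_space f M)"
      using N'(2) by (auto simp: smp)
  qed
qed

lemma H_jacobson_radical_annihilates:
  fixes R :: "('k, 'r, 'z) module_scheme" and M :: "('k, 'm, 'q) module_scheme"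
  assumes R: "module_algebra K H \<Delta> \<epsilon> S R act"
    and M: "irreducible_RH_module K H \<Delta> R act M ract hact"
    and x: "x \<in> H_jacobson_radical K H \<Delta> R act" and n: "n \<in> carrier M"
  shows "ract x n = \<zero>\<^bsub>M\<^esub>"
proof -
  interpret R: module_algebra K H \<Delta> \<epsilon> S R act by (rule R)
  interpret M: irreducible_RH_module K H \<Delta> R act M ract hact by (rule M)
  have VM: "vectorspace K M" and VR: "vectorspace K R" and VH: "vectorspace K H"
    by unfold_locales
  have \<Delta>: "\<Delta> h \<in> carrier (tensor_group K H H)" if "h \<in> carrier H" for h
    using linear_mapD(3)[OF R.H.comult_linear that] by (simp add: tensor_space_def)
  note r = bilinear_mapD[OF M.act_bilinear] note h = bilinear_mapD[OF M.HM.act_bilinear]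
  note r1 = linear_mapD(3-5)[OF r(1)] note r2 = linear_mapD(3-5)[OF r(2)]
  note h1 = linear_mapD(3-5)[OF h(1)] note h2 = linear_mapD(3-5)[OF h(2)]
  note act_closed = linear_mapD(3)[OF bilinear_mapD(1)[OF R.act_bilinear]]
  obtain a m where am: "a \<in> carrier R" "m \<in> carrier M" "ract a m \<noteq> \<zero>\<^bsub>M\<^esub>"
    using M.ract_nonzero by blast
  let ?\<beta> = "\<lambda>a h. ract a (hact h m)"
  have \<beta>: "bilinear_map K R H M ?\<beta>"
    unfolding bilinear_map_def
  proof (intro conjI ballI linear_mapI VR VH VM)
  qed (simp_all add: am(2) r1 r2 h1 h2)
  let ?l = "tensor_lift K R H (add_monoid M) ?\<beta>"
  note l_hom = bilinear_tensor_lift(1)[OF VR VH VM \<beta>]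
  note l_pure = bilinear_tensor_lift(2)[OF VR VH VM \<beta>]
  let ?T = "carrier (tensor_group K R H)"
  let ?N = "?l ` ?T"
  have comm: "comm_group (add_monoid M)" by (rule M.M.a_comm_group)
  interpret T: comm_group "tensor_group K R H" by (rule comm_group_tensor_group[OF VR VH])
  interpret l: group_hom "tensor_group K R H" "add_monoid M" ?l
    using l_hom comm by (simp add: group_hom_def group_hom_axioms_def comm_group_def T.is_group)
  have sg: "subgroup ?N (add_monoid M)" by (rule l.img_is_subgroup)
  have \<beta>_in: "ract b (hact g m) \<in> ?N" if "b \<in> carrier R" "g \<in> carrier H" for b g
    unfolding l_pure[OF that, symmetric] by (rule imageI[OF pure_tensor_closed[OF VR VH that]])
  have l_in: "?l t \<in> carrier M" if "t \<in> ?T" for t using l.hom_closed[OF that] by simp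
  have hom_comp: "(\<lambda>t. p (?l t)) \<in> hom (tensor_group K R H) (add_monoid M)"
    if "linear_map K M M p" for p
    using linear_mapD(3,4)[OF that] l_in l.hom_mult by (intro homI) auto
  have closed: "p k \<in> ?N"
    if p: "linear_map K M M p"
      and p_in: "\<And>b g. \<lbrakk>b \<in> carrier R; g \<in> carrier H\<rbrakk> \<Longrightarrow> p (ract b (hact g m)) \<in> ?N"
      and k: "k \<in> ?N" for p k
  proof -
    obtain t where t: "t \<in> ?T" "k = ?l t" using k by blast
    show ?thesis
      unfolding t(2)
      by (rule tensor_hom_in_subgroup[OF VR VH comm hom_comp[OF p] sg _ t(1)])
        (simp only: l_pure p_in)
  qed
  have "cring K" using VM by (simp add: vectorspace_def module_def)
  note K_comm = comm_monoid.m_comm[OF cring.axioms(2)[OF this]]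
  have smult: "c \<odot>\<^bsub>M\<^esub> k \<in> ?N" if "c \<in> carrier K" "k \<in> ?N" for c k
  proof (rule closed[OF _ _ that(2)])
    show "linear_map K M M (\<lambda>k. c \<odot>\<^bsub>M\<^esub> k)"
      using that by (intro linear_mapI VM)
        (auto simp: M.smult_r_distr M.smult_assoc1[symmetric] K_comm)
    fix b g assume bg: "b \<in> carrier R" "g \<in> carrier H"
    then have "c \<odot>\<^bsub>M\<^esub> ract b (hact g m) = ract (c \<odot>\<^bsub>R\<^esub> b) (hact g m)"
      using that am(2) by (simp add: r2 h1)
    then show "c \<odot>\<^bsub>M\<^esub> ract b (hact g m) \<in> ?N"
      using \<beta>_in bg that by simp
  qed
  have sub: "VectorSpace.subspace K ?N M"
    unfolding VectorSpace.subspace_def submodule_def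
    using VM M.module_axioms l_in subgroup.m_closed[OF sg] subgroup.one_closed[OF sg] smult
    by auto
  have r_in: "ract b k \<in> ?N" if "b \<in> carrier R" "k \<in> ?N" for b k
  proof (rule closed[OF _ _ that(2)])
    show "linear_map K M M (ract b)" by (rule r(1)[OF that(1)])
    fix b' g assume bg: "b' \<in> carrier R" "g \<in> carrier H"
    then have "ract b (ract b' (hact g m)) = ract (b \<otimes>\<^bsub>R\<^esub> b') (hact g m)"
      using that am(2) by (simp add: M.act_mult h1)
    then show "ract b (ract b' (hact g m)) \<in> ?N" using \<beta>_in bg that by simp
  qed
  have h_in: "hact g k \<in> ?N" if g: "g \<in> carrier H" and k: "k \<in> ?N" for g k
  proof (rule closed[OF _ _ k])
    show "linear_map K M M (hact g)" by (rule h(1)[OF g])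
    fix b g' assume bg: "b \<in> carrier R" "g' \<in> carrier H"
    then have m': "hact g' m \<in> carrier M" using am(2) h1 by blast
    note F = M.hact_ract_bilinear[OF R.act_bilinear bg(1) m']
    have "sweedler K H \<Delta> M g (\<lambda>h\<^sub>1 h\<^sub>2. ract (act h\<^sub>1 b) (hact h\<^sub>2 (hact g' m))) \<in> ?N"
      unfolding sweedler_def
    proof (rule tensor_hom_in_subgroup[OF VH VH comm bilinear_tensor_lift(1)[OF VH VH VM F]
          sg _ \<Delta>[OF g]])
      fix h\<^sub>1 h\<^sub>2 assume hh: "h\<^sub>1 \<in> carrier H" "h\<^sub>2 \<in> carrier H"
      show "tensor_lift K H H (add_monoid M) (\<lambda>h\<^sub>1 h\<^sub>2. ract (act h\<^sub>1 b) (hact h\<^sub>2 (hact g' m)))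
              (pure_tensor K H H h\<^sub>1 h\<^sub>2) \<in> ?N"
        using bilinear_tensor_lift(2)[OF VH VH VM F hh] \<beta>_in[of "act h\<^sub>1 b" "h\<^sub>2 \<otimes>\<^bsub>H\<^esub> g'"]
          hh bg am(2) act_closed by (simp add: M.HM.act_mult)
    qed
    then show "hact g (ract b (hact g' m)) \<in> ?N" using M.hact_ract[OF g bg(1) m'] by simp
  qed
  have "ract a m \<in> ?N" using \<beta>_in[OF am(1) R.H.one_closed] M.hact_one[OF am(2)] by simp
  then have N: "?N = carrier M" using M.no_proper_RH_submodule[OF sub r_in h_in] am(3) by blast
  define f where "f k = {t \<in> ?T. ?l t = k}" for k
  have inj: "inj_on f (carrier M)"
  proof (rule inj_onI)
    fix k l assume k: "k \<in> carrier M" and "f k = f l"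
    have "k \<in> ?N" using k by (simp only: N)
    then obtain t where "t \<in> ?T" "?l t = k" by blast
    moreover note \<open>f k = f l\<close>
    ultimately show "k = l" unfolding f_def by blast
  qed
  have "irreducible_RH_module K H \<Delta> R act (transport_space f M)
          (transport_action f M ract) (transport_action f M hact)"
    by (rule M.irreducible_RH_module_transport[OF inj R.H.unital_algebra_axioms
          R.R.unital_algebra_axioms \<Delta> R.act_bilinear])
  then have "\<forall>y\<in>carrier (transport_space f M).
      transport_action f M ract x y = \<zero>\<^bsub>transport_space f M\<^esub>"
    using x unfolding H_jacobson_radical_def by blast
  then have "f (ract x n) = f \<zero>\<^bsub>M\<^esub>"
    using n by (simp add: transport_simps[OF VM inj])
  then show ?thesis
    using x n r1(1)[of x n] inj_onD[OF inj] by (auto simp: H_jacobson_radical_def)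
qed

end

theory Submission
  imports Defs
begin

text \<open>The irreducible \<open>R\<close>-\<open>H\<close>-modules are exactly the irreducible modules over \<open>R # H\<close>, where
  \<open>a # h\<close> acts as \<open>m \<mapsto> a (h m)\<close>; hence \<open>r\<^sub>H\<^sub>j(R) = r\<^sub>j(R # H) \<inter> R\<close>. So \<open>r\<^sub>H\<^sub>j(R) # H\<close> is a left ideal
  inside \<open>r\<^sub>j(R # H)\<close>; it is quasi-regular, and therefore equal to its own radical. Part (2)
  is then immediate. For (3), \<open>r\<^sub>H\<^sub>j(R)\<close> is \<open>H\<close>-stable, and it is contained in \<open>r\<^sub>j(R)\<close>
  because \<open>id \<otimes> \<epsilon>\<close> maps right inverses in \<open>R # H\<close> to right inverses in \<open>R\<close>; so it is contained in
  \<open>r\<^sub>j\<^sub>H(R)\<close>. If \<open>H\<close> is finite-dimensional, irreducible \<open>R\<close>-\<open>H\<close>-modules are finitely generated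
  over \<open>R\<close> and Nakayama's lemma gives the converse inclusion, which reduces (3) to (2).\<close>

section \<open>The Jacobson radical of a unital algebra\<close>

text \<open>Irreducible modules are not assumed unital over \<open>R\<close> or over
  \<open>R # H\<close>, so that the unit acts as the identity has to be derived from irreducibility.
  Over \<open>R\<close> this rests on \<open>h \<cdot> 1 = \<epsilon>(h) 1\<close>, because the
  vectors fixed by the unit must form an \<open>H\<close>-submodule. The algebra
  \<open>I # H\<close> for \<open>I = r_Hj(R)\<close> may lack a unit, so an inverse of
  \<open>1 - e\<close> taken in \<open>R # H\<close> does not act on its modules. That inverse is,
  however, \<open>1\<close> plus an element of the ideal, and an identity inside the ideal is enough
  to exclude irreducible modules altogether. Tensors have no chosen expression by pure tensors, so a
  Sweedler sum is the value of a linear map at \<open>\<Delta> h\<close>. Identities between such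
  sums come from the uniqueness of a linear map with given values on pure tensors. The product of
  \<open>R # H\<close> is read as the action of \<open>R # H\<close> on itself as an
  \<open>R\<close>-\<open>H\<close>-module, so that associativity is the module axiom for this
  module. Finite dimension of \<open>H\<close> enters through \<open>M = R (H m)\<close> for an
  irreducible \<open>M\<close> and \<open>m \<noteq> 0\<close>.\<close>

context algebra_module begin

lemma act_simps:
  "\<lbrakk>a \<in> carrier A; m \<in> carrier M\<rbrakk> \<Longrightarrow> act a m \<in> carrier M"
  "\<lbrakk>a \<in> carrier A; m \<in> carrier M; m' \<in> carrier M\<rbrakk> \<Longrightarrow> act a (m \<oplus> m') = act a m \<oplus> act a m'"
  "\<lbrakk>a \<in> carrier A; b \<in> carrier A; m \<in> carrier M\<rbrakk> \<Longrightarrow> act (a \<oplus>\<^bsub>A\<^esub> b) m = act a m \<oplus> act b m"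
  "\<lbrakk>a \<in> carrier A; c \<in> carrier K; m \<in> carrier M\<rbrakk> \<Longrightarrow> act a (c \<odot> m) = c \<odot> act a m"
  "\<lbrakk>a \<in> carrier A; c \<in> carrier K; m \<in> carrier M\<rbrakk> \<Longrightarrow> act (c \<odot>\<^bsub>A\<^esub> a) m = c \<odot> act a m"
  "a \<in> carrier A \<Longrightarrow> act a \<zero> = \<zero>"
  "m \<in> carrier M \<Longrightarrow> act \<zero>\<^bsub>A\<^esub> m = \<zero>"
  using linear_mapD(3-6)[OF bilinear_mapD(1)[OF act_bilinear]]
    linear_mapD(3-6)[OF bilinear_mapD(2)[OF act_bilinear]] by auto

lemma orbit_subspace: "m \<in> carrier M \<Longrightarrow> VectorSpace.subspace K ((\<lambda>a. act a m) ` carrier A) M"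
  using linear_map.imT_is_subspace mod_hom.im_def linear_map.axioms(3)
    bilinear_mapD(2)[OF act_bilinear] by metis

lemma zero_subspace: "VectorSpace.subspace K {\<zero>} M"
  unfolding VectorSpace.subspace_def submodule_def
  by (auto simp: vectorspace_axioms module_axioms)

end

section \<open>Subspaces and quotient spaces\<close>

lemma subspaceI:
  assumes "vectorspace K V" "N \<subseteq> carrier V" "\<zero>\<^bsub>V\<^esub> \<in> N"
    and "\<And>v w. \<lbrakk>v \<in> N; w \<in> N\<rbrakk> \<Longrightarrow> v \<oplus>\<^bsub>V\<^esub> w \<in> N"
    and "\<And>c v. \<lbrakk>c \<in> carrier K; v \<in> N\<rbrakk> \<Longrightarrow> c \<odot>\<^bsub>V\<^esub> v \<in> N"
  shows "VectorSpace.subspace K N V"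
  using assms unfolding VectorSpace.subspace_def submodule_def vectorspace_def by auto

lemma subspaceD:
  assumes "VectorSpace.subspace K N V"
  shows "N \<subseteq> carrier V" "\<zero>\<^bsub>V\<^esub> \<in> N"
    and "\<lbrakk>v \<in> N; w \<in> N\<rbrakk> \<Longrightarrow> v \<oplus>\<^bsub>V\<^esub> w \<in> N"
    and "\<lbrakk>c \<in> carrier K; v \<in> N\<rbrakk> \<Longrightarrow> c \<odot>\<^bsub>V\<^esub> v \<in> N"
  using assms unfolding VectorSpace.subspace_def submodule_def by auto

lemma subspace_neg:
  assumes "VectorSpace.subspace K N V" "v \<in> N"
  shows "\<ominus>\<^bsub>V\<^esub> v \<in> N"
proof -
  interpret V: vectorspace K V using assms(1) by (simp add: VectorSpace.subspace_def)
  have "(\<ominus>\<^bsub>K\<^esub> \<one>\<^bsub>K\<^esub>) \<odot>\<^bsub>V\<^esub> v \<in> N"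
    by (rule subspaceD(4)[OF assms(1) _ assms(2)]) simp
  then show ?thesis using V.smult_minus_1[of v] subspaceD(1)[OF assms(1)] assms(2) by auto
qed

text \<open>Along a map that is not injective, \<^const>\<open>transport_space\<close> yields the quotient by its
  kernel: the choice of a preimage does not matter.\<close>

context
  fixes K :: "('k, 'x) ring_scheme" and V :: "('k, 'v, 'y) module_scheme" and L :: "'v set"
  assumes L: "VectorSpace.subspace K L V"
begin

interpretation V: vectorspace K V using L by (simp add: VectorSpace.subspace_def)

text \<open>Cosets have type \<open>'v set\<close>, so for \<open>V = A\<close> the quotient is a
  module of exactly the type over which \<open>jacobson_radical\<close> quantifies.\<close>

definition coset_of :: "'v \<Rightarrow> 'v set" where
  "coset_of v = {w \<in> carrier V. w \<ominus>\<^bsub>V\<^esub> v \<in> L}"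

private lemmas Ld = subspaceD[OF L]

lemma coset_of_eq_iff:
  assumes "v \<in> carrier V" "w \<in> carrier V"
  shows "coset_of v = coset_of w \<longleftrightarrow> v \<ominus>\<^bsub>V\<^esub> w \<in> L"
proof
  assume "coset_of v = coset_of w"
  moreover have "v \<in> coset_of v" using assms Ld by (auto simp: coset_of_def V.r_neg V.minus_eq)
  ultimately show "v \<ominus>\<^bsub>V\<^esub> w \<in> L" by (simp add: coset_of_def)
next
  assume *: "v \<ominus>\<^bsub>V\<^esub> w \<in> L"
  have "u \<ominus>\<^bsub>V\<^esub> v \<in> L \<longleftrightarrow> u \<ominus>\<^bsub>V\<^esub> w \<in> L" if u: "u \<in> carrier V" for u
  proof
    assume "u \<ominus>\<^bsub>V\<^esub> v \<in> L"
    then have "(u \<ominus>\<^bsub>V\<^esub> v) \<oplus>\<^bsub>V\<^esub> (v \<ominus>\<^bsub>V\<^esub> w) \<in> L" using Ld(3) * by blast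
    moreover have "(u \<ominus>\<^bsub>V\<^esub> v) \<oplus>\<^bsub>V\<^esub> (v \<ominus>\<^bsub>V\<^esub> w) = u \<ominus>\<^bsub>V\<^esub> w"
      using u assms by (simp add: V.minus_eq V.M.a_assoc V.r_neg1)
    ultimately show "u \<ominus>\<^bsub>V\<^esub> w \<in> L" by simp
  next
    assume "u \<ominus>\<^bsub>V\<^esub> w \<in> L"
    then have "(u \<ominus>\<^bsub>V\<^esub> w) \<oplus>\<^bsub>V\<^esub> (\<ominus>\<^bsub>V\<^esub> (v \<ominus>\<^bsub>V\<^esub> w)) \<in> L" using Ld(3) * subspace_neg[OF L] by blast
    moreover have "(u \<ominus>\<^bsub>V\<^esub> w) \<oplus>\<^bsub>V\<^esub> (\<ominus>\<^bsub>V\<^esub> (v \<ominus>\<^bsub>V\<^esub> w)) = u \<ominus>\<^bsub>V\<^esub> v"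
      using u assms by (simp add: V.minus_eq V.minus_add V.M.a_assoc V.M.a_comm[of "\<ominus>\<^bsub>V\<^esub> v" w]
        V.r_neg1)
    ultimately show "u \<ominus>\<^bsub>V\<^esub> v \<in> L" by simp
  qed
  then show "coset_of v = coset_of w" by (auto simp: coset_of_def)
qed

abbreviation quotient_space :: "('k, 'v set) module" where
  "quotient_space \<equiv> transport_space coset_of V"

text \<open>\<open>inv_into\<close> returns an arbitrary representative of the coset. That it
  differs from \<open>v\<close> by an element of \<open>L\<close> is all that is needed to see that
  operations on the quotient are well defined.\<close>

lemma coset_rep:
  assumes "v \<in> carrier V"
  obtains l where "l \<in> L" "inv_into (carrier V) coset_of (coset_of v) = v \<oplus>\<^bsub>V\<^esub> l"
proof
  let ?w = "inv_into (carrier V) coset_of (coset_of v)"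
  have "coset_of ?w = coset_of v" by (rule f_inv_into_f) (use assms in blast)
  moreover have w: "?w \<in> carrier V" by (rule inv_into_into) (use assms in blast)
  ultimately show "?w \<ominus>\<^bsub>V\<^esub> v \<in> L" using assms coset_of_eq_iff by blast
  show "?w = v \<oplus>\<^bsub>V\<^esub> (?w \<ominus>\<^bsub>V\<^esub> v)" using w assms by (simp add: V.minus_eq V.M.a_lcomm[of v] V.r_neg)
qed

lemma coset_of_add_L: "\<lbrakk>v \<in> carrier V; l \<in> L\<rbrakk> \<Longrightarrow> coset_of (v \<oplus>\<^bsub>V\<^esub> l) = coset_of v"
  using Ld(1) by (subst coset_of_eq_iff)
    (auto simp: V.minus_eq V.M.a_assoc V.M.a_comm[of l] V.r_neg2)

lemma quotient_simps:
  "carrier quotient_space = coset_of ` carrier V"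
  "\<zero>\<^bsub>quotient_space\<^esub> = coset_of \<zero>\<^bsub>V\<^esub>"
  "\<lbrakk>v \<in> carrier V; w \<in> carrier V\<rbrakk> \<Longrightarrow>
     coset_of v \<oplus>\<^bsub>quotient_space\<^esub> coset_of w = coset_of (v \<oplus>\<^bsub>V\<^esub> w)"
  "\<lbrakk>v \<in> carrier V; c \<in> carrier K\<rbrakk> \<Longrightarrow> c \<odot>\<^bsub>quotient_space\<^esub> coset_of v = coset_of (c \<odot>\<^bsub>V\<^esub> v)"
proof -
  show "coset_of v \<oplus>\<^bsub>quotient_space\<^esub> coset_of w = coset_of (v \<oplus>\<^bsub>V\<^esub> w)"
    if vw: "v \<in> carrier V" "w \<in> carrier V"
  proof -
    obtain l where l: "l \<in> L" "inv_into (carrier V) coset_of (coset_of v) = v \<oplus>\<^bsub>V\<^esub> l"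
      using coset_rep[OF vw(1)] .
    obtain k where k: "k \<in> L" "inv_into (carrier V) coset_of (coset_of w) = w \<oplus>\<^bsub>V\<^esub> k"
      using coset_rep[OF vw(2)] .
    have "l \<in> carrier V" "k \<in> carrier V" using Ld(1) l k by auto
    then have "v \<oplus>\<^bsub>V\<^esub> l \<oplus>\<^bsub>V\<^esub> (w \<oplus>\<^bsub>V\<^esub> k) = v \<oplus>\<^bsub>V\<^esub> w \<oplus>\<^bsub>V\<^esub> (l \<oplus>\<^bsub>V\<^esub> k)"
      using vw by (simp add: V.M.a_ac)
    then show ?thesis
      using l k vw by (simp add: transport_space_def coset_of_add_L Ld(3))
  qed
  show "c \<odot>\<^bsub>quotient_space\<^esub> coset_of v = coset_of (c \<odot>\<^bsub>V\<^esub> v)"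
    if vc: "v \<in> carrier V" "c \<in> carrier K"
  proof -
    obtain l where l: "l \<in> L" "inv_into (carrier V) coset_of (coset_of v) = v \<oplus>\<^bsub>V\<^esub> l"
      using coset_rep[OF vc(1)] .
    have "l \<in> carrier V" using Ld(1) l by auto
    then show ?thesis
      using l vc by (simp add: transport_space_def coset_of_add_L Ld(4) V.smult_r_distr)
  qed
qed (simp_all add: transport_space_def)

lemma vectorspace_quotient: "vectorspace K quotient_space"
proof (rule vs_criteria)
  show "\<forall>v\<in>carrier quotient_space. \<exists>neg_v\<in>carrier quotient_space.
      v \<oplus>\<^bsub>quotient_space\<^esub> neg_v = \<zero>\<^bsub>quotient_space\<^esub>"
  proof
    fix x assume "x \<in> carrier quotient_space"
    then obtain v where "v \<in> carrier V" "x = coset_of v" by (auto simp: quotient_simps)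
    then show "\<exists>neg_v\<in>carrier quotient_space. x \<oplus>\<^bsub>quotient_space\<^esub> neg_v = \<zero>\<^bsub>quotient_space\<^esub>"
      by (intro bexI[of _ "coset_of (\<ominus>\<^bsub>V\<^esub> v)"]) (auto simp: quotient_simps V.r_neg)
  qed
qed (auto simp: quotient_simps V.field_axioms V.M.a_ac V.smult_assoc1 V.smult_l_distr
        V.smult_r_distr)

lemma quotient_action:
  assumes "linear_map K V V (act a)" "\<And>l. l \<in> L \<Longrightarrow> act a l \<in> L" "v \<in> carrier V"
  shows "transport_action coset_of V act a (coset_of v) = coset_of (act a v)"
proof -
  obtain l where l: "l \<in> L" "inv_into (carrier V) coset_of (coset_of v) = v \<oplus>\<^bsub>V\<^esub> l"
    using coset_rep[OF assms(3)] .
  then show ?thesis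
    using assms(2,3) linear_mapD(3,4)[OF assms(1)] Ld(1)
    by (auto simp: transport_action_def coset_of_add_L subset_iff)
qed

end

text \<open>Negatives and scalar multiples are not mentioned: in a unital algebra they arise by left
  multiplication with multiples of the unit.\<close>

definition left_ideal :: "('a, 'y) ring_scheme \<Rightarrow> 'a set \<Rightarrow> bool" where
  "left_ideal A L \<longleftrightarrow> L \<subseteq> carrier A \<and> \<zero>\<^bsub>A\<^esub> \<in> L \<and> (\<forall>x\<in>L. \<forall>y\<in>L. x \<oplus>\<^bsub>A\<^esub> y \<in> L) \<and>
     (\<forall>a\<in>carrier A. \<forall>x\<in>L. a \<otimes>\<^bsub>A\<^esub> x \<in> L)"

lemma left_idealD:
  assumes "left_ideal A L"
  shows "L \<subseteq> carrier A" "x \<in> L \<Longrightarrow> x \<in> carrier A" "\<zero>\<^bsub>A\<^esub> \<in> L"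
    and "\<lbrakk>x \<in> L; y \<in> L\<rbrakk> \<Longrightarrow> x \<oplus>\<^bsub>A\<^esub> y \<in> L"
    and "\<lbrakk>a \<in> carrier A; x \<in> L\<rbrakk> \<Longrightarrow> a \<otimes>\<^bsub>A\<^esub> x \<in> L"
  using assms by (auto simp: left_ideal_def)

section \<open>Maximal left ideals and their simple quotients\<close>

context unital_algebra begin

text \<open>Scalars act as left multiplication by \<open>c \<odot> \<one>\<close>.\<close>

lemma left_ideal_subspace:
  assumes "left_ideal A L"
  shows "VectorSpace.subspace K L A"
proof (rule subspaceI)
  note L = left_idealD[OF assms]
  show "vectorspace K A" by unfold_locales
  show "c \<odot> v \<in> L" if "c \<in> carrier K" "v \<in> L" for c v
    using L(5)[of "c \<odot> \<one>" v] smult_mult_left[of c \<one> v] L(2)[OF that(2)] that by simp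
qed (use left_idealD[OF assms] in auto)

lemma left_ideal_Union_chain:
  assumes "C \<noteq> {}" "subset.chain (Collect (left_ideal A)) C"
  shows "left_ideal A (\<Union>C)"
proof -
  have C: "left_ideal A N" if "N \<in> C" for N using that assms(2) by (auto simp: subset_chain_def)
  have "x \<oplus> y \<in> \<Union>C" if "x \<in> X" "X \<in> C" "y \<in> Y" "Y \<in> C" for x y X Y
  proof -
    have "X \<subseteq> Y \<or> Y \<subseteq> X" using assms(2) that by (auto simp: subset_chain_def)
    then show ?thesis using that left_idealD(4)[OF C] by blast
  qed
  moreover have "\<Union>C \<subseteq> carrier A" using left_idealD(1)[OF C] by (rule Union_least)
  moreover have "\<zero> \<in> \<Union>C" using left_idealD(3)[OF C] assms(1) by auto
  moreover have "a \<otimes> x \<in> \<Union>C" if "a \<in> carrier A" "x \<in> X" "X \<in> C" for a x X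
    using left_idealD(5)[OF C] that by auto
  ultimately show ?thesis unfolding left_ideal_def by auto
qed

text \<open>Zorn's lemma applies because properness of a left ideal is the single condition
  \<open>\<one> \<notin> N\<close>, which survives unions of chains.\<close>

lemma left_ideal_in_maximal:
  assumes L: "left_ideal A L" and "\<one> \<notin> L"
  obtains N where "left_ideal A N" "L \<subseteq> N" "\<one> \<notin> N"
    and "\<And>N'. \<lbrakk>left_ideal A N'; N \<subseteq> N'; \<one> \<notin> N'\<rbrakk> \<Longrightarrow> N' = N"
proof -
  let ?S = "{N. left_ideal A N \<and> L \<subseteq> N \<and> \<one> \<notin> N}"
  have "\<exists>N\<in>?S. \<forall>X\<in>?S. N \<subseteq> X \<longrightarrow> X = N"
  proof (rule subset_Zorn_nonempty)
    show "?S \<noteq> {}" using assms by blast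
    fix C assume C: "C \<noteq> {}" "subset.chain ?S C"
    then have "subset.chain (Collect (left_ideal A)) C"
      by (auto simp: subset_chain_def)
    with C have "left_ideal A (\<Union>C)" using left_ideal_Union_chain by blast
    then show "\<Union>C \<in> ?S" using C by (auto simp: subset_chain_def)
  qed
  then obtain N where "N \<in> ?S" "\<forall>X\<in>?S. N \<subseteq> X \<longrightarrow> X = N" ..
  then show thesis by (intro that[of N]) auto
qed

text \<open>The preimage \<open>L'\<close> of a submodule of \<open>A / L\<close> is a left ideal
  containing \<open>L\<close>. By maximality it is \<open>L\<close> or contains the unit, and these
  two cases give the zero submodule and the whole quotient. The action is nonzero because the coset
  of \<open>\<one>\<close> is fixed by \<open>\<one>\<close>.\<close>

lemma quotient_irreducible:
  assumes L: "left_ideal A L" "\<one> \<notin> L"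
    and max: "\<And>L'. \<lbrakk>left_ideal A L'; L \<subseteq> L'; \<one> \<notin> L'\<rbrakk> \<Longrightarrow> L' = L"
  shows "irreducible_module K A (quotient_space A L)
           (transport_action (coset_of A L) A (\<otimes>))"
proof -
  note Ld = left_idealD[OF L(1)]
  have V: "vectorspace K A" by unfold_locales
  have lin: "linear_map K A A ((\<otimes>) a)" if "a \<in> carrier A" for a
    using that by (intro linear_mapI V) (auto simp: r_distr smult_mult_right)
  note sub = left_ideal_subspace[OF L(1)]
  note q = quotient_simps[OF sub]
  have qact: "transport_action (coset_of A L) A (\<otimes>) a (coset_of A L v) = coset_of A L (a \<otimes> v)"
    if "a \<in> carrier A" "v \<in> carrier A" for a v
    by (rule quotient_action[where act = "(\<otimes>)", OF sub lin[OF that(1)] Ld(5)[OF that(1)] that(2)])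
  note Q = vectorspace_quotient[OF sub]
  show ?thesis
  proof (intro irreducible_module.intro algebra_module.intro algebra_module_axioms.intro
      irreducible_module_axioms.intro Q)
    show "bilinear_map K A (quotient_space A L) (quotient_space A L)
        (transport_action (coset_of A L) A (\<otimes>))"
      unfolding bilinear_map_def
      by (intro conjI ballI linear_mapI V Q)
        (auto simp: q qact r_distr l_distr smult_mult_left smult_mult_right)
    show "transport_action (coset_of A L) A (\<otimes>) (a \<otimes> b) m =
        transport_action (coset_of A L) A (\<otimes>) a (transport_action (coset_of A L) A (\<otimes>) b m)"
      if "a \<in> carrier A" "b \<in> carrier A" "m \<in> carrier (quotient_space A L)" for a b m
      using that by (auto simp: q qact m_assoc)
    have "coset_of A L \<one> \<noteq> coset_of A L \<zero>"
      using coset_of_eq_iff[OF sub, of \<one> \<zero>] L(2) by (simp add: minus_eq)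
    then show "\<exists>a\<in>carrier A. \<exists>m\<in>carrier (quotient_space A L).
        transport_action (coset_of A L) A (\<otimes>) a m \<noteq> \<zero>\<^bsub>quotient_space A L\<^esub>"
      by (intro bexI[of _ \<one>] bexI[of _ "coset_of A L \<one>"]) (auto simp: q qact)
    fix N assume N: "VectorSpace.subspace K N (quotient_space A L)"
      and N_act: "\<And>a n. \<lbrakk>a \<in> carrier A; n \<in> N\<rbrakk> \<Longrightarrow>
            transport_action (coset_of A L) A (\<otimes>) a n \<in> N"
    note Nd = subspaceD[OF N]
    define L' where "L' = {v \<in> carrier A. coset_of A L v \<in> N}"
    have L': "left_ideal A L'"
      unfolding left_ideal_def
    proof (intro conjI ballI)
      show "\<zero> \<in> L'" using Nd(2) by (simp add: L'_def q(2))
      show "x \<oplus> y \<in> L'" if "x \<in> L'" "y \<in> L'" for x y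
        using that Nd(3)[of "coset_of A L x" "coset_of A L y"] q(3)[of x y] by (simp add: L'_def)
      show "a \<otimes> x \<in> L'" if "a \<in> carrier A" "x \<in> L'" for a x
        using that N_act[of a "coset_of A L x"] qact[of a x] by (simp add: L'_def)
    qed (auto simp: L'_def)
    have "v \<in> L'" if "v \<in> L" for v
      using that Ld(2) Nd(2) coset_of_eq_iff[OF sub, of v \<zero>] by (auto simp: L'_def minus_eq q(2))
    then have "L \<subseteq> L'" by blast
    then have cases: "L' = L \<or> \<one> \<in> L'" using max[OF L'] by argo
    have N_eq: "N = coset_of A L ` L'" using Nd(1) by (auto simp: q(1) L'_def)
    show "N = {\<zero>\<^bsub>quotient_space A L\<^esub>} \<or> N = carrier (quotient_space A L)"
      using cases
    proof
      assume "L' = L"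
      moreover have "coset_of A L v = coset_of A L \<zero>" if "v \<in> L" for v
        using that Ld(2) coset_of_eq_iff[OF sub, of v \<zero>] by (simp add: minus_eq)
      with Ld(3) have "coset_of A L ` L = {coset_of A L \<zero>}" by blast
      ultimately show ?thesis by (simp add: N_eq q(2))
    next
      assume one: "\<one> \<in> L'"
      have "a \<in> L'" if "a \<in> carrier A" for a
        using left_idealD(5)[OF L' that one] that by simp
      then have "L' = carrier A" using left_idealD(1)[OF L'] by (intro equalityI) auto
      then show ?thesis by (simp add: N_eq q(1))
    qed
  qed
qed

text \<open>Otherwise \<open>A (1 - x)\<close> is a proper left ideal and lies in a maximal one,
  \<open>N\<close>. As \<open>x\<close> annihilates the coset of the unit in \<open>A / N\<close>,
  it belongs to \<open>N\<close>; so does \<open>1 - x\<close>, and hence the unit, a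
  contradiction.\<close>

lemma jacobson_radical_left_inverse:
  assumes x: "x \<in> jacobson_radical K A"
  shows "\<exists>u\<in>carrier A. u \<otimes> (\<one> \<ominus> x) = \<one>"
proof (rule ccontr)
  assume *: "\<not> (\<exists>u\<in>carrier A. u \<otimes> (\<one> \<ominus> x) = \<one>)"
  have xA: "x \<in> carrier A" using x by (simp add: jacobson_radical_def)
  let ?L = "(\<lambda>u. u \<otimes> (\<one> \<ominus> x)) ` carrier A"
  have "left_ideal A ?L"
    unfolding left_ideal_def
  proof (intro conjI ballI)
    show "\<zero> \<in> ?L" using xA by (intro image_eqI[of _ _ \<zero>]) simp_all
    show "y \<oplus> z \<in> ?L" if yz: "y \<in> ?L" "z \<in> ?L" for y z
    proof -
      obtain u v where "u \<in> carrier A" "v \<in> carrier A" "y = u \<otimes> (\<one> \<ominus> x)" "z = v \<otimes> (\<one> \<ominus> x)"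
        using yz by blast
      then show ?thesis using xA by (intro image_eqI[of _ _ "u \<oplus> v"]) (simp_all add: l_distr)
    qed
    show "a \<otimes> y \<in> ?L" if a: "a \<in> carrier A" and y: "y \<in> ?L" for a y
    proof -
      obtain u where "u \<in> carrier A" "y = u \<otimes> (\<one> \<ominus> x)" using y by blast
      then show ?thesis using xA a by (intro image_eqI[of _ _ "a \<otimes> u"]) (simp_all add: m_assoc)
    qed
  qed (use xA in auto)
  moreover have "\<one> \<notin> ?L" using * by force
  ultimately obtain N where N: "left_ideal A N" "?L \<subseteq> N" "\<one> \<notin> N"
    and max: "\<And>N'. \<lbrakk>left_ideal A N'; N \<subseteq> N'; \<one> \<notin> N'\<rbrakk> \<Longrightarrow> N' = N"
    using left_ideal_in_maximal by blast
  note sub = left_ideal_subspace[OF N(1)]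
  have lin: "linear_map K A A ((\<otimes>) x)"
    using xA by (intro linear_mapI) (auto simp: r_distr smult_mult_right vectorspace_axioms)
  have "transport_action (coset_of A N) A (\<otimes>) x (coset_of A N \<one>) = \<zero>\<^bsub>quotient_space A N\<^esub>"
    using x quotient_irreducible[OF N(1,3) max] quotient_simps(1)[OF sub]
    unfolding jacobson_radical_def by blast
  then have "coset_of A N x = coset_of A N \<zero>"
    using quotient_action[where act = "(\<otimes>)", OF sub lin] left_idealD(5)[OF N(1) xA] xA
    by (simp add: quotient_simps(2)[OF sub])
  then have "x \<in> N" using coset_of_eq_iff[OF sub, of x \<zero>] xA by (simp add: minus_eq)
  moreover have "\<one> \<otimes> (\<one> \<ominus> x) \<in> N" using N(2) by blast
  ultimately have "(\<one> \<ominus> x) \<oplus> x \<in> N" using xA left_idealD(4)[OF N(1)] by simp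
  then show False using N(3) xA by (simp add: minus_eq add.m_assoc l_neg)
qed

lemma jacobson_radicalD:
  fixes M :: "('a, 'c set) module"
  assumes "x \<in> jacobson_radical K A" "irreducible_module K A M act" "m \<in> carrier M"
  shows "x \<in> carrier A" "act x m = \<zero>\<^bsub>M\<^esub>"
  using assms by (auto simp: jacobson_radical_def)

lemma jacobson_radicalI:
  assumes "x \<in> carrier A"
    and "\<And>(M :: ('a, 'c set) module) act m.
           \<lbrakk>irreducible_module K A M act; m \<in> carrier M\<rbrakk> \<Longrightarrow> act x m = \<zero>\<^bsub>M\<^esub>"
  shows "x \<in> jacobson_radical K A"
  using assms by (simp add: jacobson_radical_def)

lemma jacobson_radical_ideal:
  shows "left_ideal A (jacobson_radical K A)"
    and "\<lbrakk>x \<in> jacobson_radical K A; a \<in> carrier A\<rbrakk> \<Longrightarrow> x \<otimes> a \<in> jacobson_radical K A"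
proof -
  have J: "x \<in> carrier A" if "x \<in> jacobson_radical K A" for x
    using that by (simp add: jacobson_radical_def)
  have zero: "\<zero> \<in> jacobson_radical K A"
  proof (rule jacobson_radicalI)
    fix M :: "('a, 'c set) module" and act m
    assume "irreducible_module K A M act" "m \<in> carrier M"
    then interpret M: irreducible_module K A M act by simp
    show "act \<zero> m = \<zero>\<^bsub>M\<^esub>" by (rule M.act_simps) fact
  qed simp
  have add: "x \<oplus> y \<in> jacobson_radical K A"
    if xy: "x \<in> jacobson_radical K A" "y \<in> jacobson_radical K A" for x y
  proof (rule jacobson_radicalI)
    fix M :: "('a, 'c set) module" and act m
    assume M: "irreducible_module K A M act" "m \<in> carrier M"
    interpret M: irreducible_module K A M act by (rule M)
    show "act (x \<oplus> y) m = \<zero>\<^bsub>M\<^esub>"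
      using M(2) xy by (simp add: M.act_simps J jacobson_radicalD(2)[OF _ M])
  qed (use xy J in simp)
  have mult: "a \<otimes> x \<in> jacobson_radical K A"
    if x: "x \<in> jacobson_radical K A" and a: "a \<in> carrier A" for a x
  proof (rule jacobson_radicalI)
    fix M :: "('a, 'c set) module" and act m
    assume M: "irreducible_module K A M act" "m \<in> carrier M"
    interpret M: irreducible_module K A M act by (rule M)
    show "act (a \<otimes> x) m = \<zero>\<^bsub>M\<^esub>"
      using M(2) x a by (simp add: M.act_simps M.act_mult J jacobson_radicalD(2)[OF _ M])
  qed (use x a J in simp)
  show "left_ideal A (jacobson_radical K A)"
    unfolding left_ideal_def using J zero add mult by blast
  show "x \<otimes> a \<in> jacobson_radical K A"
    if x: "x \<in> jacobson_radical K A" and a: "a \<in> carrier A"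
  proof (rule jacobson_radicalI)
    fix M :: "('a, 'c set) module" and act m
    assume M: "irreducible_module K A M act" "m \<in> carrier M"
    interpret M: irreducible_module K A M act by (rule M)
    show "act (x \<otimes> a) m = \<zero>\<^bsub>M\<^esub>"
      using M(2) x a by (simp add: M.act_simps M.act_mult J jacobson_radicalD(2)[OF _ M(1)])
  qed (use x a J in simp)
qed

section \<open>Quasi-regularity\<close>

lemma minus_one_mult: "\<lbrakk>x \<in> carrier A; w \<in> carrier A\<rbrakk> \<Longrightarrow> (\<one> \<ominus> x) \<otimes> w = w \<ominus> x \<otimes> w"
  by (simp add: minus_eq l_distr l_minus)

lemma mult_minus_one: "\<lbrakk>x \<in> carrier A; w \<in> carrier A\<rbrakk> \<Longrightarrow> w \<otimes> (\<one> \<ominus> x) = w \<ominus> w \<otimes> x"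
  by (simp add: minus_eq r_distr r_minus)

lemma left_ideal_neg: "\<lbrakk>left_ideal A L; x \<in> L\<rbrakk> \<Longrightarrow> \<ominus> x \<in> L"
  by (rule subspace_neg[OF left_ideal_subspace])

text \<open>Applied with \<open>y = w x\<close> or \<open>y = x w\<close>: a one-sided inverse
  \<open>w\<close> of \<open>1 - x\<close> is again one minus an element of the ideal in question,
  so the existence of inverses can be applied to \<open>w\<close> in turn.\<close>

lemma eq_one_minus:
  assumes "w \<ominus> y = \<one>" "w \<in> carrier A" "y \<in> carrier A"
  shows "w = \<one> \<ominus> (\<ominus> y)"
proof -
  have "w \<ominus> y \<oplus> y = \<one> \<oplus> y" using assms(1) by simp
  then show ?thesis using assms(2,3) by (simp add: minus_eq a_assoc l_neg)
qed

text \<open>The left inverse \<open>u\<close> equals \<open>1 + u x\<close>, so it has a left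
  inverse \<open>v\<close> itself. An element with a left inverse \<open>v\<close> and a right
  inverse \<open>1 - x\<close> has \<open>v = 1 - x\<close>, and so \<open>u\<close> is
  two-sided.\<close>

lemma jacobson_radical_inverse:
  assumes x: "x \<in> jacobson_radical K A"
  shows "\<exists>u\<in>carrier A. u \<otimes> (\<one> \<ominus> x) = \<one> \<and> (\<one> \<ominus> x) \<otimes> u = \<one>"
proof -
  note J = jacobson_radical_ideal(1)
  have xA: "x \<in> carrier A" using left_idealD(2)[OF J x] .
  obtain u where u: "u \<in> carrier A" "u \<otimes> (\<one> \<ominus> x) = \<one>"
    using jacobson_radical_left_inverse[OF x] by blast
  have "u = \<one> \<ominus> (\<ominus> (u \<otimes> x))"
    using u xA by (intro eq_one_minus) (simp_all add: mult_minus_one)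
  moreover have "\<ominus> (u \<otimes> x) \<in> jacobson_radical K A"
    by (rule left_ideal_neg[OF J left_idealD(5)[OF J u(1) x]])
  ultimately obtain v where v: "v \<in> carrier A" "v \<otimes> u = \<one>"
    using jacobson_radical_left_inverse by metis
  have "v = v \<otimes> (u \<otimes> (\<one> \<ominus> x))" using u v by simp
  also have "\<dots> = \<one> \<ominus> x" using u(1) v xA by (simp flip: m_assoc)
  finally show ?thesis using u v by blast
qed

text \<open>The algebra \<open>I\<close> has no irreducible modules at all, so its radical is
  everything. In an irreducible \<open>M\<close> with \<open>a m \<noteq> 0\<close>, the orbit
  \<open>I m\<close> is a nonzero submodule, hence \<open>M\<close>, and \<open>e m = m\<close> for
  some \<open>e \<in> I\<close>. Invertibility of \<open>1 - e\<close> in \<open>A\<close> then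
  forces \<open>m = 0\<close>.\<close>

lemma jacobson_radical_left_ideal_eq:
  assumes I: "left_ideal A I" "I \<subseteq> jacobson_radical K A"
  shows "jacobson_radical K (A\<lparr>carrier := I\<rparr>) = I"
proof -
  note Id = left_idealD[OF I(1)]
  have "\<not> irreducible_module K (A\<lparr>carrier := I\<rparr>) M act" for M :: "('a, 'c set) module" and act
  proof
    assume "irreducible_module K (A\<lparr>carrier := I\<rparr>) M act"
    then interpret M: irreducible_module K "A\<lparr>carrier := I\<rparr>" M act .
    note smp = M.act_simps[simplified] M.act_mult[simplified]
    obtain a m where am: "a \<in> I" "m \<in> carrier M" "act a m \<noteq> \<zero>\<^bsub>M\<^esub>"
      using M.act_nonzero by auto
    let ?N = "(\<lambda>a. act a m) ` I"
    have "act b n \<in> ?N" if "b \<in> I" "n \<in> ?N" for b n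
      using that am Id(2,5) by (auto simp flip: smp(8))
    then have "?N = {\<zero>\<^bsub>M\<^esub>} \<or> ?N = carrier M"
      using M.no_proper_submodule[of ?N] M.orbit_subspace[OF am(2)] by simp
    moreover have "?N \<noteq> {\<zero>\<^bsub>M\<^esub>}" using am by blast
    ultimately have "m \<in> ?N" using am(2) by simp
    then obtain e where e: "e \<in> I" "act e m = m" by auto
    have eA: "e \<in> carrier A" using Id(2) e by blast
    obtain u where u: "u \<in> carrier A" "u \<otimes> (\<one> \<ominus> e) = \<one>"
      using jacobson_radical_inverse e I(2) by blast
    let ?x = "u \<otimes> e"
    have xI: "?x \<in> I" using Id(5) u(1) e(1) by blast
    have uE: "u = \<one> \<oplus> ?x"
      using eq_one_minus[of u ?x] u eA by (simp add: mult_minus_one) (simp add: minus_eq)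
    \<comment> \<open>The inverse \<open>u\<close> need not act on \<open>M\<close>, which is a
      module over \<open>I\<close> only. The relation is therefore rewritten as
      \<open>x = e + x e\<close> for \<open>x = u e \<in> I\<close>; applied to \<open>m\<close> it
      reads \<open>x m = m + x m\<close>.\<close>
    have "?x = (\<one> \<oplus> ?x) \<otimes> e" by (subst uE[symmetric]) (rule refl)
    then have "?x = e \<oplus> ?x \<otimes> e" using eA u(1) by (simp add: l_distr)
    then have "act ?x m = act e m \<oplus>\<^bsub>M\<^esub> act (?x \<otimes> e) m"
      using smp(3)[of e "?x \<otimes> e" m] e xI am(2) Id(5) eA u(1) by simp
    then have "act ?x m = m \<oplus>\<^bsub>M\<^esub> act ?x m" using smp(8)[OF xI e(1) am(2)] e by simp
    then have "m = \<zero>\<^bsub>M\<^esub>"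
      using smp(1)[OF xI am(2)] am(2) M.M.add.r_cancel_one by simp
    then show False using am smp(6) by simp
  qed
  then show ?thesis by (auto simp: jacobson_radical_def)
qed

text \<open>If \<open>x m \<noteq> 0\<close> in an irreducible \<open>M\<close>, then
  \<open>m = r x m\<close> for some \<open>r\<close>, so \<open>e = r x\<close> is an element of
  \<open>I\<close> fixing \<open>m\<close>. Once \<open>1 - e\<close> is known to be invertible on
  both sides, \<open>(1 - e) m = 0\<close> gives \<open>m = 0\<close>. Right inverses are assumed
  because they are what the projection from \<open>R # H\<close> to \<open>R\<close>
  preserves.\<close>

lemma quasi_regular_ideal_subset:
  assumes I: "left_ideal A I" "\<And>x a. \<lbrakk>x \<in> I; a \<in> carrier A\<rbrakk> \<Longrightarrow> x \<otimes> a \<in> I"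
    and inv: "\<And>x. x \<in> I \<Longrightarrow> \<exists>w\<in>carrier A. (\<one> \<ominus> x) \<otimes> w = \<one>"
  shows "I \<subseteq> jacobson_radical K A"
proof
  note Id = left_idealD[OF I(1)]
  fix x assume x: "x \<in> I"
  then have xA: "x \<in> carrier A" using Id by blast
  show "x \<in> jacobson_radical K A"
  proof (rule jacobson_radicalI[OF xA], rule ccontr)
    fix M :: "('a, 'c set) module" and act m
    assume "irreducible_module K A M act" and m: "m \<in> carrier M" and xm: "act x m \<noteq> \<zero>\<^bsub>M\<^esub>"
    then interpret M: irreducible_module K A M act by simp
    note smp = M.act_simps
    let ?N = "(\<lambda>a. act a (act x m)) ` carrier A"
    have xmM: "act x m \<in> carrier M" using smp xA m by blast
    have closed: "act b n \<in> ?N" if "b \<in> carrier A" "n \<in> ?N" for b n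
      using that xmM by (auto simp flip: M.act_mult)
    \<comment> \<open>Since \<open>M\<close> is not assumed unital, \<open>A (x m)\<close> could
      vanish although \<open>x m \<noteq> 0\<close>. The vectors killed by all of \<open>A\<close>
      form a submodule, which is zero because the action is nonzero.\<close>
    define Z where "Z = {n \<in> carrier M. \<forall>a\<in>carrier A. act a n = \<zero>\<^bsub>M\<^esub>}"
    have "VectorSpace.subspace K Z M"
      by (rule subspaceI) (auto simp: Z_def M.vectorspace_axioms smp)
    moreover have "act a n \<in> Z" if "a \<in> carrier A" "n \<in> Z" for a n
      using that by (auto simp: Z_def smp)
    ultimately have Z: "Z = {\<zero>\<^bsub>M\<^esub>} \<or> Z = carrier M" by (rule M.no_proper_submodule)
    obtain b n where bn: "b \<in> carrier A" "n \<in> carrier M" "act b n \<noteq> \<zero>\<^bsub>M\<^esub>"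
      using M.act_nonzero by auto
    then have "n \<notin> Z" by (auto simp: Z_def)
    with Z bn(2) have "Z = {\<zero>\<^bsub>M\<^esub>}" by auto
    with xm have "act x m \<notin> Z" by simp
    then obtain c where "c \<in> carrier A" "act c (act x m) \<noteq> \<zero>\<^bsub>M\<^esub>" using xmM by (auto simp: Z_def)
    then have "?N \<noteq> {\<zero>\<^bsub>M\<^esub>}" by (metis (no_types, lifting) imageI singletonD)
    moreover have "?N = {\<zero>\<^bsub>M\<^esub>} \<or> ?N = carrier M"
      by (rule M.no_proper_submodule[OF M.orbit_subspace[OF xmM] closed])
    ultimately have "m \<in> ?N" using m by simp
    then obtain r where r: "r \<in> carrier A" "m = act r (act x m)" by (elim imageE)
    define e where "e = r \<otimes> x"
    have e: "e \<in> I" "e \<in> carrier A" using r(1) x Id by (auto simp: e_def)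
    have em: "act e m = m" using r m xA by (simp add: e_def M.act_mult)
    \<comment> \<open>The unit fixes \<open>m\<close> because \<open>m\<close> lies in the image of
      the action: \<open>1 (e m) = (1 e) m\<close>.\<close>
    have one_m: "act \<one> m = m" using em M.act_mult[of \<one> e m] e m by simp
    obtain w where w: "w \<in> carrier A" "(\<one> \<ominus> e) \<otimes> w = \<one>" using inv[OF e(1)] by blast
    have "w = \<one> \<ominus> (\<ominus> (e \<otimes> w))"
      using w e by (intro eq_one_minus) (simp_all add: minus_one_mult)
    moreover have "\<ominus> (e \<otimes> w) \<in> I"
      by (rule left_ideal_neg[OF I(1) I(2)[OF e(1) w(1)]])
    ultimately obtain z where z: "z \<in> carrier A" "w \<otimes> z = \<one>" using inv by metis
    \<comment> \<open>As \<open>w\<close> has the left inverse \<open>1 - e\<close> and the right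
      inverse \<open>z\<close>, the two coincide, so \<open>w\<close> is a left inverse of
      \<open>1 - e\<close> as well.\<close>
    have "z = (\<one> \<ominus> e) \<otimes> w \<otimes> z" using w z by simp
    also have "\<dots> = \<one> \<ominus> e" using w(1) z e by (simp add: m_assoc)
    finally have "w \<otimes> (\<one> \<ominus> e) = \<one>" using z by simp
    then have "m = act w (act (\<one> \<ominus> e) m)" using one_m M.act_mult[of w "\<one> \<ominus> e" m] w e m by simp
    also have "act (\<one> \<ominus> e) m \<oplus>\<^bsub>M\<^esub> act e m = act \<one> m"
      using smp(3)[of "\<one> \<ominus> e" e m] e m by (simp add: minus_eq a_assoc l_neg)
    then have "act (\<one> \<ominus> e) m = \<zero>\<^bsub>M\<^esub>"
      using em one_m m e M.M.add.r_cancel_one[of m "act (\<one> \<ominus> e) m"] smp(1)[of "\<one> \<ominus> e" m] by simp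
    finally have "m = \<zero>\<^bsub>M\<^esub>" using w smp by simp
    then show False using xm smp xA by simp
  qed
qed

end

section \<open>Nakayama's lemma\<close>

context algebra_module begin

abbreviation submodule_of :: "'c set \<Rightarrow> bool" where
  "submodule_of N \<equiv> VectorSpace.subspace K N M \<and> (\<forall>a\<in>carrier A. \<forall>n\<in>N. act a n \<in> N)"

text \<open>The sum \<open>N + I b\<close> is used twice in Nakayama's lemma, with \<open>I\<close>
  the whole algebra and with \<open>I\<close> the given ideal.\<close>

lemma subspace_plus_orbit:
  assumes N: "VectorSpace.subspace K N M" and I: "VectorSpace.subspace K I A"
    and b: "b \<in> carrier M"
  shows "VectorSpace.subspace K {n \<oplus> act a b | n a. n \<in> N \<and> a \<in> I} M"
    (is "VectorSpace.subspace K ?P M")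
proof (rule subspaceI)
  note Nd = subspaceD[OF N] and Id = subspaceD[OF I]
  have NM: "n \<in> carrier M" if "n \<in> N" for n using Nd(1) that by blast
  have IA: "a \<in> carrier A" if "a \<in> I" for a using Id(1) that by blast
  have P: "n \<oplus> act a b \<in> ?P" if "n \<in> N" "a \<in> I" for n a using that by blast
  show "vectorspace K M" by unfold_locales
  show "?P \<subseteq> carrier M" using NM IA b by (auto simp: act_simps)
  show "\<zero> \<in> ?P" using P[OF Nd(2) Id(2)] b by (simp add: act_simps)
  show "v \<oplus> w \<in> ?P" if vw: "v \<in> ?P" "w \<in> ?P" for v w
  proof -
    obtain n a n' a' where *: "n \<in> N" "a \<in> I" "n' \<in> N" "a' \<in> I" "v = n \<oplus> act a b"
      "w = n' \<oplus> act a' b"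
      using vw by blast
    have "v \<oplus> w = (n \<oplus> n') \<oplus> act (a \<oplus>\<^bsub>A\<^esub> a') b"
      using * NM IA b by (simp add: act_simps M.a_ac)
    then show ?thesis using P[OF Nd(3) Id(3)] * by simp
  qed
  show "c \<odot> v \<in> ?P" if c: "c \<in> carrier K" and v: "v \<in> ?P" for c v
  proof -
    obtain n a where *: "n \<in> N" "a \<in> I" "v = n \<oplus> act a b" using v by blast
    have "c \<odot> v = (c \<odot> n) \<oplus> act (c \<odot>\<^bsub>A\<^esub> a) b"
      using * c NM IA b by (simp add: act_simps smult_r_distr)
    then show ?thesis using P[OF Nd(4) Id(4)] * c by simp
  qed
qed

text \<open>Induction on the generators removes one of them, \<open>b\<close>, at a time: modulo the
  submodule \<open>N\<close> generated by the others, \<open>b = a b\<close> with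
  \<open>a \<in> I\<close>, and \<open>1 - a\<close> is invertible. Both \<open>I M = M\<close> and
  generation by \<open>B\<close> are phrased by quantifying over subspaces and submodules, which
  avoids finite sums.\<close>

lemma Nakayama:
  assumes A: "unital_algebra K A" and unital: "\<And>m. m \<in> carrier M \<Longrightarrow> act \<one>\<^bsub>A\<^esub> m = m"
    and I: "left_ideal A I" "I \<subseteq> jacobson_radical K A"
      "\<And>x a. \<lbrakk>x \<in> I; a \<in> carrier A\<rbrakk> \<Longrightarrow> x \<otimes>\<^bsub>A\<^esub> a \<in> I"
    and IM: "\<And>N. \<lbrakk>VectorSpace.subspace K N M; \<And>a m. \<lbrakk>a \<in> I; m \<in> carrier M\<rbrakk> \<Longrightarrow> act a m \<in> N\<rbrakk>
               \<Longrightarrow> N = carrier M"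
    and B: "finite B" "B \<subseteq> carrier M"
    and gen: "\<And>N. \<lbrakk>submodule_of N; B \<subseteq> N\<rbrakk> \<Longrightarrow> N = carrier M"
  shows "carrier M = {\<zero>}"
  using B gen
proof (induction B)
  case empty
  show ?case using empty(2)[of "{\<zero>}"] by (auto simp: zero_subspace act_simps)
next
  case (insert b B)
  interpret A: unital_algebra K A by (rule A)
  have A_sub: "left_ideal A (carrier A)" by (auto simp: left_ideal_def)
  have b: "b \<in> carrier M" and BM: "B \<subseteq> carrier M" using insert.prems by auto
  define N where "N = \<Inter>{N. submodule_of N \<and> B \<subseteq> N}"
  have M_sub: "submodule_of (carrier M)"
    by (auto intro!: subspaceI simp: vectorspace_axioms act_simps)
  have sub: "VectorSpace.subspace K N M"
  proof (rule subspaceI)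
    show "N \<subseteq> carrier M" unfolding N_def using M_sub BM by blast
  qed (auto simp: N_def vectorspace_axioms dest: subspaceD(2-4))
  have closed: "act a n \<in> N" if "a \<in> carrier A" "n \<in> N" for a n
    using that unfolding N_def by auto
  note Nd = subspaceD[OF sub]
  have BN: "B \<subseteq> N" unfolding N_def by blast
  let ?P = "\<lambda>I. {n \<oplus> act a b | n a. n \<in> N \<and> a \<in> I}"
  have P: "?P (carrier A) = carrier M"
  proof (rule insert.prems(2), intro conjI ballI)
    show "VectorSpace.subspace K (?P (carrier A)) M"
      by (rule subspace_plus_orbit[OF sub A.left_ideal_subspace[OF A_sub] b])
    have "n \<in> ?P (carrier A)" if "n \<in> N" for n
      using that Nd(1) b by (intro CollectI exI[of _ n] exI[of _ "\<zero>\<^bsub>A\<^esub>"]) (auto simp: act_simps)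
    moreover have "b \<in> ?P (carrier A)"
      using Nd(2) b by (intro CollectI exI[of _ \<zero>] exI[of _ "\<one>\<^bsub>A\<^esub>"]) (auto simp: unital)
    ultimately show "insert b B \<subseteq> ?P (carrier A)" using BN by blast
    fix a p assume a: "a \<in> carrier A" and "p \<in> ?P (carrier A)"
    then obtain n r where nr: "n \<in> N" "r \<in> carrier A" "p = n \<oplus> act r b" by blast
    then have "act a p = act a n \<oplus> act (a \<otimes>\<^bsub>A\<^esub> r) b"
      using a b Nd(1) by (auto simp: act_simps act_mult)
    then show "act a p \<in> ?P (carrier A)" using closed[OF a nr(1)] nr(2) a by blast
  qed
  \<comment> \<open>An element of \<open>I\<close> maps \<open>n + r b\<close> to
    \<open>a n + (a r) b\<close>. That \<open>I\<close> is closed under right multiplication puts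
    \<open>a r\<close> back into \<open>I\<close>.\<close>
  have "?P I = carrier M"
  proof (rule IM)
    show "VectorSpace.subspace K (?P I) M"
      by (rule subspace_plus_orbit[OF sub A.left_ideal_subspace[OF I(1)] b])
    fix a m assume a: "a \<in> I" and m: "m \<in> carrier M"
    have aA: "a \<in> carrier A" using a left_idealD(1)[OF I(1)] by blast
    obtain n r where nr: "n \<in> N" "r \<in> carrier A" "m = n \<oplus> act r b"
      using m unfolding P[symmetric] by blast
    then have "act a m = act a n \<oplus> act (a \<otimes>\<^bsub>A\<^esub> r) b"
      using aA b Nd(1) by (auto simp: act_simps act_mult)
    then show "act a m \<in> ?P I" using closed[OF aA nr(1)] I(3)[OF a nr(2)] by blast
  qed
  with b obtain n a where na: "n \<in> N" "a \<in> I" "b = n \<oplus> act a b" by blast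
  have aA: "a \<in> carrier A" using na left_idealD(1)[OF I(1)] by blast
  have nM: "n \<in> carrier M" using na Nd(1) by blast
  obtain u where u: "u \<in> carrier A" "u \<otimes>\<^bsub>A\<^esub> (\<one>\<^bsub>A\<^esub> \<ominus>\<^bsub>A\<^esub> a) = \<one>\<^bsub>A\<^esub>"
    using A.jacobson_radical_inverse na I(2) by blast
  have "act (\<one>\<^bsub>A\<^esub> \<ominus>\<^bsub>A\<^esub> a) b \<oplus> act a b = act \<one>\<^bsub>A\<^esub> b"
    using act_simps(3)[of "\<one>\<^bsub>A\<^esub> \<ominus>\<^bsub>A\<^esub> a" a b] aA b by (simp add: A.minus_eq A.a_assoc A.l_neg)
  then have "act (\<one>\<^bsub>A\<^esub> \<ominus>\<^bsub>A\<^esub> a) b = n"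
    using na(3) unital[OF b] aA b nM
      act_simps(1) M.add.right_cancel[of "act a b" "act (\<one>\<^bsub>A\<^esub> \<ominus>\<^bsub>A\<^esub> a) b" n] by simp
  then have "b = act u n" using act_mult[of u "\<one>\<^bsub>A\<^esub> \<ominus>\<^bsub>A\<^esub> a" b] u aA b unital by simp
  then have "b \<in> N" using closed[OF u(1) na(1)] by simp
  then have "N = carrier M" using insert.prems(2)[of N] sub closed BN by blast
  \<comment> \<open>Any submodule containing \<open>B\<close> contains \<open>N\<close>, which is
    all of \<open>M\<close>; so \<open>B\<close> without \<open>b\<close> still generates and the
    induction hypothesis applies.\<close>
  then have "N' = carrier M" if "submodule_of N'" "B \<subseteq> N'" for N'
    using that subspaceD(1)[of K N' M] unfolding N_def by blast
  then show ?case using insert.IH BM by blast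
qed

end

section \<open>Linear maps on tensor products\<close>

lemma bilinear_mapI:
  assumes "vectorspace K V" "vectorspace K W" "vectorspace K P"
    and "\<And>v w. \<lbrakk>v \<in> carrier V; w \<in> carrier W\<rbrakk> \<Longrightarrow> \<beta> v w \<in> carrier P"
    and "\<And>v v' w. \<lbrakk>v \<in> carrier V; v' \<in> carrier V; w \<in> carrier W\<rbrakk> \<Longrightarrow>
           \<beta> (v \<oplus>\<^bsub>V\<^esub> v') w = \<beta> v w \<oplus>\<^bsub>P\<^esub> \<beta> v' w"
    and "\<And>v w w'. \<lbrakk>v \<in> carrier V; w \<in> carrier W; w' \<in> carrier W\<rbrakk> \<Longrightarrow>
           \<beta> v (w \<oplus>\<^bsub>W\<^esub> w') = \<beta> v w \<oplus>\<^bsub>P\<^esub> \<beta> v w'"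
    and "\<And>c v w. \<lbrakk>c \<in> carrier K; v \<in> carrier V; w \<in> carrier W\<rbrakk> \<Longrightarrow>
           \<beta> (c \<odot>\<^bsub>V\<^esub> v) w = c \<odot>\<^bsub>P\<^esub> \<beta> v w"
    and "\<And>c v w. \<lbrakk>c \<in> carrier K; v \<in> carrier V; w \<in> carrier W\<rbrakk> \<Longrightarrow>
           \<beta> v (c \<odot>\<^bsub>W\<^esub> w) = c \<odot>\<^bsub>P\<^esub> \<beta> v w"
  shows "bilinear_map K V W P \<beta>"
  unfolding bilinear_map_def by (intro conjI ballI linear_mapI) (auto simp: assms)

lemma bilinear_simps:
  assumes "bilinear_map K V W P \<beta>"
  shows "\<lbrakk>v \<in> carrier V; w \<in> carrier W\<rbrakk> \<Longrightarrow> \<beta> v w \<in> carrier P"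
    and "\<lbrakk>v \<in> carrier V; v' \<in> carrier V; w \<in> carrier W\<rbrakk> \<Longrightarrow>
           \<beta> (v \<oplus>\<^bsub>V\<^esub> v') w = \<beta> v w \<oplus>\<^bsub>P\<^esub> \<beta> v' w"
    and "\<lbrakk>v \<in> carrier V; w \<in> carrier W; w' \<in> carrier W\<rbrakk> \<Longrightarrow>
           \<beta> v (w \<oplus>\<^bsub>W\<^esub> w') = \<beta> v w \<oplus>\<^bsub>P\<^esub> \<beta> v w'"
    and "\<lbrakk>c \<in> carrier K; v \<in> carrier V; w \<in> carrier W\<rbrakk> \<Longrightarrow> \<beta> (c \<odot>\<^bsub>V\<^esub> v) w = c \<odot>\<^bsub>P\<^esub> \<beta> v w"
    and "\<lbrakk>c \<in> carrier K; v \<in> carrier V; w \<in> carrier W\<rbrakk> \<Longrightarrow> \<beta> v (c \<odot>\<^bsub>W\<^esub> w) = c \<odot>\<^bsub>P\<^esub> \<beta> v w"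
  using linear_mapD(3-5)[OF bilinear_mapD(1)[OF assms]]
    linear_mapD(3-5)[OF bilinear_mapD(2)[OF assms]] by auto

lemma linear_map_compose:
  assumes "linear_map K V W f" "linear_map K W P g"
  shows "linear_map K V P (\<lambda>v. g (f v))"
  by (rule linear_mapI) (simp_all add: linear_mapD[OF assms(1)] linear_mapD(2-)[OF assms(2)])

lemma linear_map_add:
  assumes f: "linear_map K V P f" and g: "linear_map K V P g"
  shows "linear_map K V P (\<lambda>v. f v \<oplus>\<^bsub>P\<^esub> g v)"
proof -
  interpret P: vectorspace K P by (rule linear_mapD(2)[OF f])
  show ?thesis
    by (rule linear_mapI)
      (simp_all add: linear_mapD[OF f] linear_mapD(3-)[OF g] P.M.a_ac P.smult_r_distr)
qed

lemma smult_commute: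
  assumes V: "vectorspace K V" and "c \<in> carrier K" "d \<in> carrier K" "v \<in> carrier V"
  shows "c \<odot>\<^bsub>V\<^esub> (d \<odot>\<^bsub>V\<^esub> v) = d \<odot>\<^bsub>V\<^esub> (c \<odot>\<^bsub>V\<^esub> v)"
proof -
  interpret V: vectorspace K V by (rule V)
  show ?thesis using assms by (metis V.smult_assoc1 V.m_comm)
qed

lemma linear_map_smult:
  assumes f: "linear_map K V P f" and c: "c \<in> carrier K"
  shows "linear_map K V P (\<lambda>v. c \<odot>\<^bsub>P\<^esub> f v)"
proof -
  interpret P: vectorspace K P by (rule linear_mapD(2)[OF f])
  show ?thesis
    using c by (intro linear_mapI)
      (simp_all add: linear_mapD[OF f] P.smult_r_distr smult_commute[OF _ c])
qed

lemma linear_map_bilinear_compose: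
  assumes "bilinear_map K V W P \<beta>" "linear_map K P Q f"
    and VW: "vectorspace K V" "vectorspace K W"
  shows "bilinear_map K V W Q (\<lambda>v w. f (\<beta> v w))"
  by (rule bilinear_mapI)
    (simp_all add: bilinear_simps[OF assms(1)] linear_mapD(2-)[OF assms(2)] VW)

text \<open>The multiplicative group and the additive group of the tensor space have the same
  carrier and operation, hence the same homomorphisms into them, so the choice in
  \<open>tensor_lift\<close> ranges over the same maps. This joins the definition of products by
  \<open>tensor_group\<close> to the Sweedler sums in vector spaces.\<close>

lemma tensor_lift_tensor_group:
  "tensor_lift K V W (tensor_group K V' W') \<beta>
    = tensor_lift K V W (add_monoid (tensor_space K V' W')) \<beta>"
  by (simp add: tensor_lift_def hom_def tensor_space_def)

lemma tensor_space_simps: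
  "carrier (tensor_group K V W) = carrier (tensor_space K V W)"
  "mult (tensor_group K V W) = add (tensor_space K V W)"
  "one (tensor_group K V W) = zero (tensor_space K V W)"
  by (simp_all add: tensor_space_def)

context
  fixes K :: "('k, 'x) ring_scheme" and V :: "('k, 'v, 'y) module_scheme"
    and W :: "('k, 'w, 'z) module_scheme"
  assumes V: "vectorspace K V" and W: "vectorspace K W"
begin

lemma tensor_linear_eqI:
  assumes \<phi>: "linear_map K (tensor_space K V W) P \<phi>" and \<psi>: "linear_map K (tensor_space K V W) P \<psi>"
    and eq: "\<And>v w. \<lbrakk>v \<in> carrier V; w \<in> carrier W\<rbrakk> \<Longrightarrow>
               \<phi> (pure_tensor K V W v w) = \<psi> (pure_tensor K V W v w)"
    and t: "t \<in> carrier (tensor_space K V W)"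
  shows "\<phi> t = \<psi> t"
proof -
  interpret P: vectorspace K P by (rule linear_mapD(2)[OF \<phi>])
  show ?thesis
  proof (rule tensor_hom_eqI[OF V W P.M.a_group])
    show "\<phi> (pure_tensor K V W v w) = \<psi> (pure_tensor K V W v w)"
      if "v \<in> carrier V" "w \<in> carrier W" for v w by (rule eq[OF that])
    show "\<phi> \<in> hom (tensor_group K V W) (add_monoid P)" "\<psi> \<in> hom (tensor_group K V W) (add_monoid P)"
      by (auto intro!: homI simp: tensor_space_simps linear_mapD(3,4)[OF \<phi>] linear_mapD(3,4)[OF \<psi>])
    show "t \<in> carrier (tensor_group K V W)" using t by (simp add: tensor_space_simps)
  qed
qed

lemma pure_tensor_bilinear: "bilinear_map K V W (tensor_space K V W) (pure_tensor K V W)"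
  by (rule bilinear_mapI[OF V W vectorspace_tensor_space[OF V W]])
    (use pure_tensor_closed[OF V W] in
      \<open>simp_all flip: tensor_space_simps add: pure_tensor_add_left[OF V W] pure_tensor_add_right[OF V W]
       tensor_smult_pure[OF V W] pure_tensor_balanced[OF V W, symmetric]\<close>)

context
  fixes P :: "('k, 'p, 'q) module_scheme"
  assumes P: "vectorspace K P"
begin

interpretation P: vectorspace K P by (rule P)

lemma tensor_lift_pure_bilinear:
  "\<lbrakk>bilinear_map K V W P \<beta>; v \<in> carrier V; w \<in> carrier W\<rbrakk> \<Longrightarrow>
     tensor_lift K V W (add_monoid P) \<beta> (pure_tensor K V W v w) = \<beta> v w"
  by (rule bilinear_tensor_lift(2)[OF V W P])

text \<open>Additivity is part of the universal property of the group. For homogeneity,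
  \<open>t \<mapsto> l (c t)\<close> and \<open>t \<mapsto> c (l t)\<close> are group homomorphisms
  that agree on pure tensors.\<close>

lemma tensor_lift_linear:
  assumes \<beta>: "bilinear_map K V W P \<beta>"
  shows "linear_map K (tensor_space K V W) P (tensor_lift K V W (add_monoid P) \<beta>)"
    (is "linear_map K ?T P ?l")
proof -
  note hom = bilinear_tensor_lift(1)[OF V W P \<beta>]
  note pure = tensor_lift_pure_bilinear[OF \<beta>]
  have closed: "?l t \<in> carrier P" if "t \<in> carrier ?T" for t
    using hom that by (auto simp: hom_def tensor_space_simps)
  have add: "?l (s \<oplus>\<^bsub>?T\<^esub> t) = ?l s \<oplus>\<^bsub>P\<^esub> ?l t" if "s \<in> carrier ?T" "t \<in> carrier ?T" for s t
    using hom that by (auto simp: hom_def tensor_space_simps)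
  note sh = tensor_smult_hom[OF V W]
  have "?l (c \<odot>\<^bsub>?T\<^esub> t) = c \<odot>\<^bsub>P\<^esub> ?l t" if c: "c \<in> carrier K" and t: "t \<in> carrier ?T" for c t
  proof (rule tensor_hom_eqI[OF V W P.M.a_group])
    show "(\<lambda>t. ?l (c \<odot>\<^bsub>?T\<^esub> t)) \<in> hom (tensor_group K V W) (add_monoid P)"
      using hom_compose[OF sh[OF c] hom] by (simp add: o_def)
    show "(\<lambda>t. c \<odot>\<^bsub>P\<^esub> ?l t) \<in> hom (tensor_group K V W) (add_monoid P)"
      using c by (intro homI) (simp_all add: tensor_space_simps closed add P.smult_r_distr)
    show "?l (c \<odot>\<^bsub>?T\<^esub> pure_tensor K V W v w) = c \<odot>\<^bsub>P\<^esub> ?l (pure_tensor K V W v w)"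
      if vw: "v \<in> carrier V" "w \<in> carrier W" for v w
    proof -
      interpret V: vectorspace K V by (rule V)
      have "c \<odot>\<^bsub>V\<^esub> v \<in> carrier V" using c vw by simp
      then show ?thesis
        using vw c by (simp add: tensor_smult_pure[OF V W] pure bilinear_simps(4)[OF \<beta>])
    qed
    show "t \<in> carrier (tensor_group K V W)" using t by (simp add: tensor_space_simps)
  qed
  then show ?thesis
    by (intro linear_mapI vectorspace_tensor_space V W P closed add) 
qed

text \<open>The lift is obtained by choice, so its dependence on \<open>\<beta>\<close> is
  accessible only through uniqueness: the lift of a sum and the sum of the lifts agree on pure
  tensors. This is what makes nested Sweedler sums bilinear in the outer variables.\<close>

lemma tensor_lift_parameter_linear:
  assumes U: "vectorspace K U"
    and bil: "\<And>u. u \<in> carrier U \<Longrightarrow> bilinear_map K V W P (\<beta> u)"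
    and lin: "\<And>v w. \<lbrakk>v \<in> carrier V; w \<in> carrier W\<rbrakk> \<Longrightarrow> linear_map K U P (\<lambda>u. \<beta> u v w)"
    and t: "t \<in> carrier (tensor_space K V W)"
  shows "linear_map K U P (\<lambda>u. tensor_lift K V W (add_monoid P) (\<beta> u) t)"
proof -
  interpret U: vectorspace K U by (rule U)
  let ?l = "\<lambda>u. tensor_lift K V W (add_monoid P) (\<beta> u)"
  note l = tensor_lift_linear[OF bil]
  show ?thesis
  proof (rule linear_mapI[OF U P])
    show "?l u t \<in> carrier P" if "u \<in> carrier U" for u
      by (rule linear_mapD(3)[OF l[OF that] t])
    show "?l (u \<oplus>\<^bsub>U\<^esub> u') t = ?l u t \<oplus>\<^bsub>P\<^esub> ?l u' t" if u: "u \<in> carrier U" "u' \<in> carrier U" for u u'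
      by (rule tensor_linear_eqI[OF l linear_map_add[OF l l] _ t])
        (simp_all add: u tensor_lift_pure_bilinear[OF bil] linear_mapD(4)[OF lin])
    show "?l (c \<odot>\<^bsub>U\<^esub> u) t = c \<odot>\<^bsub>P\<^esub> ?l u t" if u: "c \<in> carrier K" "u \<in> carrier U" for c u
      by (rule tensor_linear_eqI[OF l linear_map_smult[OF l] _ t])
        (simp_all add: u tensor_lift_pure_bilinear[OF bil] linear_mapD(5)[OF lin])
  qed
qed

end

lemma tensor_lift_map:
  assumes \<beta>: "bilinear_map K V W P \<beta>" and f: "linear_map K P Q f"
    and t: "t \<in> carrier (tensor_space K V W)"
  shows "f (tensor_lift K V W (add_monoid P) \<beta> t) =
           tensor_lift K V W (add_monoid Q) (\<lambda>v w. f (\<beta> v w)) t"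
proof -
  note P = linear_mapD(1)[OF f] and Q = linear_mapD(2)[OF f]
  note f\<beta> = linear_map_bilinear_compose[OF \<beta> f V W]
  show ?thesis
    by (rule tensor_linear_eqI[OF linear_map_compose[OF tensor_lift_linear[OF P \<beta>] f]
          tensor_lift_linear[OF Q f\<beta>] _ t])
      (simp add: tensor_lift_pure_bilinear[OF P \<beta>] tensor_lift_pure_bilinear[OF Q f\<beta>])
qed

end

text \<open>Serves for \<open>smash_ideal\<close>, which is an additive subgroup given by generators
  and not the image of a tensor product, so that the uniqueness arguments for tensors do not reach
  its elements directly.\<close>

lemma generate_mapped:
  assumes "comm_group G" "f \<in> hom G G" "subgroup N G" "B \<subseteq> carrier G"
    and "\<And>b. b \<in> B \<Longrightarrow> f b \<in> N" and "x \<in> generate G B"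
  shows "f x \<in> N"
proof -
  interpret G: comm_group G by fact
  interpret f: group_hom G G f using assms(2) by unfold_locales
  from assms(6) show ?thesis
  proof (induction rule: generate.induct)
    case one
    then show ?case using subgroup.one_closed[OF assms(3)] by simp
  next
    case (incl b)
    then show ?case by (rule assms(5))
  next
    case (inv b)
    then show ?case
      using assms(4) f.hom_inv[of b] subgroup.m_inv_closed[OF assms(3) assms(5)[OF inv]] by auto
  next
    case (eng x y)
    then show ?case
      using G.generate_in_carrier[OF assms(4)] f.hom_mult subgroup.m_closed[OF assms(3)] by auto
  qed
qed

lemma tensor_linear_in_subspace:
  assumes V: "vectorspace K V" and W: "vectorspace K W"
    and f: "linear_map K (tensor_space K V W) P f" and N: "VectorSpace.subspace K N P"
    and pure: "\<And>v w. \<lbrakk>v \<in> carrier V; w \<in> carrier W\<rbrakk> \<Longrightarrow> f (pure_tensor K V W v w) \<in> N"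
    and t: "t \<in> carrier (tensor_space K V W)"
  shows "f t \<in> N"
proof -
  interpret P: vectorspace K P by (rule linear_mapD(2)[OF f])
  have "subgroup N (add_monoid P)"
    using subspaceD[OF N] subspace_neg[OF N]
    by unfold_locales (auto simp: a_inv_def[symmetric])
  moreover have "f \<in> hom (tensor_group K V W) (add_monoid P)"
    by (auto intro!: homI simp: tensor_space_simps linear_mapD[OF f])
  moreover have "t \<in> carrier (tensor_group K V W)" using t by (simp add: tensor_space_simps)
  ultimately show ?thesis
    using tensor_hom_in_subgroup[OF V W P.M.a_comm_group, of f N t] pure by simp
qed

text \<open>The three arguments share one space because \<open>T\<close> is evaluated on the three
  legs of a twice comultiplied element.\<close>

definition trilinear_map ::
    "('k, 'x) ring_scheme \<Rightarrow> ('k, 'u, 'v) module_scheme \<Rightarrow> ('k, 'p, 'q) module_scheme \<Rightarrow>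
     ('u \<Rightarrow> 'u \<Rightarrow> 'u \<Rightarrow> 'p) \<Rightarrow> bool" where
  "trilinear_map K V P T \<longleftrightarrow>
     (\<forall>x\<in>carrier V. bilinear_map K V V P (T x)) \<and>
     (\<forall>y\<in>carrier V. \<forall>z\<in>carrier V. linear_map K V P (\<lambda>x. T x y z))"

lemma trilinear_mapI:
  assumes "vectorspace K V" "vectorspace K P"
    and "\<And>x y z. \<lbrakk>x \<in> carrier V; y \<in> carrier V; z \<in> carrier V\<rbrakk> \<Longrightarrow> T x y z \<in> carrier P"
    and "\<And>x x' y z. \<lbrakk>x \<in> carrier V; x' \<in> carrier V; y \<in> carrier V; z \<in> carrier V\<rbrakk> \<Longrightarrow>
           T (x \<oplus>\<^bsub>V\<^esub> x') y z = T x y z \<oplus>\<^bsub>P\<^esub> T x' y z"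
    and "\<And>x y y' z. \<lbrakk>x \<in> carrier V; y \<in> carrier V; y' \<in> carrier V; z \<in> carrier V\<rbrakk> \<Longrightarrow>
           T x (y \<oplus>\<^bsub>V\<^esub> y') z = T x y z \<oplus>\<^bsub>P\<^esub> T x y' z"
    and "\<And>x y z z'. \<lbrakk>x \<in> carrier V; y \<in> carrier V; z \<in> carrier V; z' \<in> carrier V\<rbrakk> \<Longrightarrow>
           T x y (z \<oplus>\<^bsub>V\<^esub> z') = T x y z \<oplus>\<^bsub>P\<^esub> T x y z'"
    and "\<And>c x y z. \<lbrakk>c \<in> carrier K; x \<in> carrier V; y \<in> carrier V; z \<in> carrier V\<rbrakk> \<Longrightarrow>
           T (c \<odot>\<^bsub>V\<^esub> x) y z = c \<odot>\<^bsub>P\<^esub> T x y z"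
    and "\<And>c x y z. \<lbrakk>c \<in> carrier K; x \<in> carrier V; y \<in> carrier V; z \<in> carrier V\<rbrakk> \<Longrightarrow>
           T x (c \<odot>\<^bsub>V\<^esub> y) z = c \<odot>\<^bsub>P\<^esub> T x y z"
    and "\<And>c x y z. \<lbrakk>c \<in> carrier K; x \<in> carrier V; y \<in> carrier V; z \<in> carrier V\<rbrakk> \<Longrightarrow>
           T x y (c \<odot>\<^bsub>V\<^esub> z) = c \<odot>\<^bsub>P\<^esub> T x y z"
  shows "trilinear_map K V P T"
  unfolding trilinear_map_def
  by (intro conjI ballI linear_mapI bilinear_mapI) (auto simp: assms)

lemma trilinear_mapD:
  assumes "trilinear_map K V P T" "vectorspace K V" "vectorspace K P"
  shows "x \<in> carrier V \<Longrightarrow> bilinear_map K V V P (T x)"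
    and "y \<in> carrier V \<Longrightarrow> bilinear_map K V V P (\<lambda>x. T x y)"
    and "z \<in> carrier V \<Longrightarrow> bilinear_map K V V P (\<lambda>x y. T x y z)"
    and "\<lbrakk>y \<in> carrier V; z \<in> carrier V\<rbrakk> \<Longrightarrow> linear_map K V P (\<lambda>x. T x y z)"
    and "\<lbrakk>x \<in> carrier V; z \<in> carrier V\<rbrakk> \<Longrightarrow> linear_map K V P (\<lambda>y. T x y z)"
    and "\<lbrakk>x \<in> carrier V; y \<in> carrier V\<rbrakk> \<Longrightarrow> linear_map K V P (\<lambda>z. T x y z)"
proof -
  show 1: "bilinear_map K V V P (T x)" if "x \<in> carrier V" for x
    using assms that by (simp add: trilinear_map_def)
  show 4: "linear_map K V P (\<lambda>x. T x y z)" if "y \<in> carrier V" "z \<in> carrier V" for y z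
    using assms that by (simp add: trilinear_map_def)
  show "linear_map K V P (\<lambda>y. T x y z)" if "x \<in> carrier V" "z \<in> carrier V" for x z
    using bilinear_mapD(2)[OF 1] that by simp
  show "linear_map K V P (\<lambda>z. T x y z)" if "x \<in> carrier V" "y \<in> carrier V" for x y
    using bilinear_mapD(1)[OF 1] that by simp
  show "bilinear_map K V V P (\<lambda>x. T x y)" if "y \<in> carrier V" for y
    by (rule bilinear_mapI[OF assms(2,2,3)])
      (simp_all add: that bilinear_simps[OF 1] linear_mapD[OF 4])
  show "bilinear_map K V V P (\<lambda>x y. T x y z)" if "z \<in> carrier V" for z
    by (rule bilinear_mapI[OF assms(2,2,3)])
      (simp_all add: that bilinear_simps[OF 1] linear_mapD[OF 4])
qed

section \<open>Sweedler notation\<close>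

context hopf_algebra begin

lemma comult_closed: "h \<in> carrier H \<Longrightarrow> \<Delta> h \<in> carrier (tensor_space K H H)"
  by (rule linear_mapD(3)[OF comult_linear])

lemma vectorspace_HH: "vectorspace K (tensor_space K H H)"
  by (rule linear_mapD(2)[OF comult_linear])

lemma sweedler_cong:
  assumes "\<And>x y. \<lbrakk>x \<in> carrier H; y \<in> carrier H\<rbrakk> \<Longrightarrow> F x y = G x y"
  shows "sweedler K H \<Delta> P h F = sweedler K H \<Delta> P h G"
proof -
  have "tensor_lift K H H (add_monoid P) F = tensor_lift K H H (add_monoid P) G"
    by (rule tensor_lift_cong) (rule assms)
  then show ?thesis by (simp add: sweedler_def)
qed

lemma sweedler_linear:
  assumes "vectorspace K P" "bilinear_map K H H P F"
  shows "linear_map K H P (\<lambda>h. sweedler K H \<Delta> P h F)"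
  unfolding sweedler_def
  by (rule linear_map_compose[OF comult_linear
        tensor_lift_linear[OF vectorspace_axioms vectorspace_axioms assms]])

lemma sweedler_map:
  assumes "bilinear_map K H H P F" "linear_map K P Q f" "h \<in> carrier H"
  shows "f (sweedler K H \<Delta> P h F) = sweedler K H \<Delta> Q h (\<lambda>x y. f (F x y))"
  unfolding sweedler_def
  by (rule tensor_lift_map[OF vectorspace_axioms vectorspace_axioms assms(1,2)
        comult_closed[OF assms(3)]])

lemma sweedler_parameter_linear:
  assumes "vectorspace K U" "vectorspace K P"
    and "\<And>u. u \<in> carrier U \<Longrightarrow> bilinear_map K H H P (F u)"
    and "\<And>x y. \<lbrakk>x \<in> carrier H; y \<in> carrier H\<rbrakk> \<Longrightarrow> linear_map K U P (\<lambda>u. F u x y)"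
    and "h \<in> carrier H"
  shows "linear_map K U P (\<lambda>u. sweedler K H \<Delta> P h (F u))"
  unfolding sweedler_def
  by (rule tensor_lift_parameter_linear[OF vectorspace_axioms vectorspace_axioms assms(2,1,3,4)
        comult_closed[OF assms(5)]])

lemma sweedler_in_subspace:
  assumes bil: "bilinear_map K H H P F" and P: "vectorspace K P" and N: "VectorSpace.subspace K N P"
    and "\<And>x y. \<lbrakk>x \<in> carrier H; y \<in> carrier H\<rbrakk> \<Longrightarrow> F x y \<in> N" and h: "h \<in> carrier H"
  shows "sweedler K H \<Delta> P h F \<in> N"
proof -
  note V = vectorspace_axioms
  show ?thesis
    unfolding sweedler_def
    by (rule tensor_linear_in_subspace[OF V V tensor_lift_linear[OF V V P bil] N _
          comult_closed[OF h]])
      (simp add: tensor_lift_pure_bilinear[OF V V P bil] assms(4))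
qed

lemma sweedler_one:
  assumes "vectorspace K P" "bilinear_map K H H P F"
  shows "sweedler K H \<Delta> P \<one> F = F \<one> \<one>"
  using tensor_lift_pure_bilinear[OF vectorspace_axioms vectorspace_axioms assms]
  by (simp add: sweedler_def comult_one)

lemma sweedler_left_bilinear:
  assumes T: "trilinear_map K H P T" and P: "vectorspace K P"
  shows "bilinear_map K H H P (\<lambda>x y. sweedler K H \<Delta> P x (\<lambda>x\<^sub>1 x\<^sub>2. T x\<^sub>1 x\<^sub>2 y))"
  unfolding bilinear_map_def
  by (intro conjI ballI sweedler_linear sweedler_parameter_linear
        P vectorspace_axioms trilinear_mapD[OF T vectorspace_axioms P])

text \<open>The coassociativity axiom is an equation in \<open>H \<otimes> (H \<otimes> H)\<close>.
  The trilinear map \<open>T\<close> factors through a linear map \<open>L\<close> on that space,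
  and applying \<open>L\<close> to both sides of the axiom gives the two groupings of the triple
  sum.\<close>

lemma sweedler_coassociative:
  assumes T: "trilinear_map K H P T" and P: "vectorspace K P" and h: "h \<in> carrier H"
  shows "sweedler K H \<Delta> P h (\<lambda>x y. sweedler K H \<Delta> P x (\<lambda>x\<^sub>1 x\<^sub>2. T x\<^sub>1 x\<^sub>2 y)) =
         sweedler K H \<Delta> P h (\<lambda>x y. sweedler K H \<Delta> P y (T x))"
proof -
  note V = vectorspace_axioms and HH = vectorspace_HH
  let ?HH = "tensor_space K H H" and ?HHH = "tensor_space K H (tensor_space K H H)"
  note HHH = vectorspace_tensor_space[OF V HH]
  note Td = trilinear_mapD[OF T V P]
  let ?l = "\<lambda>x. tensor_lift K H H (add_monoid P) (T x)"
  have l: "bilinear_map K H ?HH P ?l"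
    unfolding bilinear_map_def
    by (intro conjI ballI tensor_lift_linear[OF V V P] tensor_lift_parameter_linear[OF V V P V] Td)
  let ?L = "tensor_lift K H ?HH (add_monoid P) ?l"
  have L: "linear_map K ?HHH P ?L" by (rule tensor_lift_linear[OF V HH P l])
  note p = pure_tensor_bilinear[OF V V] pure_tensor_bilinear[OF V HH]
  note ps = bilinear_simps[OF p(1)] bilinear_simps[OF p(2)]
  have L_pure: "?L (pure_tensor K H ?HH x (pure_tensor K H H y z)) = T x y z"
    if "x \<in> carrier H" "y \<in> carrier H" "z \<in> carrier H" for x y z
    using that by (simp add: tensor_lift_pure_bilinear[OF V HH P l] ps
        tensor_lift_pure_bilinear[OF V V P Td(1)])
  have pT: "trilinear_map K H ?HHH (\<lambda>x y z. pure_tensor K H ?HH x (pure_tensor K H H y z))"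
    by (rule trilinear_mapI[OF V HHH]) (simp_all add: ps)
  have pD: "bilinear_map K H H ?HHH (\<lambda>x y. pure_tensor K H ?HH x (\<Delta> y))"
    by (rule bilinear_mapI[OF V V HHH]) (simp_all add: ps linear_mapD[OF comult_linear])
  have "sweedler K H \<Delta> P h (\<lambda>x y. sweedler K H \<Delta> P x (\<lambda>x\<^sub>1 x\<^sub>2. T x\<^sub>1 x\<^sub>2 y)) =
      sweedler K H \<Delta> P h (\<lambda>x y. ?L (sweedler K H \<Delta> ?HHH x (\<lambda>x\<^sub>1 x\<^sub>2.
        pure_tensor K H ?HH x\<^sub>1 (pure_tensor K H H x\<^sub>2 y))))"
  proof (rule sweedler_cong)
    fix x y assume xy: "x \<in> carrier H" "y \<in> carrier H"
    then show "sweedler K H \<Delta> P x (\<lambda>x\<^sub>1 x\<^sub>2. T x\<^sub>1 x\<^sub>2 y) =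
        ?L (sweedler K H \<Delta> ?HHH x (\<lambda>x\<^sub>1 x\<^sub>2. pure_tensor K H ?HH x\<^sub>1 (pure_tensor K H H x\<^sub>2 y)))"
      by (subst sweedler_map[OF trilinear_mapD(3)[OF pT V HHH xy(2)] L xy(1)])
        (rule sweedler_cong, simp add: L_pure)
  qed
  also have "\<dots> = ?L (sweedler K H \<Delta> ?HHH h (\<lambda>x y. sweedler K H \<Delta> ?HHH x (\<lambda>x\<^sub>1 x\<^sub>2.
        pure_tensor K H ?HH x\<^sub>1 (pure_tensor K H H x\<^sub>2 y))))"
    by (rule sweedler_map[OF sweedler_left_bilinear[OF pT HHH] L h, symmetric])
  also have "\<dots> = ?L (sweedler K H \<Delta> ?HHH h (\<lambda>x y. pure_tensor K H ?HH x (\<Delta> y)))"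
    by (simp only: coassociative[OF h])
  also have "\<dots> = sweedler K H \<Delta> P h (\<lambda>x y. ?L (pure_tensor K H ?HH x (\<Delta> y)))"
    by (rule sweedler_map[OF pD L h])
  also have "\<dots> = sweedler K H \<Delta> P h (\<lambda>x y. sweedler K H \<Delta> P y (T x))"
    by (rule sweedler_cong)
      (simp add: tensor_lift_pure_bilinear[OF V HH P l] comult_closed sweedler_def)
  finally show ?thesis .
qed

text \<open>Multiplicativity of \<open>\<Delta>\<close>, written out in the tensor algebra as a
  double Sweedler sum of \<open>g\<^sub>1 h\<^sub>1 \<otimes> g\<^sub>2 h\<^sub>2\<close>, to which
  the lift of \<open>F\<close> is applied.\<close>

lemma sweedler_mult:
  assumes F: "bilinear_map K H H P F" and P: "vectorspace K P"
    and g: "g \<in> carrier H" and h: "h \<in> carrier H"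
  shows "sweedler K H \<Delta> P (g \<otimes> h) F =
         sweedler K H \<Delta> P g (\<lambda>x y. sweedler K H \<Delta> P h (\<lambda>x' y'. F (x \<otimes> x') (y \<otimes> y')))"
proof -
  note V = vectorspace_axioms and HH = vectorspace_HH
  let ?HH = "tensor_space K H H"
  let ?l = "tensor_lift K H H (add_monoid P) F"
  note l = tensor_lift_linear[OF V V P F]
  note ps = bilinear_simps[OF pure_tensor_bilinear[OF V V]]
  have 1: "bilinear_map K H H ?HH (\<lambda>x' y'. pure_tensor K H H (x \<otimes> x') (y \<otimes> y'))"
    if "x \<in> carrier H" "y \<in> carrier H" for x y
    using that by (intro bilinear_mapI[OF V V HH]) (simp_all add: ps r_distr smult_mult_right)
  have 2: "bilinear_map K H H ?HH (\<lambda>x y. pure_tensor K H H (x \<otimes> x') (y \<otimes> y'))"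
    if "x' \<in> carrier H" "y' \<in> carrier H" for x' y'
    using that by (intro bilinear_mapI[OF V V HH]) (simp_all add: ps l_distr smult_mult_left)
  have 3: "bilinear_map K H H ?HH (\<lambda>x y. sweedler K H \<Delta> ?HH h (\<lambda>x' y'.
      pure_tensor K H H (x \<otimes> x') (y \<otimes> y')))"
    unfolding bilinear_map_def
    by (intro conjI ballI sweedler_parameter_linear V HH h 1)
      (use bilinear_mapD[OF 2] in auto)
  have "\<Delta> (g \<otimes> h) = sweedler K H \<Delta> ?HH g (\<lambda>x y. sweedler K H \<Delta> ?HH h (\<lambda>x' y'.
      pure_tensor K H H (x \<otimes> x') (y \<otimes> y')))"
    by (simp add: comult_mult[OF g h] tensor_algebra_def sweedler_def tensor_lift_tensor_group)
  then have "sweedler K H \<Delta> P (g \<otimes> h) F = ?l (sweedler K H \<Delta> ?HH g (\<lambda>x y. sweedler K H \<Delta> ?HH h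
      (\<lambda>x' y'. pure_tensor K H H (x \<otimes> x') (y \<otimes> y'))))"
    by (simp add: sweedler_def[of _ _ _ P "g \<otimes> h"])
  also have "\<dots> = sweedler K H \<Delta> P g (\<lambda>x y. ?l (sweedler K H \<Delta> ?HH h
      (\<lambda>x' y'. pure_tensor K H H (x \<otimes> x') (y \<otimes> y'))))"
    by (rule sweedler_map[OF 3 l g])
  also have "\<dots> = sweedler K H \<Delta> P g (\<lambda>x y. sweedler K H \<Delta> P h (\<lambda>x' y'. F (x \<otimes> x') (y \<otimes> y')))"
    by (intro sweedler_cong)
      (simp add: sweedler_map[OF 1 l h] tensor_lift_pure_bilinear[OF V V P F] cong: sweedler_cong)
  finally show ?thesis .
qed

text \<open>Without explicit sums to interchange, both sides are regarded as linear functions of the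
  tensor in the place of \<open>\<Delta> g\<close>; on a pure tensor \<open>x \<otimes> y\<close>
  each of them is the sum of \<open>F x y\<close> over \<open>h\<close>.\<close>

lemma sweedler_swap:
  assumes P: "vectorspace K P" and g: "g \<in> carrier H" and h: "h \<in> carrier H"
    and 1: "\<And>x y. \<lbrakk>x \<in> carrier H; y \<in> carrier H\<rbrakk> \<Longrightarrow> bilinear_map K H H P (F x y)"
    and 2: "\<And>x y. \<lbrakk>x \<in> carrier H; y \<in> carrier H\<rbrakk> \<Longrightarrow> bilinear_map K H H P (\<lambda>x' y'. F x' y' x y)"
  shows "sweedler K H \<Delta> P g (\<lambda>x y. sweedler K H \<Delta> P h (F x y)) =
         sweedler K H \<Delta> P h (\<lambda>x' y'. sweedler K H \<Delta> P g (\<lambda>x y. F x y x' y'))"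
proof -
  note V = vectorspace_axioms
  let ?s = "tensor_lift K H H (add_monoid P)"
  have bil: "bilinear_map K H H P (\<lambda>x y. ?s (F x y) (\<Delta> h))"
    unfolding bilinear_map_def
    by (intro conjI ballI tensor_lift_parameter_linear[OF V V P V] 1 comult_closed h)
      (auto intro: bilinear_mapD[OF 2])
  \<comment> \<open>Stated for an arbitrary tensor \<open>t\<close>, since \<open>\<Delta> g\<close>
    is about to be treated as a variable.\<close>
  have bil': "bilinear_map K H H P (\<lambda>x' y'. ?s (\<lambda>x y. F x y x' y') t)"
    if "t \<in> carrier (tensor_space K H H)" for t
    unfolding bilinear_map_def
    by (intro conjI ballI tensor_lift_parameter_linear[OF V V P V] 2 that)
      (auto intro: bilinear_mapD[OF 1])
  have "?s (\<lambda>x y. ?s (F x y) (\<Delta> h)) (\<Delta> g) = ?s (\<lambda>x' y'. ?s (\<lambda>x y. F x y x' y') (\<Delta> g)) (\<Delta> h)"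
  proof (rule tensor_linear_eqI[OF V V tensor_lift_linear[OF V V P bil]
        tensor_lift_parameter_linear[OF V V P vectorspace_HH bil' tensor_lift_linear[OF V V P 2]
          comult_closed[OF h]] _ comult_closed[OF g]])
    fix x y assume xy: "x \<in> carrier H" "y \<in> carrier H"
    have "?s (\<lambda>x' y'. ?s (\<lambda>x y. F x y x' y') (pure_tensor K H H x y)) = ?s (F x y)"
      by (rule tensor_lift_cong) (rule tensor_lift_pure_bilinear[OF V V P 2 xy])
    then show "?s (\<lambda>x y. ?s (F x y) (\<Delta> h)) (pure_tensor K H H x y) =
        ?s (\<lambda>x' y'. ?s (\<lambda>x y. F x y x' y') (pure_tensor K H H x y)) (\<Delta> h)"
      by (simp add: tensor_lift_pure_bilinear[OF V V P bil xy])
  qed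
  then show ?thesis by (simp add: sweedler_def)
qed

lemma counit_closed: "h \<in> carrier H \<Longrightarrow> \<epsilon> h \<in> carrier K"
  using counit_ring_hom by (auto simp: ring_hom_def)

lemma counit_add: "\<lbrakk>g \<in> carrier H; h \<in> carrier H\<rbrakk> \<Longrightarrow> \<epsilon> (g \<oplus> h) = \<epsilon> g \<oplus>\<^bsub>K\<^esub> \<epsilon> h"
  using counit_ring_hom by (auto simp: ring_hom_def)

lemma counit_bilinear:
  assumes V: "vectorspace K V"
  shows "bilinear_map K V H V (\<lambda>v h. \<epsilon> h \<odot>\<^bsub>V\<^esub> v)"
proof -
  interpret V: vectorspace K V by (rule V)
  show ?thesis
    by (rule bilinear_mapI[OF V vectorspace_axioms V])
      (simp_all add: counit_closed counit_add counit_smult V.smult_r_distr V.smult_l_distr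
         V.smult_assoc1 smult_commute[OF V])
qed

lemma counit_bilinear_left:
  assumes "vectorspace K V"
  shows "bilinear_map K H V V (\<lambda>h v. \<epsilon> h \<odot>\<^bsub>V\<^esub> v)"
  using counit_bilinear[OF assms] by (simp add: bilinear_map_def)

end

section \<open>The smash product\<close>

lemma vectorspace_mult_update:
  assumes "vectorspace K V"
  shows "vectorspace K (V\<lparr>mult := m, one := e\<rparr>)"
proof -
  interpret V: vectorspace K V by (rule assms)
  show ?thesis
  proof (rule vs_criteria)
    show "\<forall>v\<in>carrier (V\<lparr>mult := m, one := e\<rparr>). \<exists>neg_v\<in>carrier (V\<lparr>mult := m, one := e\<rparr>).
        v \<oplus>\<^bsub>V\<lparr>mult := m, one := e\<rparr>\<^esub> neg_v = \<zero>\<^bsub>V\<lparr>mult := m, one := e\<rparr>\<^esub>"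
      using V.M.r_neg by (auto intro!: bexI[of _ "\<ominus>\<^bsub>V\<^esub> _"])
  qed (simp_all add: V.field_axioms V.M.a_ac V.smult_assoc1 V.smult_l_distr V.smult_r_distr)
qed

context module_algebra begin

abbreviation smash (infixl "\<sharp>" 65) where "a \<sharp> h \<equiv> pure_tensor K R H a h"
abbreviation RtH where "RtH \<equiv> tensor_space K R H"
abbreviation RsH where "RsH \<equiv> smash_product K H \<Delta> R act"

lemmas VH = H.vectorspace_axioms
lemmas VR = R.vectorspace_axioms
lemmas VP = vectorspace_tensor_space[OF VR VH]

lemmas smash_simps = bilinear_simps[OF pure_tensor_bilinear[OF VR VH]]
lemmas act_simps = bilinear_simps[OF act_bilinear]

text \<open>Both sides equal \<open>\<Sum> (h\<^sub>1 \<cdot> 1) (h\<^sub>2 \<cdot> (S(h\<^sub>3) \<cdot> 1))\<close>.\<close>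

lemma act_unit:
  assumes h: "h \<in> carrier H"
  shows "h \<cdot> \<one> = \<epsilon> h \<odot> \<one>"
proof -
  let ?T = "\<lambda>x y z. (x \<cdot> \<one>) \<otimes> (y \<cdot> (S z \<cdot> \<one>))"
  note S = linear_mapD(3-5)[OF H.antipode_linear]
  have T: "trilinear_map K H R ?T"
    by (rule trilinear_mapI[OF VH VR])
      (simp_all add: act_simps S R.l_distr R.r_distr R.smult_mult_left R.smult_mult_right)
  have lin1: "linear_map K H R (\<lambda>h. h \<cdot> \<one>)" by (rule bilinear_mapD(2)[OF act_bilinear]) simp
  have xS: "bilinear_map K H H H (\<lambda>x y. x \<otimes>\<^bsub>H\<^esub> S y)"
    by (rule bilinear_mapI[OF VH VH VH])
      (simp_all add: S H.l_distr H.r_distr H.smult_mult_left H.smult_mult_right)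
  have Sx: "bilinear_map K H H R (\<lambda>x y. x \<cdot> (S y \<cdot> a))" if "a \<in> carrier R" for a
    using that by (intro bilinear_mapI[OF VH VH VR]) (simp_all add: S act_simps)
  have ex: "bilinear_map K H H H (\<lambda>x y. \<epsilon> y \<odot>\<^bsub>H\<^esub> x)"
    by (rule H.counit_bilinear[OF VH])
  have "sweedler K H \<Delta> R h (\<lambda>x y. sweedler K H \<Delta> R x (\<lambda>x\<^sub>1 x\<^sub>2. ?T x\<^sub>1 x\<^sub>2 y)) =
      sweedler K H \<Delta> R h (\<lambda>x y. (x \<otimes>\<^bsub>H\<^esub> S y) \<cdot> \<one>)"
    by (rule H.sweedler_cong) (simp add: act_prod[symmetric] act_simps S act_mult)
  also have "\<dots> = sweedler K H \<Delta> H h (\<lambda>x y. x \<otimes>\<^bsub>H\<^esub> S y) \<cdot> \<one>"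
    by (rule H.sweedler_map[OF xS lin1 h, symmetric])
  also have "\<dots> = \<epsilon> h \<odot> \<one>"
    by (simp add: H.antipode_right h H.counit_closed act_simps act_one)
  finally have 1: "sweedler K H \<Delta> R h (\<lambda>x y. sweedler K H \<Delta> R x (\<lambda>x\<^sub>1 x\<^sub>2. ?T x\<^sub>1 x\<^sub>2 y)) =
      \<epsilon> h \<odot> \<one>" .
  have inner: "sweedler K H \<Delta> R y (?T x) = (\<epsilon> y \<odot>\<^bsub>H\<^esub> x) \<cdot> \<one>"
    if xy: "x \<in> carrier H" "y \<in> carrier H" for x y
  proof -
    have "linear_map K R R (\<lambda>r. (x \<cdot> \<one>) \<otimes> r)"
      using xy by (intro linear_mapI[OF VR VR])
        (simp_all add: act_simps R.r_distr R.smult_mult_right)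
    from H.sweedler_map[OF Sx[OF R.one_closed] this xy(2)]
    have "sweedler K H \<Delta> R y (?T x) = (x \<cdot> \<one>) \<otimes> sweedler K H \<Delta> R y (\<lambda>x y. x \<cdot> (S y \<cdot> \<one>))" by simp
    also have "sweedler K H \<Delta> R y (\<lambda>x y. x \<cdot> (S y \<cdot> \<one>)) =
        sweedler K H \<Delta> R y (\<lambda>x y. (x \<otimes>\<^bsub>H\<^esub> S y) \<cdot> \<one>)"
      by (rule H.sweedler_cong) (simp add: act_mult S)
    also have "\<dots> = sweedler K H \<Delta> H y (\<lambda>x y. x \<otimes>\<^bsub>H\<^esub> S y) \<cdot> \<one>"
      by (rule H.sweedler_map[OF xS lin1 xy(2), symmetric])
    also have "\<dots> = \<epsilon> y \<odot> \<one>"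
      by (simp add: H.antipode_right xy H.counit_closed act_simps act_one)
    finally show ?thesis using xy by (simp add: R.smult_mult_right act_simps H.counit_closed)
  qed
  have "sweedler K H \<Delta> R h (\<lambda>x y. sweedler K H \<Delta> R y (?T x)) =
      sweedler K H \<Delta> R h (\<lambda>x y. (\<epsilon> y \<odot>\<^bsub>H\<^esub> x) \<cdot> \<one>)"
    by (rule H.sweedler_cong) (rule inner)
  also have "\<dots> = h \<cdot> \<one>"
    by (simp add: H.sweedler_map[OF ex lin1 h, symmetric] H.counit_right h)
  finally show ?thesis using 1 H.sweedler_coassociative[OF T VR h] by simp
qed

lemma smash_zero: "h \<in> carrier H \<Longrightarrow> \<zero> \<sharp> h = \<zero>\<^bsub>RtH\<^esub>"
  by (rule linear_mapD(6)[OF bilinear_mapD(2)[OF pure_tensor_bilinear[OF VR VH]]])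

section \<open>\<open>R\<close>-\<open>H\<close>-modules as modules over the smash product\<close>

definition smash_act ::
    "('a, 'm, 'q) module_scheme \<Rightarrow> ('e \<Rightarrow> 'm \<Rightarrow> 'm) \<Rightarrow> ('c \<Rightarrow> 'm \<Rightarrow> 'm) \<Rightarrow>
     ('e, 'c) tensor \<Rightarrow> 'm \<Rightarrow> 'm" where
  "smash_act M ract hact x m = tensor_lift K R H (add_monoid M) (\<lambda>a h. ract a (hact h m)) x"

context
  fixes M :: "('a, 'm, 'q) module_scheme" and ract hact
  assumes M: "RH_module K H \<Delta> R act M ract hact"
begin

interpretation M: RH_module K H \<Delta> R act M ract hact by (rule M)

lemma smash_act_on_pairs_bilinear:
  "m \<in> carrier M \<Longrightarrow> bilinear_map K R H M (\<lambda>a h. ract a (hact h m))"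
  by (rule bilinear_mapI[OF VR VH M.vectorspace_axioms]) (simp_all add: M.act_simps M.HM.act_simps)

lemma smash_act_pure:
  "\<lbrakk>a \<in> carrier R; h \<in> carrier H; m \<in> carrier M\<rbrakk> \<Longrightarrow>
    smash_act M ract hact (a \<sharp> h) m = ract a (hact h m)"
  unfolding smash_act_def
  by (rule tensor_lift_pure_bilinear[OF VR VH M.vectorspace_axioms smash_act_on_pairs_bilinear])

lemma smash_act_bilinear: "bilinear_map K RtH M M (smash_act M ract hact)"
  unfolding bilinear_map_def smash_act_def
  by (intro conjI ballI tensor_lift_parameter_linear[OF VR VH] tensor_lift_linear[OF VR VH]
      smash_act_on_pairs_bilinear M.vectorspace_axioms)
    (auto intro!: linear_mapI simp: M.vectorspace_axioms M.act_simps M.HM.act_simps)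

end

text \<open>Left multiplication by \<open>a # 1\<close>; \<open>smash_hact\<close> is left
  multiplication by \<open>1 # h\<close>. They are defined without the product of
  \<open>R # H\<close> and turn the tensor space into an \<open>R\<close>-\<open>H\<close>-module
  before that product is known to be associative.\<close>

definition smash_ract :: "'e \<Rightarrow> ('e, 'c) tensor \<Rightarrow> ('e, 'c) tensor" where
  "smash_ract a t = tensor_lift K R H (add_monoid RtH) (\<lambda>b g. (a \<otimes> b) \<sharp> g) t"

definition smash_hact :: "'c \<Rightarrow> ('e, 'c) tensor \<Rightarrow> ('e, 'c) tensor" where
  "smash_hact h t = tensor_lift K R H (add_monoid RtH)
     (\<lambda>b g. sweedler K H \<Delta> RtH h (\<lambda>x y. (x \<cdot> b) \<sharp> (y \<otimes>\<^bsub>H\<^esub> g))) t"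

lemma smash_ract_on_pairs_bilinear: "a \<in> carrier R \<Longrightarrow> bilinear_map K R H RtH (\<lambda>b g. (a \<otimes> b) \<sharp> g)"
  by (rule bilinear_mapI[OF VR VH VP]) (simp_all add: smash_simps R.r_distr R.smult_mult_right)

lemma smash_ract_pure:
  "\<lbrakk>a \<in> carrier R; b \<in> carrier R; g \<in> carrier H\<rbrakk> \<Longrightarrow> smash_ract a (b \<sharp> g) = (a \<otimes> b) \<sharp> g"
  unfolding smash_ract_def
  by (rule tensor_lift_pure_bilinear[OF VR VH VP smash_ract_on_pairs_bilinear])

lemma smash_ract_bilinear: "bilinear_map K R RtH RtH smash_ract"
  unfolding bilinear_map_def smash_ract_def
  by (intro conjI ballI tensor_lift_parameter_linear[OF VR VH VP VR] tensor_lift_linear[OF VR VH VP]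
      smash_ract_on_pairs_bilinear)
    (auto intro!: linear_mapI[OF VR VP] simp: smash_simps R.l_distr R.smult_mult_left)

lemma sweedler_summand_bilinear:
  "\<lbrakk>b \<in> carrier R; g \<in> carrier H\<rbrakk> \<Longrightarrow> bilinear_map K H H RtH (\<lambda>x y. (x \<cdot> b) \<sharp> (y \<otimes>\<^bsub>H\<^esub> g))"
  by (rule bilinear_mapI[OF VH VH VP])
    (simp_all add: smash_simps act_simps H.l_distr H.smult_mult_left)

lemma smash_hact_on_pairs_bilinear:
  assumes "h \<in> carrier H"
  shows "bilinear_map K R H RtH (\<lambda>b g. sweedler K H \<Delta> RtH h (\<lambda>x y. (x \<cdot> b) \<sharp> (y \<otimes>\<^bsub>H\<^esub> g)))"
  unfolding bilinear_map_def
  by (intro conjI ballI H.sweedler_parameter_linear VR VH VP assms sweedler_summand_bilinear)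
    (auto intro!: linear_mapI[OF VR VP] linear_mapI[OF VH VP]
       simp: smash_simps act_simps H.r_distr H.smult_mult_right)

lemma smash_hact_pure:
  "\<lbrakk>h \<in> carrier H; b \<in> carrier R; g \<in> carrier H\<rbrakk> \<Longrightarrow>
     smash_hact h (b \<sharp> g) = sweedler K H \<Delta> RtH h (\<lambda>x y. (x \<cdot> b) \<sharp> (y \<otimes>\<^bsub>H\<^esub> g))"
  unfolding smash_hact_def
  by (rule tensor_lift_pure_bilinear[OF VR VH VP smash_hact_on_pairs_bilinear])

lemma smash_hact_bilinear: "bilinear_map K H RtH RtH smash_hact"
  unfolding bilinear_map_def smash_hact_def
  by (intro conjI ballI tensor_lift_parameter_linear[OF VR VH VP VH] tensor_lift_linear[OF VR VH VP]
      smash_hact_on_pairs_bilinear H.sweedler_linear VP sweedler_summand_bilinear)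

lemmas smash_ract_simps = bilinear_simps[OF smash_ract_bilinear]
lemmas smash_hact_simps = bilinear_simps[OF smash_hact_bilinear]

lemma smash_ract_linear: "a \<in> carrier R \<Longrightarrow> linear_map K RtH RtH (smash_ract a)"
  by (rule bilinear_mapD(1)[OF smash_ract_bilinear])

lemma smash_hact_linear: "h \<in> carrier H \<Longrightarrow> linear_map K RtH RtH (smash_hact h)"
  by (rule bilinear_mapD(1)[OF smash_hact_bilinear])

lemma smash_ract_one: "t \<in> carrier RtH \<Longrightarrow> smash_ract \<one> t = t"
  by (rule tensor_linear_eqI[OF VR VH smash_ract_linear linear_mapI[OF VP VP]])
    (simp_all add: smash_ract_pure)

lemma smash_ract_mult:
  assumes "a \<in> carrier R" "b \<in> carrier R" "t \<in> carrier RtH"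
  shows "smash_ract (a \<otimes> b) t = smash_ract a (smash_ract b t)"
  by (rule tensor_linear_eqI[OF VR VH smash_ract_linear
        linear_map_compose[OF smash_ract_linear smash_ract_linear] _ assms(3)])
    (simp_all add: assms smash_ract_pure R.m_assoc)

lemma smash_hact_one: "t \<in> carrier RtH \<Longrightarrow> smash_hact \<one>\<^bsub>H\<^esub> t = t"
  by (rule tensor_linear_eqI[OF VR VH smash_hact_linear linear_mapI[OF VP VP]])
    (simp_all add: smash_hact_pure H.sweedler_one[OF VP sweedler_summand_bilinear] act_one)

text \<open>Expanding \<open>g (h (b # k))\<close> puts the sum over \<open>h\<close> outside and
  the sum over \<open>g\<close> inside. They are exchanged so that multiplicativity of
  \<open>\<Delta>\<close> can be applied.\<close>

lemma smash_hact_mult: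
  assumes gh: "g \<in> carrier H" "h \<in> carrier H" and t: "t \<in> carrier RtH"
  shows "smash_hact (g \<otimes>\<^bsub>H\<^esub> h) t = smash_hact g (smash_hact h t)"
proof (rule tensor_linear_eqI[OF VR VH smash_hact_linear
        linear_map_compose[OF smash_hact_linear smash_hact_linear] _ t])
  fix b k assume bk: "b \<in> carrier R" "k \<in> carrier H"
  let ?F = "\<lambda>x y. (x \<cdot> b) \<sharp> (y \<otimes>\<^bsub>H\<^esub> k)"
  have "smash_hact g (smash_hact h (b \<sharp> k)) =
      sweedler K H \<Delta> RtH h (\<lambda>x' y'. smash_hact g ((x' \<cdot> b) \<sharp> (y' \<otimes>\<^bsub>H\<^esub> k)))"
    unfolding smash_hact_pure[OF gh(2) bk]
    by (rule H.sweedler_map[OF sweedler_summand_bilinear[OF bk] smash_hact_linear[OF gh(1)] gh(2)])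
  also have "\<dots> = sweedler K H \<Delta> RtH h (\<lambda>x' y'. sweedler K H \<Delta> RtH g (\<lambda>x y.
      ?F (x \<otimes>\<^bsub>H\<^esub> x') (y \<otimes>\<^bsub>H\<^esub> y')))"
    by (intro H.sweedler_cong)
      (simp add: smash_hact_pure gh bk act_simps act_mult H.m_assoc cong: H.sweedler_cong)
  also have "\<dots> = sweedler K H \<Delta> RtH g (\<lambda>x y. sweedler K H \<Delta> RtH h (\<lambda>x' y'.
      ?F (x \<otimes>\<^bsub>H\<^esub> x') (y \<otimes>\<^bsub>H\<^esub> y')))"
    using bk by (intro H.sweedler_swap[OF VP gh(2,1)] bilinear_mapI[OF VH VH VP])
      (simp_all add: smash_simps act_simps H.l_distr H.r_distr H.smult_mult_left H.smult_mult_right)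
  also have "\<dots> = sweedler K H \<Delta> RtH (g \<otimes>\<^bsub>H\<^esub> h) ?F"
    by (rule H.sweedler_mult[OF sweedler_summand_bilinear[OF bk] VP gh, symmetric])
  finally show "smash_hact (g \<otimes>\<^bsub>H\<^esub> h) (b \<sharp> k) = smash_hact g (smash_hact h (b \<sharp> k))"
    using gh bk by (simp add: smash_hact_pure)
qed (use gh in simp_all)

text \<open>On \<open>b # g\<close> both sides are the triple sum of
  \<open>(h\<^sub>1 \<cdot> a) (h\<^sub>2 \<cdot> b) # h\<^sub>3 g\<close>, grouped in the two ways
  that coassociativity identifies.\<close>

lemma smash_hact_ract:
  assumes h: "h \<in> carrier H" and a: "a \<in> carrier R" and t: "t \<in> carrier RtH"
  shows "smash_hact h (smash_ract a t) =
         sweedler K H \<Delta> RtH h (\<lambda>h\<^sub>1 h\<^sub>2. smash_ract (h\<^sub>1 \<cdot> a) (smash_hact h\<^sub>2 t))"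
proof (rule tensor_linear_eqI[OF VR VH
  linear_map_compose[OF smash_ract_linear smash_hact_linear] _ _ t])
  have bil: "bilinear_map K H H RtH (\<lambda>h\<^sub>1 h\<^sub>2. smash_ract (h\<^sub>1 \<cdot> a) (smash_hact h\<^sub>2 t))"
    if "t \<in> carrier RtH" for t
    using that a by (intro bilinear_mapI[OF VH VH VP])
      (simp_all add: smash_ract_simps smash_hact_simps act_simps)
  show "linear_map K RtH RtH (\<lambda>t.
    sweedler K H \<Delta> RtH h (\<lambda>h\<^sub>1 h\<^sub>2. smash_ract (h\<^sub>1 \<cdot> a) (smash_hact h\<^sub>2 t)))"
    using a by (intro H.sweedler_parameter_linear VP h bil
      linear_map_compose[OF smash_hact_linear smash_ract_linear])
      (simp_all add: act_simps)
  fix b g assume bg: "b \<in> carrier R" "g \<in> carrier H"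
  let ?T = "\<lambda>x y z. ((x \<cdot> a) \<otimes> (y \<cdot> b)) \<sharp> (z \<otimes>\<^bsub>H\<^esub> g)"
  have T: "trilinear_map K H RtH ?T"
    using a bg by (intro trilinear_mapI[OF VH VP])
      (simp_all add: act_simps smash_simps R.l_distr R.r_distr R.smult_mult_left R.smult_mult_right
        H.l_distr H.smult_mult_left)
  have ab: "bilinear_map K H H R (\<lambda>x y. (x \<cdot> a) \<otimes> (y \<cdot> b))"
    using a bg by (intro bilinear_mapI[OF VH VH VR])
      (simp_all add: act_simps R.l_distr R.r_distr R.smult_mult_left R.smult_mult_right)
  have "smash_hact h (smash_ract a (b \<sharp> g)) =
      sweedler K H \<Delta> RtH h (\<lambda>x y. (x \<cdot> (a \<otimes> b)) \<sharp> (y \<otimes>\<^bsub>H\<^esub> g))"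
    using h a bg by (simp add: smash_ract_pure smash_hact_pure)
  also have "\<dots> = sweedler K H \<Delta> RtH h (\<lambda>x y. sweedler K H \<Delta> RtH x (\<lambda>x\<^sub>1 x\<^sub>2. ?T x\<^sub>1 x\<^sub>2 y))"
  proof (rule H.sweedler_cong)
    fix x y assume xy: "x \<in> carrier H" "y \<in> carrier H"
    have "linear_map K R RtH (\<lambda>r. r \<sharp> (y \<otimes>\<^bsub>H\<^esub> g))"
      using xy bg by (intro linear_mapI[OF VR VP]) (simp_all add: smash_simps)
    from H.sweedler_map[OF ab this xy(1)]
    show "(x \<cdot> (a \<otimes> b)) \<sharp> (y \<otimes>\<^bsub>H\<^esub> g) = sweedler K H \<Delta> RtH x (\<lambda>x\<^sub>1 x\<^sub>2. ?T x\<^sub>1 x\<^sub>2 y)"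
      using xy a bg by (simp add: act_prod)
  qed
  also have "\<dots> = sweedler K H \<Delta> RtH h (\<lambda>x y. sweedler K H \<Delta> RtH y (?T x))"
    by (rule H.sweedler_coassociative[OF T VP h])
  also have "\<dots> = sweedler K H \<Delta> RtH h (\<lambda>x y. smash_ract (x \<cdot> a) (smash_hact y (b \<sharp> g)))"
  proof (rule H.sweedler_cong)
    fix x y assume xy: "x \<in> carrier H" "y \<in> carrier H"
    then have "x \<cdot> a \<in> carrier R" using a by (simp add: act_simps)
    from H.sweedler_map[OF sweedler_summand_bilinear[OF bg] smash_ract_linear[OF this] xy(2)]
    have "smash_ract (x \<cdot> a) (smash_hact y (b \<sharp> g)) =
        sweedler K H \<Delta> RtH y (\<lambda>x' y'. smash_ract (x \<cdot> a) ((x' \<cdot> b) \<sharp> (y' \<otimes>\<^bsub>H\<^esub> g)))"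
      using xy bg by (simp add: smash_hact_pure)
    also have "\<dots> = sweedler K H \<Delta> RtH y (?T x)"
      using xy bg a by (intro H.sweedler_cong) (simp add: smash_ract_pure act_simps)
    finally show "sweedler K H \<Delta> RtH y (?T x) = smash_ract (x \<cdot> a) (smash_hact y (b \<sharp> g))" by simp
  qed
  finally show "smash_hact h (smash_ract a (b \<sharp> g)) =
      sweedler K H \<Delta> RtH h (\<lambda>h\<^sub>1 h\<^sub>2. smash_ract (h\<^sub>1 \<cdot> a) (smash_hact h\<^sub>2 (b \<sharp> g)))" .
qed (use h a in simp_all)

lemma smash_RH_module: "RH_module K H \<Delta> R act RtH smash_ract smash_hact"
  by (intro RH_module.intro algebra_module.intro algebra_module_axioms.intro RH_module_axioms.intro
      VP smash_ract_bilinear smash_hact_bilinear smash_ract_mult smash_hact_mult smash_hact_one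
      smash_hact_ract)

lemma RsH_simps:
  "carrier RsH = carrier RtH" "\<zero>\<^bsub>RsH\<^esub> = \<zero>\<^bsub>RtH\<^esub>" "\<one>\<^bsub>RsH\<^esub> = \<one> \<sharp> \<one>\<^bsub>H\<^esub>"
  "add RsH = add RtH" "smult RsH = smult RtH"
  by (simp_all add: smash_product_def)

lemma vectorspace_RsH: "vectorspace K RsH"
  unfolding smash_product_def by (rule vectorspace_mult_update[OF VP])

text \<open>The inner lift in the definition of the product is \<open>t \<mapsto> a (h t)\<close>
  for the regular \<open>R\<close>-\<open>H\<close>-module. The product thus becomes an instance of
  \<open>smash_act\<close>, and its bilinearity is inherited.\<close>

lemma smash_mult:
  assumes "t \<in> carrier RtH"
  shows "s \<otimes>\<^bsub>RsH\<^esub> t = smash_act RtH smash_ract smash_hact s t"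
proof -
  let ?F = "\<lambda>h b g. sweedler K H \<Delta> RtH h (\<lambda>x y. (x \<cdot> b) \<sharp> (y \<otimes>\<^bsub>H\<^esub> g))"
  have "tensor_lift K R H (add_monoid RtH) (\<lambda>b g.
      sweedler K H \<Delta> RtH h (\<lambda>x y. (a \<otimes> x \<cdot> b) \<sharp> (y \<otimes>\<^bsub>H\<^esub> g))) t = smash_ract a (smash_hact h t)"
    if ah: "a \<in> carrier R" "h \<in> carrier H" for a h
  proof -
    have "smash_ract a (smash_hact h t) =
        tensor_lift K R H (add_monoid RtH) (\<lambda>b g. smash_ract a (?F h b g)) t"
      unfolding smash_hact_def
      by (rule tensor_lift_map[OF VR VH smash_hact_on_pairs_bilinear[OF ah(2)]
        smash_ract_linear[OF ah(1)] assms])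
    also have "tensor_lift K R H (add_monoid RtH) (\<lambda>b g. smash_ract a (?F h b g)) =
        tensor_lift K R H (add_monoid RtH) (\<lambda>b g.
          sweedler K H \<Delta> RtH h (\<lambda>x y. (a \<otimes> x \<cdot> b) \<sharp> (y \<otimes>\<^bsub>H\<^esub> g)))"
      by (rule tensor_lift_cong)
        (simp add: H.sweedler_map[OF sweedler_summand_bilinear smash_ract_linear] ah smash_ract_pure
          act_simps
          cong: H.sweedler_cong)
    finally show ?thesis by simp
  qed
  then have "tensor_lift K R H (add_monoid RtH) (\<lambda>a h. tensor_lift K R H (add_monoid RtH) (\<lambda>b g.
        sweedler K H \<Delta> RtH h (\<lambda>x y. (a \<otimes> x \<cdot> b) \<sharp> (y \<otimes>\<^bsub>H\<^esub> g))) t) =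
      tensor_lift K R H (add_monoid RtH) (\<lambda>a h. smash_ract a (smash_hact h t))"
    by (intro tensor_lift_cong)
  then show ?thesis
    by (simp add: smash_product_def smash_act_def tensor_lift_tensor_group)
qed

lemmas smash_mult_simps = bilinear_simps[OF smash_act_bilinear[OF smash_RH_module]]

lemma smash_pure_mult:
  "\<lbrakk>a \<in> carrier R; h \<in> carrier H; t \<in> carrier RtH\<rbrakk> \<Longrightarrow>
     (a \<sharp> h) \<otimes>\<^bsub>RsH\<^esub> t = smash_ract a (smash_hact h t)"
  by (simp add: smash_mult smash_act_pure[OF smash_RH_module])

lemma smash_pure_mult_pure:
  assumes "a \<in> carrier R" "h \<in> carrier H" "b \<in> carrier R" "g \<in> carrier H"
  shows "(a \<sharp> h) \<otimes>\<^bsub>RsH\<^esub> (b \<sharp> g) = sweedler K H \<Delta> RtH h (\<lambda>x y. (a \<otimes> x \<cdot> b) \<sharp> (y \<otimes>\<^bsub>H\<^esub> g))"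
  using assms
  by (simp add: smash_pure_mult smash_simps smash_hact_pure act_simps smash_ract_pure
      H.sweedler_map[OF sweedler_summand_bilinear smash_ract_linear] cong: H.sweedler_cong)

lemma smash_left_R_mult:
  "\<lbrakk>a \<in> carrier R; b \<in> carrier R; g \<in> carrier H\<rbrakk> \<Longrightarrow>
     (a \<sharp> \<one>\<^bsub>H\<^esub>) \<otimes>\<^bsub>RsH\<^esub> (b \<sharp> g) = (a \<otimes> b) \<sharp> g"
  by (simp add: smash_pure_mult smash_simps smash_hact_one smash_ract_pure)

text \<open>Because \<open>h\<^sub>1 \<cdot> 1 = \<epsilon>(h\<^sub>1) 1\<close>, the scalars move
  to the second factor, where the counit law contracts the sum to \<open>h\<close>.\<close>

lemma smash_right_H_mult:
  assumes "a \<in> carrier R" "h \<in> carrier H" "g \<in> carrier H"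
  shows "(a \<sharp> h) \<otimes>\<^bsub>RsH\<^esub> (\<one> \<sharp> g) = a \<sharp> (h \<otimes>\<^bsub>H\<^esub> g)"
proof -
  have bil: "bilinear_map K H H H (\<lambda>x y. \<epsilon> x \<odot>\<^bsub>H\<^esub> y)"
    by (rule H.counit_bilinear_left[OF VH])
  have "linear_map K H RtH (\<lambda>k. a \<sharp> (k \<otimes>\<^bsub>H\<^esub> g))"
    using assms by (intro linear_mapI[OF VH VP])
      (simp_all add: smash_simps H.l_distr H.smult_mult_left)
  note map = H.sweedler_map[OF bil this assms(2)]
  have "(a \<sharp> h) \<otimes>\<^bsub>RsH\<^esub> (\<one> \<sharp> g) = sweedler K H \<Delta> RtH h (\<lambda>x y. a \<sharp> ((\<epsilon> x \<odot>\<^bsub>H\<^esub> y) \<otimes>\<^bsub>H\<^esub> g))"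
    using assms
    by (simp add: smash_pure_mult_pure act_unit R.smult_mult_right smash_simps H.counit_closed
        H.smult_mult_left cong: H.sweedler_cong)
  then show ?thesis using map by (simp add: H.counit_left assms)
qed

lemma smash_decompose:
  "\<lbrakk>a \<in> carrier R; h \<in> carrier H\<rbrakk> \<Longrightarrow> a \<sharp> h = (a \<sharp> \<one>\<^bsub>H\<^esub>) \<otimes>\<^bsub>RsH\<^esub> (\<one> \<sharp> h)"
  by (simp add: smash_left_R_mult)

context
  fixes M :: "('a, 'm, 'q) module_scheme" and ract hact
  assumes M: "RH_module K H \<Delta> R act M ract hact"
begin

interpretation M: RH_module K H \<Delta> R act M ract hact by (rule M)

private lemmas VM = M.vectorspace_axioms
private lemmas sm_simps = bilinear_simps[OF smash_act_bilinear[OF M]]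

text \<open>By linearity \<open>x\<close> and then \<open>y\<close> may be taken pure. For
  \<open>x = a # h\<close> and \<open>y = b # g\<close> the equation is the compatibility of the
  \<open>H\<close>-action with \<open>h (b (g m))\<close>, followed by \<open>a\<close>. The lemma
  covers both arbitrary \<open>R\<close>-\<open>H\<close>-modules and the associativity of
  \<open>R # H\<close>.\<close>

lemma smash_act_mult:
  assumes x: "x \<in> carrier RtH" and y: "y \<in> carrier RtH" and m: "m \<in> carrier M"
  shows "smash_act M ract hact (x \<otimes>\<^bsub>RsH\<^esub> y) m = smash_act M ract hact x (smash_act M ract hact y m)"
proof -
  let ?s = "smash_act M ract hact"
  have ym: "?s y m \<in> carrier M" using y m by (simp add: sm_simps)
  have s1: "linear_map K RtH M (\<lambda>x. ?s x k)" if "k \<in> carrier M" for k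
    by (rule bilinear_mapD(2)[OF smash_act_bilinear[OF M] that])
  show ?thesis
  proof (rule tensor_linear_eqI[OF VR VH _ s1[OF ym] _ x])
    have "linear_map K RtH RtH (\<lambda>x. x \<otimes>\<^bsub>RsH\<^esub> y)"
      using y by (intro linear_mapI[OF VP VP]) (simp_all add: smash_mult smash_mult_simps)
    then show "linear_map K RtH M (\<lambda>x. ?s (x \<otimes>\<^bsub>RsH\<^esub> y) m)"
      by (rule linear_map_compose[OF _ s1[OF m]])
    fix a h assume ah: "a \<in> carrier R" "h \<in> carrier H"
    have ra: "linear_map K M M (\<lambda>k. ract a k)"
      using ah by (intro linear_mapI[OF VM VM]) (simp_all add: M.act_simps)
    have "?s (smash_ract a (smash_hact h y)) m = ract a (hact h (?s y m))"
    proof (rule tensor_linear_eqI[OF VR VH _ _ _ y])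
      have 1: "linear_map K RtH M (\<lambda>y. ?s (smash_ract a y) m)"
        by (rule linear_map_compose[OF smash_ract_linear[OF ah(1)] s1[OF m]])
      show "linear_map K RtH M (\<lambda>y. ?s (smash_ract a (smash_hact h y)) m)"
        by (rule linear_map_compose[OF smash_hact_linear[OF ah(2)] 1])
      show "linear_map K RtH M (\<lambda>y. ract a (hact h (?s y m)))"
        using ah m by (intro linear_mapI[OF VP VM])
          (simp_all add: sm_simps M.act_simps M.HM.act_simps)
      fix b g assume bg: "b \<in> carrier R" "g \<in> carrier H"
      have gm: "hact g m \<in> carrier M" using bg m by (simp add: M.HM.act_simps)
      have "?s (smash_ract a (smash_hact h (b \<sharp> g))) m =
          sweedler K H \<Delta> M h (\<lambda>x y. ?s (smash_ract a ((x \<cdot> b) \<sharp> (y \<otimes>\<^bsub>H\<^esub> g))) m)"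
        unfolding smash_hact_pure[OF ah(2) bg]
        by (rule H.sweedler_map[OF sweedler_summand_bilinear[OF bg] 1 ah(2)])
      also have "\<dots> = sweedler K H \<Delta> M h (\<lambda>x y. ract a (ract (x \<cdot> b) (hact y (hact g m))))"
        by (rule H.sweedler_cong)
          (simp add: ah bg m smash_ract_pure act_simps smash_act_pure[OF M] M.act_mult M.HM.act_mult
            M.HM.act_simps)
      also have "\<dots> = ract a (hact h (ract b (hact g m)))"
        unfolding M.hact_ract[OF ah(2) bg(1) gm]
        by (rule H.sweedler_map[OF M.hact_ract_bilinear[OF act_bilinear bg(1) gm]
          ra ah(2), symmetric])
      finally show "?s (smash_ract a (smash_hact h (b \<sharp> g))) m = ract a (hact h (?s (b \<sharp> g) m))"
        using bg m by (simp add: smash_act_pure[OF M])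
    qed
    then show "?s ((a \<sharp> h) \<otimes>\<^bsub>RsH\<^esub> y) m = ?s (a \<sharp> h) (?s y m)"
      by (simp add: smash_pure_mult ah y smash_act_pure[OF M] ym)
  qed
qed

lemma smash_act_module: "algebra_module K RsH M (smash_act M ract hact)"
proof (intro algebra_module.intro algebra_module_axioms.intro VM)
  show "bilinear_map K RsH M M (smash_act M ract hact)"
    by (rule bilinear_mapI[OF vectorspace_RsH VM VM]) (simp_all add: RsH_simps sm_simps)
qed (simp_all add: RsH_simps smash_act_mult)

end

lemma unital_algebra_RsH: "unital_algebra K RsH"
proof -
  interpret A: vectorspace K RsH by (rule vectorspace_RsH)
  interpret T: vectorspace K RtH by (rule VP)
  have one: "\<one> \<sharp> \<one>\<^bsub>H\<^esub> \<in> carrier RtH" by (simp add: smash_simps)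
  have right_one: "x \<otimes>\<^bsub>RsH\<^esub> (\<one> \<sharp> \<one>\<^bsub>H\<^esub>) = x" if "x \<in> carrier RtH" for x
  proof (rule tensor_linear_eqI[OF VR VH _ linear_mapI[OF VP VP] _ that])
    show "linear_map K RtH RtH (\<lambda>x. x \<otimes>\<^bsub>RsH\<^esub> (\<one> \<sharp> \<one>\<^bsub>H\<^esub>))"
      using one by (intro linear_mapI[OF VP VP]) (simp_all add: smash_mult smash_mult_simps)
  qed (simp_all add: smash_right_H_mult)
  have closed: "x \<otimes>\<^bsub>RsH\<^esub> y \<in> carrier RtH" if "x \<in> carrier RtH" "y \<in> carrier RtH" for x y
    using that by (simp add: smash_mult smash_mult_simps)
  have left_one: "(\<one> \<sharp> \<one>\<^bsub>H\<^esub>) \<otimes>\<^bsub>RsH\<^esub> x = x" if "x \<in> carrier RtH" for x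
    using that by (simp add: smash_pure_mult smash_hact_one smash_ract_one)
  \<comment> \<open>Associativity is the action law for the regular module.\<close>
  have assoc: "x \<otimes>\<^bsub>RsH\<^esub> y \<otimes>\<^bsub>RsH\<^esub> z = x \<otimes>\<^bsub>RsH\<^esub> (y \<otimes>\<^bsub>RsH\<^esub> z)"
    if "x \<in> carrier RtH" "y \<in> carrier RtH" "z \<in> carrier RtH" for x y z
    using smash_act_mult[OF smash_RH_module that] that by (simp add: smash_mult smash_mult_simps)
  have "Group.monoid RsH"
    by (rule monoidI) (simp_all add: RsH_simps one right_one left_one assoc closed)
  then have "ring RsH"
    by (rule ringI[OF A.M.abelian_group_axioms])
      (simp_all add: RsH_simps smash_mult smash_mult_simps A.M.a_closed[unfolded RsH_simps])
  then show ?thesis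
    by (intro unital_algebra.intro unital_algebra_axioms.intro vectorspace_RsH)
      (simp_all add: RsH_simps smash_mult smash_mult_simps linear_mapD)
qed


sublocale RsH: unital_algebra K RsH by (rule unital_algebra_RsH)

lemma subspace_RsH_iff: "VectorSpace.subspace K N RsH \<longleftrightarrow> VectorSpace.subspace K N RtH"
  using vectorspace_RsH VP
  by (simp add: VectorSpace.subspace_def submodule_def RsH_simps vectorspace_def)

section \<open>Irreducible modules\<close>

text \<open>The vectors fixed by the unit of \<open>R\<close> contain \<open>R M\<close>, which is
  nonzero, so it suffices that they form an \<open>R\<close>-\<open>H\<close>-submodule.\<close>

lemma irreducible_RH_unital:
  assumes M: "irreducible_RH_module K H \<Delta> R act M ract hact" and m: "m \<in> carrier M"
  shows "ract \<one> m = m"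
proof -
  interpret M: irreducible_RH_module K H \<Delta> R act M ract hact by (rule M)
  note VM = M.vectorspace_axioms
  let ?N = "{m \<in> carrier M. ract \<one> m = m}"
  have "VectorSpace.subspace K ?N M"
    by (rule subspaceI) (auto simp: VM M.act_simps)
  moreover have r: "ract a n \<in> ?N" if "a \<in> carrier R" "n \<in> carrier M" for a n
    using that by (auto simp: M.act_simps simp flip: M.act_mult)
  moreover have "hact h n \<in> ?N" if h: "h \<in> carrier H" and n: "n \<in> ?N" for h n
  proof -
    have nM: "n \<in> carrier M" and n1: "ract \<one> n = n" using n by auto
    have 1: "linear_map K M M (ract \<one>)"
      by (intro linear_mapI[OF VM VM]) (simp_all add: M.act_simps)
    have 2: "linear_map K H M (\<lambda>k. ract \<one> (hact k n))"
      using nM by (intro linear_mapI[OF VH VM]) (simp_all add: M.act_simps M.HM.act_simps)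
    have bil: "bilinear_map K H H H (\<lambda>x y. \<epsilon> x \<odot>\<^bsub>H\<^esub> y)"
      by (rule H.counit_bilinear_left[OF VH])
    \<comment> \<open>Stability under \<open>H\<close>: in \<open>h (1 n)\<close> each
      \<open>h\<^sub>1 \<cdot> 1\<close> is the scalar \<open>\<epsilon>(h\<^sub>1)\<close>, and the
      counit law leaves \<open>1 (h n)\<close>.\<close>
    have "hact h (ract \<one> n) = sweedler K H \<Delta> M h (\<lambda>x y. ract \<one> (hact (\<epsilon> x \<odot>\<^bsub>H\<^esub> y) n))"
      unfolding M.hact_ract[OF h R.one_closed nM]
      by (rule H.sweedler_cong)
        (simp add: act_unit nM M.act_simps M.HM.act_simps H.counit_closed)
    also have "\<dots> = ract \<one> (hact h n)"
      using H.sweedler_map[OF bil 2 h] by (simp add: H.counit_left h)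
    finally show ?thesis using h n1 nM by (simp add: M.HM.act_simps)
  qed
  ultimately have N: "?N = {\<zero>\<^bsub>M\<^esub>} \<or> ?N = carrier M"
    by (intro M.no_proper_RH_submodule) auto
  obtain b n where bn: "b \<in> carrier R" "n \<in> carrier M" "ract b n \<noteq> \<zero>\<^bsub>M\<^esub>"
    using M.ract_nonzero by auto
  then have "?N \<noteq> {\<zero>\<^bsub>M\<^esub>}" using r[OF bn(1,2)] by auto
  with N m show ?thesis by auto
qed

text \<open>A subspace stable under \<open>R # H\<close> is stable under \<open>a = a # 1\<close>
  and under \<open>h = 1 # h\<close>. The second identification is where the unit of
  \<open>R\<close> must act as the identity.\<close>

lemma irreducible_RH_imp_smash:
  assumes M: "irreducible_RH_module K H \<Delta> R act M ract hact"
  shows "irreducible_module K RsH M (smash_act M ract hact)"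
proof -
  interpret M: irreducible_RH_module K H \<Delta> R act M ract hact by (rule M)
  note RM = M.RH_module_axioms
  note pure = smash_act_pure[OF RM] and unital = irreducible_RH_unital[OF M]
  show ?thesis
  proof (intro irreducible_module.intro irreducible_module_axioms.intro smash_act_module[OF RM])
    obtain b n where bn: "b \<in> carrier R" "n \<in> carrier M" "ract b n \<noteq> \<zero>\<^bsub>M\<^esub>"
      using M.ract_nonzero by auto
    then have "smash_act M ract hact (b \<sharp> \<one>\<^bsub>H\<^esub>) n \<noteq> \<zero>\<^bsub>M\<^esub>" by (simp add: pure M.hact_one)
    then show "\<exists>a\<in>carrier RsH. \<exists>m\<in>carrier M. smash_act M ract hact a m \<noteq> \<zero>\<^bsub>M\<^esub>"
      using bn by (intro bexI[of _ "b \<sharp> \<one>\<^bsub>H\<^esub>"] bexI[of _ n]) (simp_all add: RsH_simps smash_simps)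
    fix N assume N: "VectorSpace.subspace K N M"
      and closed: "\<And>a n. \<lbrakk>a \<in> carrier RsH; n \<in> N\<rbrakk> \<Longrightarrow> smash_act M ract hact a n \<in> N"
    have NM: "n \<in> carrier M" if "n \<in> N" for n using that subspaceD(1)[OF N] by blast
    have r: "ract a n \<in> N" if "a \<in> carrier R" "n \<in> N" for a n
      using closed[of "a \<sharp> \<one>\<^bsub>H\<^esub>" n] that NM by (simp add: RsH_simps smash_simps pure M.hact_one)
    have h: "hact h n \<in> N" if "h \<in> carrier H" "n \<in> N" for h n
      using closed[of "\<one> \<sharp> h" n] that NM
      by (simp add: RsH_simps smash_simps pure unital M.HM.act_simps)
    show "N = {\<zero>\<^bsub>M\<^esub>} \<or> N = carrier M" by (rule M.no_proper_RH_submodule[OF N r h])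
  qed
qed

text \<open>Compatibility of the two actions is the rule that \<open>(1 # h) (a # 1)\<close> is the
  sum of \<open>(h\<^sub>1 \<cdot> a) # h\<^sub>2\<close>. Conversely to the restriction of the
  action, \<open>a # h = (a # 1) (1 # h)\<close> makes every
  \<open>R\<close>-\<open>H\<close>-stable subspace stable under \<open>R # H\<close>.\<close>

lemma irreducible_smash_imp_RH:
  assumes M: "irreducible_module K RsH M sact"
  shows "irreducible_RH_module K H \<Delta> R act M (\<lambda>a. sact (a \<sharp> \<one>\<^bsub>H\<^esub>)) (\<lambda>h. sact (\<one> \<sharp> h))"
proof -
  interpret M: irreducible_module K RsH M sact by (rule M)
  note VM = M.vectorspace_axioms
  note s = M.act_simps[unfolded RsH_simps]
  note pc = smash_simps(1)
  let ?N = "{m \<in> carrier M. sact (\<one> \<sharp> \<one>\<^bsub>H\<^esub>) m = m}"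
  have one: "\<one> \<sharp> \<one>\<^bsub>H\<^esub> \<in> carrier RsH" using RsH.one_closed by (simp add: RsH_simps)
  obtain b n where bn: "b \<in> carrier RsH" "n \<in> carrier M" "sact b n \<noteq> \<zero>\<^bsub>M\<^esub>"
    using M.act_nonzero by auto
  have unital: "sact (\<one> \<sharp> \<one>\<^bsub>H\<^esub>) m = m" if m: "m \<in> carrier M" for m
  proof -
    have N: "VectorSpace.subspace K ?N M"
      by (rule subspaceI) (use one in \<open>auto simp: VM M.act_simps\<close>)
    have sN: "sact a n \<in> ?N" if "a \<in> carrier RsH" "n \<in> carrier M" for a n
      using that one M.act_mult[OF one that] RsH.l_one[OF that(1)] by
        (simp add: M.act_simps RsH_simps)
    then have "?N = {\<zero>\<^bsub>M\<^esub>} \<or> ?N = carrier M"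
      by (intro M.no_proper_submodule[OF N]) auto
    moreover have "?N \<noteq> {\<zero>\<^bsub>M\<^esub>}" using sN[OF bn(1,2)] bn(3) by auto
    ultimately show ?thesis using m by auto
  qed
  have mult: "sact x (sact y m) = sact (x \<otimes>\<^bsub>RsH\<^esub> y) m"
    if "x \<in> carrier RtH" "y \<in> carrier RtH" "m \<in> carrier M" for x y m
    using M.act_mult that by (simp add: RsH_simps)
  have s_lin: "linear_map K RtH M (\<lambda>x. sact x m)" if "m \<in> carrier M" for m
    using that by (intro linear_mapI[OF VP VM]) (simp_all add: s)
  show ?thesis
  proof (intro irreducible_RH_module.intro RH_module.intro algebra_module.intro VM
      algebra_module_axioms.intro RH_module_axioms.intro irreducible_RH_module_axioms.intro)
    show "bilinear_map K R M M (\<lambda>a. sact (a \<sharp> \<one>\<^bsub>H\<^esub>))"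
      by (rule bilinear_mapI[OF VR VM VM]) (simp_all add: smash_simps s)
    show "bilinear_map K H M M (\<lambda>h. sact (\<one> \<sharp> h))"
      by (rule bilinear_mapI[OF VH VM VM]) (simp_all add: smash_simps s)
    show "sact ((a \<otimes> b) \<sharp> \<one>\<^bsub>H\<^esub>) m = sact (a \<sharp> \<one>\<^bsub>H\<^esub>) (sact (b \<sharp> \<one>\<^bsub>H\<^esub>) m)"
      if "a \<in> carrier R" "b \<in> carrier R" "m \<in> carrier M" for a b m
      using that by (simp add: mult pc smash_left_R_mult)
    show "sact (\<one> \<sharp> (g \<otimes>\<^bsub>H\<^esub> h)) m = sact (\<one> \<sharp> g) (sact (\<one> \<sharp> h) m)"
      if "g \<in> carrier H" "h \<in> carrier H" "m \<in> carrier M" for g h m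
      using that by (simp add: mult pc smash_right_H_mult)
    show "sact (\<one> \<sharp> \<one>\<^bsub>H\<^esub>) m = m" if "m \<in> carrier M" for m by (rule unital[OF that])
    show "sact (\<one> \<sharp> h) (sact (a \<sharp> \<one>\<^bsub>H\<^esub>) m) =
        sweedler K H \<Delta> M h (\<lambda>x y. sact ((x \<cdot> a) \<sharp> \<one>\<^bsub>H\<^esub>) (sact (\<one> \<sharp> y) m))"
      if h: "h \<in> carrier H" and a: "a \<in> carrier R" and m: "m \<in> carrier M" for h a m
    proof -
      have bil: "bilinear_map K H H RtH (\<lambda>x y. (x \<cdot> a) \<sharp> y)"
        using a by (intro bilinear_mapI[OF VH VH VP]) (simp_all add: smash_simps act_simps)
      have "sact (\<one> \<sharp> h) (sact (a \<sharp> \<one>\<^bsub>H\<^esub>) m) = sact (sweedler K H \<Delta> RtH h (\<lambda>x y. (x \<cdot> a) \<sharp> y)) m"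
        using h a m by (simp add: mult pc smash_pure_mult_pure act_simps cong: H.sweedler_cong)
      also have "\<dots> = sweedler K H \<Delta> M h (\<lambda>x y. sact ((x \<cdot> a) \<sharp> y) m)"
        by (rule H.sweedler_map[OF bil s_lin[OF m] h])
      finally show ?thesis
        using a m by (simp add: mult pc act_simps smash_left_R_mult cong: H.sweedler_cong)
    qed
    \<comment> \<open>A vector on which \<open>R\<close> acts nontrivially: the unit of
      \<open>R\<close> fixes the nonzero vector \<open>b n\<close>.\<close>
    have "sact (\<one> \<sharp> \<one>\<^bsub>H\<^esub>) (sact b n) \<noteq> \<zero>\<^bsub>M\<^esub>"
      using bn by (simp add: unital M.act_simps)
    then show "\<exists>a\<in>carrier R. \<exists>m\<in>carrier M. sact (a \<sharp> \<one>\<^bsub>H\<^esub>) m \<noteq> \<zero>\<^bsub>M\<^esub>"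
      using bn M.act_simps(1) R.one_closed by blast
    fix N assume N: "VectorSpace.subspace K N M"
      and r: "\<And>a n. \<lbrakk>a \<in> carrier R; n \<in> N\<rbrakk> \<Longrightarrow> sact (a \<sharp> \<one>\<^bsub>H\<^esub>) n \<in> N"
      and h: "\<And>h n. \<lbrakk>h \<in> carrier H; n \<in> N\<rbrakk> \<Longrightarrow> sact (\<one> \<sharp> h) n \<in> N"
    show "N = {\<zero>\<^bsub>M\<^esub>} \<or> N = carrier M"
    proof (rule M.no_proper_submodule[OF N])
      fix x n assume x: "x \<in> carrier RsH" and n: "n \<in> N"
      have nM: "n \<in> carrier M" using n subspaceD(1)[OF N] by blast
      show "sact x n \<in> N"
      proof (rule tensor_linear_in_subspace[OF VR VH s_lin[OF nM] N])
        fix a h' assume ah: "a \<in> carrier R" "h' \<in> carrier H"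
        have "sact (a \<sharp> h') n = sact (a \<sharp> \<one>\<^bsub>H\<^esub>) (sact (\<one> \<sharp> h') n)"
          using ah nM by (simp add: mult pc smash_left_R_mult)
        then show "sact (a \<sharp> h') n \<in> N" using r[OF ah(1) h[OF ah(2) n]] by simp
      qed (use x in \<open>simp add: RsH_simps\<close>)
    qed
  qed
qed

abbreviation rHj where "rHj \<equiv> H_jacobson_radical K H \<Delta> R act"
abbreviation J where "J \<equiv> jacobson_radical K RsH"

text \<open>Both radicals quantify over modules whose elements have type
  \<open>('e, 'c) tensor set\<close>, and passing between \<open>R\<close>-\<open>H\<close>-modules
  and \<open>R # H\<close>-modules keeps the underlying space; so the two families of annihilators
  match without any transport.\<close>

lemma rHj_iff: "a \<in> rHj \<longleftrightarrow> a \<in> carrier R \<and> a \<sharp> \<one>\<^bsub>H\<^esub> \<in> J"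
proof
  assume a: "a \<in> rHj"
  then have aR: "a \<in> carrier R" by (simp add: H_jacobson_radical_def)
  have "a \<sharp> \<one>\<^bsub>H\<^esub> \<in> J"
  proof (rule RsH.jacobson_radicalI)
    show "a \<sharp> \<one>\<^bsub>H\<^esub> \<in> carrier RsH" using aR by (simp add: RsH_simps smash_simps)
    fix M :: "('a, ('e, 'c) tensor set) module" and sact m
    assume "irreducible_module K RsH M sact" "m \<in> carrier M"
    then show "sact (a \<sharp> \<one>\<^bsub>H\<^esub>) m = \<zero>\<^bsub>M\<^esub>"
      using irreducible_smash_imp_RH[of M sact] a unfolding H_jacobson_radical_def by blast
  qed
  with aR show "a \<in> carrier R \<and> a \<sharp> \<one>\<^bsub>H\<^esub> \<in> J" by blast
next
  assume a: "a \<in> carrier R \<and> a \<sharp> \<one>\<^bsub>H\<^esub> \<in> J"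
  have "ract a m = \<zero>\<^bsub>M\<^esub>"
    if M: "irreducible_RH_module K H \<Delta> R act M ract hact" and m: "m \<in> carrier M"
    for M :: "('a, ('e, 'c) tensor set) module" and ract hact m
  proof -
    interpret M: irreducible_RH_module K H \<Delta> R act M ract hact by (rule M)
    have "smash_act M ract hact (a \<sharp> \<one>\<^bsub>H\<^esub>) m = \<zero>\<^bsub>M\<^esub>"
      using RsH.jacobson_radicalD(2)[OF _ irreducible_RH_imp_smash[OF M] m] a by blast
    then show ?thesis using a m by (simp add: smash_act_pure[OF M.RH_module_axioms] M.hact_one)
  qed
  then show "a \<in> rHj" using a by (simp add: H_jacobson_radical_def)
qed

section \<open>The ideal \<open>r\<^sub>H\<^sub>j(R)\<close>\<close>

lemmas J_ideal = RsH.jacobson_radical_ideal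
lemmas J_subspace = RsH.left_ideal_subspace[OF J_ideal(1)]

lemma rHj_ideal:
  shows "left_ideal R rHj" and "\<lbrakk>x \<in> rHj; a \<in> carrier R\<rbrakk> \<Longrightarrow> x \<otimes> a \<in> rHj"
proof -
  note Jd = left_idealD[OF J_ideal(1), unfolded RsH_simps]
  have p: "a \<sharp> \<one>\<^bsub>H\<^esub> \<in> carrier RsH" if "a \<in> carrier R" for a
    using that by (simp add: RsH_simps smash_simps)
  show "left_ideal R rHj"
    unfolding left_ideal_def
  proof (intro conjI ballI)
    show "\<zero> \<in> rHj" using Jd(3) by (simp add: rHj_iff smash_zero)
    show "x \<oplus> y \<in> rHj" if "x \<in> rHj" "y \<in> rHj" for x y
      using that Jd(4) by (simp add: rHj_iff smash_simps)
    show "a \<otimes> x \<in> rHj" if a: "a \<in> carrier R" and x: "x \<in> rHj" for a x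
      using x a left_idealD(5)[OF J_ideal(1) p[OF a], of "x \<sharp> \<one>\<^bsub>H\<^esub>"]
      by (simp add: rHj_iff smash_left_R_mult)
  qed (auto simp: rHj_iff)
  show "x \<otimes> a \<in> rHj" if x: "x \<in> rHj" and a: "a \<in> carrier R"
    using x a J_ideal(2)[of "x \<sharp> \<one>\<^bsub>H\<^esub>", OF _ p[OF a]] by (simp add: rHj_iff smash_left_R_mult)
qed

text \<open>In \<open>R # H\<close> we have \<open>h \<cdot> x = \<Sum> h\<^sub>1 x S(h\<^sub>2)\<close>.\<close>

lemma rHj_stable:
  assumes x: "x \<in> rHj" and h: "h \<in> carrier H"
  shows "h \<cdot> x \<in> rHj"
proof -
  have xR: "x \<in> carrier R" and xJ: "x \<sharp> \<one>\<^bsub>H\<^esub> \<in> J" using x by (auto simp: rHj_iff)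
  note S = linear_mapD(3-5)[OF H.antipode_linear]
  let ?T = "\<lambda>u v w. (u \<cdot> x) \<sharp> (v \<otimes>\<^bsub>H\<^esub> S w)"
  have T: "trilinear_map K H RtH ?T"
    by (rule trilinear_mapI[OF VH VP])
      (simp_all add: xR act_simps smash_simps S H.l_distr H.r_distr
        H.smult_mult_left H.smult_mult_right)
  have J_sub: "VectorSpace.subspace K J RtH" using J_subspace by (simp add: subspace_RsH_iff)
  have bil: "bilinear_map K H H RtH (\<lambda>u v. sweedler K H \<Delta> RtH u (\<lambda>u\<^sub>1 u\<^sub>2. ?T u\<^sub>1 u\<^sub>2 v))"
    by (rule H.sweedler_left_bilinear[OF T VP])
  have inJ: "sweedler K H \<Delta> RtH u (\<lambda>u\<^sub>1 u\<^sub>2. ?T u\<^sub>1 u\<^sub>2 v) \<in> J"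
    if uv: "u \<in> carrier H" "v \<in> carrier H" for u v
  proof -
    have Sv: "\<one> \<sharp> S v \<in> carrier RtH" using uv by (simp add: smash_simps S)
    have ux: "bilinear_map K H H RtH (\<lambda>y z. (y \<cdot> x) \<sharp> z)"
      by (rule bilinear_mapI[OF VH VH VP]) (simp_all add: xR act_simps smash_simps)
    have lin: "linear_map K RtH RtH (\<lambda>t. t \<otimes>\<^bsub>RsH\<^esub> (\<one> \<sharp> S v))"
      using Sv by (intro linear_mapI[OF VP VP]) (simp_all add: smash_mult smash_mult_simps)
    have "(\<one> \<sharp> u) \<otimes>\<^bsub>RsH\<^esub> (x \<sharp> \<one>\<^bsub>H\<^esub>) = sweedler K H \<Delta> RtH u (\<lambda>y z. (y \<cdot> x) \<sharp> z)"
      using uv xR by (simp add: smash_pure_mult_pure act_simps cong: H.sweedler_cong)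
    then have "(\<one> \<sharp> u) \<otimes>\<^bsub>RsH\<^esub> (x \<sharp> \<one>\<^bsub>H\<^esub>) \<otimes>\<^bsub>RsH\<^esub> (\<one> \<sharp> S v) =
        sweedler K H \<Delta> RtH u (\<lambda>u\<^sub>1 u\<^sub>2. ?T u\<^sub>1 u\<^sub>2 v)"
      using uv xR H.sweedler_map[OF ux lin uv(1)]
      by (simp add: smash_right_H_mult act_simps S cong: H.sweedler_cong)
    moreover have "(\<one> \<sharp> u) \<otimes>\<^bsub>RsH\<^esub> (x \<sharp> \<one>\<^bsub>H\<^esub>) \<otimes>\<^bsub>RsH\<^esub> (\<one> \<sharp> S v) \<in> J"
      by (intro J_ideal(2) left_idealD(5)[OF J_ideal(1)] xJ)
        (use uv Sv in \<open>simp_all add: RsH_simps smash_simps\<close>)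
    ultimately show ?thesis by simp
  qed
  have "sweedler K H \<Delta> RtH h (\<lambda>u v. sweedler K H \<Delta> RtH u (\<lambda>u\<^sub>1 u\<^sub>2. ?T u\<^sub>1 u\<^sub>2 v)) \<in> J"
    by (rule H.sweedler_in_subspace[OF bil VP J_sub inJ h])
  also have "sweedler K H \<Delta> RtH h (\<lambda>u v. sweedler K H \<Delta> RtH u (\<lambda>u\<^sub>1 u\<^sub>2. ?T u\<^sub>1 u\<^sub>2 v)) =
      sweedler K H \<Delta> RtH h (\<lambda>u v. sweedler K H \<Delta> RtH v (?T u))"
    by (rule H.sweedler_coassociative[OF T VP h])
  also have "\<dots> = sweedler K H \<Delta> RtH h (\<lambda>u v. ((\<epsilon> v \<odot>\<^bsub>H\<^esub> u) \<cdot> x) \<sharp> \<one>\<^bsub>H\<^esub>)"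
  proof (rule H.sweedler_cong)
    fix u v assume uv: "u \<in> carrier H" "v \<in> carrier H"
    have xS: "bilinear_map K H H H (\<lambda>x y. x \<otimes>\<^bsub>H\<^esub> S y)"
      by (rule bilinear_mapI[OF VH VH VH])
        (simp_all add: S H.l_distr H.r_distr H.smult_mult_left H.smult_mult_right)
    have lin: "linear_map K H RtH (\<lambda>k. (u \<cdot> x) \<sharp> k)"
      using uv xR by (intro linear_mapI[OF VH VP]) (simp_all add: act_simps smash_simps)
    show "sweedler K H \<Delta> RtH v (?T u) = ((\<epsilon> v \<odot>\<^bsub>H\<^esub> u) \<cdot> x) \<sharp> \<one>\<^bsub>H\<^esub>"
      using H.sweedler_map[OF xS lin uv(2)] uv xR
      by (simp add: H.antipode_right smash_simps act_simps H.counit_closed)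
  qed
  also have "\<dots> = (h \<cdot> x) \<sharp> \<one>\<^bsub>H\<^esub>"
  proof -
    have lin: "linear_map K H RtH (\<lambda>k. (k \<cdot> x) \<sharp> \<one>\<^bsub>H\<^esub>)"
      using xR by (intro linear_mapI[OF VH VP]) (simp_all add: act_simps smash_simps)
    show ?thesis
      using H.sweedler_map[OF H.counit_bilinear[OF VH] lin h] by (simp add: H.counit_right h)
  qed
  finally show ?thesis using xR h by (simp add: rHj_iff act_simps)
qed

section \<open>The subalgebras \<open>I # H\<close>\<close>

lemmas TG = comm_group_tensor_group[OF VR VH]

lemma smash_ideal_generators:
  "I \<subseteq> carrier R \<Longrightarrow> {a \<sharp> h | a h. a \<in> I \<and> h \<in> carrier H} \<subseteq> carrier (tensor_group K R H)"
  by (auto simp: tensor_space_simps smash_simps)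

lemma smash_ideal_subgroup:
  assumes "I \<subseteq> carrier R"
  shows "subgroup (smash_ideal K H R I) (tensor_group K R H)"
proof -
  interpret T: comm_group "tensor_group K R H" by (rule TG)
  show ?thesis
    unfolding smash_ideal_def by (rule T.generate_is_subgroup[OF smash_ideal_generators[OF assms]])
qed

text \<open>For \<open>b \<in> I\<close>, the product \<open>(a # h) (b # g)\<close> is the sum of
  \<open>a (h\<^sub>1 \<cdot> b) # h\<^sub>2 g\<close>: stability keeps
  \<open>h\<^sub>1 \<cdot> b\<close> in \<open>I\<close>, and the left ideal property keeps
  \<open>a (h\<^sub>1 \<cdot> b)\<close> there.\<close>

lemma smash_ideal_left_ideal:
  assumes I: "left_ideal R I" and stable: "\<And>h x. \<lbrakk>h \<in> carrier H; x \<in> I\<rbrakk> \<Longrightarrow> h \<cdot> x \<in> I"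
  shows "left_ideal RsH (smash_ideal K H R I)"
proof -
  interpret T: comm_group "tensor_group K R H" by (rule TG)
  note Id = left_idealD[OF I]
  let ?I = "smash_ideal K H R I"
  note sub = smash_ideal_subgroup[OF Id(1)]
  note subD = subgroup.subset[OF sub] subgroup.m_closed[OF sub] subgroup.one_closed[OF sub]
  note subD' = subD[unfolded tensor_space_simps]
  have gen: "a \<sharp> h \<in> ?I" if "a \<in> I" "h \<in> carrier H" for a h
    unfolding smash_ideal_def by (rule generate.incl) (use that in blast)
  have hom: "f \<in> hom (tensor_group K R H) (tensor_group K R H)" if "linear_map K RtH RtH f" for f
    using linear_mapD[OF that] by (auto intro!: homI simp: tensor_space_simps)
  have mult: "x \<otimes>\<^bsub>RsH\<^esub> y \<in> ?I" if x: "x \<in> carrier RtH" and y: "y \<in> ?I" for x y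
  proof -
    have yP: "y \<in> carrier RtH" using y subD'(1) by blast
    have lin: "linear_map K RtH RtH (\<lambda>x. x \<otimes>\<^bsub>RsH\<^esub> y)"
      using yP by (intro linear_mapI[OF VP VP]) (simp_all add: smash_mult smash_mult_simps)
    show ?thesis
    proof (rule tensor_hom_in_subgroup[OF VR VH TG hom[OF lin] sub])
      fix a h assume ah: "a \<in> carrier R" "h \<in> carrier H"
      \<comment> \<open>The left factor is now pure. The right factor is reduced to a generator
        \<open>b # g\<close> separately, because it ranges over the generated subgroup only.\<close>
      have "smash_ract a (smash_hact h y) \<in> ?I"
      proof (rule generate_mapped[OF TG hom[OF
        linear_map_compose[OF smash_hact_linear smash_ract_linear]] sub
            smash_ideal_generators[OF Id(1)] _ y[unfolded smash_ideal_def]])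
        fix z assume "z \<in> {a \<sharp> h |a h. a \<in> I \<and> h \<in> carrier H}"
        then obtain b g where bg: "b \<in> I" "g \<in> carrier H" "z = b \<sharp> g" by blast
        have bR: "b \<in> carrier R" using bg Id by blast
        have bil: "bilinear_map K H H RtH (\<lambda>x y. (a \<otimes> x \<cdot> b) \<sharp> (y \<otimes>\<^bsub>H\<^esub> g))"
          using ah bR bg by (intro bilinear_mapI[OF VH VH VP])
            (simp_all add: act_simps smash_simps R.r_distr R.smult_mult_right H.l_distr
              H.smult_mult_left)
        have "sweedler K H \<Delta> RtH h (\<lambda>x y. (a \<otimes> x \<cdot> b) \<sharp> (y \<otimes>\<^bsub>H\<^esub> g)) \<in> ?I"
          unfolding sweedler_def tensor_lift_tensor_group[symmetric]
        proof (rule tensor_hom_in_subgroup[OF VH VH TG _ sub])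
          show "tensor_lift K H H (tensor_group K R H) (\<lambda>x y. (a \<otimes> x \<cdot> b) \<sharp> (y \<otimes>\<^bsub>H\<^esub> g))
              \<in> hom (tensor_group K H H) (tensor_group K R H)"
            using bilinear_tensor_lift(1)[OF VH VH VP bil]
            by (simp add: tensor_lift_tensor_group hom_def tensor_space_simps)
          show "\<Delta> h \<in> carrier (tensor_group K H H)"
            using H.comult_closed[OF ah(2)] by (simp add: tensor_space_simps)
          fix u v assume uv: "u \<in> carrier H" "v \<in> carrier H"
          show "tensor_lift K H H (tensor_group K R H) (\<lambda>x y. (a \<otimes> x \<cdot> b) \<sharp> (y \<otimes>\<^bsub>H\<^esub> g))
              (pure_tensor K H H u v) \<in> ?I"
            using uv ah bg stable Id(5)
            by (simp add: tensor_lift_tensor_group tensor_lift_pure_bilinear[OF VH VH VP bil] gen)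
        qed
        then show "smash_ract a (smash_hact h z) \<in> ?I"
          using ah bg bR by (simp add: smash_pure_mult_pure smash_simps flip: smash_pure_mult)
      qed (use ah in simp_all)
      then show "(a \<sharp> h) \<otimes>\<^bsub>RsH\<^esub> y \<in> ?I" using ah yP by (simp add: smash_pure_mult)
    qed (use x in \<open>simp add: tensor_space_simps\<close>)
  qed
  show ?thesis
    unfolding left_ideal_def RsH_simps using subD' mult by blast
qed

text \<open>A generator is \<open>a # h = (a # 1) (1 # h)\<close>, and the radical of
  \<open>R # H\<close> is closed under right multiplication.\<close>

lemma smash_ideal_rHj_subset: "smash_ideal K H R rHj \<subseteq> J"
proof -
  interpret T: comm_group "tensor_group K R H" by (rule TG)
  have "subgroup J (tensor_group K R H)"
  proof -
    have "subgroup J (add_monoid RsH)"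
      using subspaceD[OF J_subspace] subspace_neg[OF J_subspace]
      by unfold_locales (auto simp: a_inv_def[symmetric])
    then show ?thesis
      by (simp add: subgroup_def m_inv_def tensor_space_simps RsH_simps)
  qed
  moreover have "a \<sharp> h \<in> J" if "a \<in> rHj" "h \<in> carrier H" for a h
  proof -
    have "(a \<sharp> \<one>\<^bsub>H\<^esub>) \<otimes>\<^bsub>RsH\<^esub> (\<one> \<sharp> h) \<in> J"
      by (rule J_ideal(2)) (use that in \<open>simp_all add: rHj_iff RsH_simps smash_simps\<close>)
    then show ?thesis using that smash_decompose[of a h] by (simp add: rHj_iff)
  qed
  ultimately show ?thesis
    unfolding smash_ideal_def by (intro T.generate_subgroup_incl) auto
qed

lemma jacobson_radical_smash_rHj:
  "jacobson_radical K (RsH\<lparr>carrier := smash_ideal K H R rHj\<rparr>) = smash_ideal K H R rHj"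
  by (rule RsH.jacobson_radical_left_ideal_eq[OF
        smash_ideal_left_ideal[OF rHj_ideal(1) rHj_stable] smash_ideal_rHj_subset])

section \<open>Finite-dimensional Hopf algebras\<close>

text \<open>The map \<open>id \<otimes> \<epsilon>\<close> need not be multiplicative, but it is
  left \<open>R\<close>-linear, which is enough to carry \<open>((1 - x) # 1) u = 1\<close> to
  \<open>(1 - x) p(u) = 1\<close>.\<close>

lemma rHj_subset_jacobson: "rHj \<subseteq> jacobson_radical K R"
proof (rule R.quasi_regular_ideal_subset[OF rHj_ideal])
  fix x assume x: "x \<in> rHj"
  have xR: "x \<in> carrier R" and xJ: "x \<sharp> \<one>\<^bsub>H\<^esub> \<in> J" using x by (auto simp: rHj_iff)
  obtain u where u: "u \<in> carrier RsH" "(\<one>\<^bsub>RsH\<^esub> \<ominus>\<^bsub>RsH\<^esub> (x \<sharp> \<one>\<^bsub>H\<^esub>)) \<otimes>\<^bsub>RsH\<^esub> u = \<one>\<^bsub>RsH\<^esub>"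
    using RsH.jacobson_radical_inverse[OF xJ] by blast
  have uP: "u \<in> carrier RtH" using u by (simp add: RsH_simps)
  have xP: "x \<sharp> \<one>\<^bsub>H\<^esub> \<in> carrier RsH" using xR by (simp add: RsH_simps smash_simps)
  have "((\<one> \<ominus> x) \<sharp> \<one>\<^bsub>H\<^esub>) \<oplus>\<^bsub>RsH\<^esub> (x \<sharp> \<one>\<^bsub>H\<^esub>) = \<one>\<^bsub>RsH\<^esub>"
    using xR by (simp add: RsH_simps smash_simps(2)[symmetric] R.minus_eq R.a_assoc R.l_neg)
  moreover have "(\<one> \<ominus> x) \<sharp> \<one>\<^bsub>H\<^esub> \<in> carrier RsH" using xR by (simp add: RsH_simps smash_simps)
  ultimately have 1: "\<one>\<^bsub>RsH\<^esub> \<ominus>\<^bsub>RsH\<^esub> (x \<sharp> \<one>\<^bsub>H\<^esub>) = (\<one> \<ominus> x) \<sharp> \<one>\<^bsub>H\<^esub>"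
    using xP by (metis RsH.minus_eq RsH.a_assoc RsH.r_neg RsH.r_zero RsH.a_inv_closed)
  have bil: "bilinear_map K R H R (\<lambda>b g. \<epsilon> g \<odot> b)"
    by (rule H.counit_bilinear[OF VR])
  let ?p = "tensor_lift K R H (add_monoid R) (\<lambda>b g. \<epsilon> g \<odot> b)"
  note p = tensor_lift_linear[OF VR VH VR bil]
  note p_pure = tensor_lift_pure_bilinear[OF VR VH VR bil]
  have "?p (smash_ract a t) = a \<otimes> ?p t" if a: "a \<in> carrier R" and t: "t \<in> carrier RtH" for a t
  proof (rule tensor_linear_eqI[OF VR VH linear_map_compose[OF smash_ract_linear[OF a] p] _ _ t])
    show "linear_map K RtH R (\<lambda>t. a \<otimes> ?p t)"
      by (rule linear_map_compose[OF p])
        (use a in \<open>auto intro!: linear_mapI[OF VR VR] simp: R.r_distr R.smult_mult_right\<close>)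
  qed (simp add: a smash_ract_pure p_pure H.counit_closed R.smult_mult_right)
  moreover have "smash_ract (\<one> \<ominus> x) u = \<one>\<^bsub>RsH\<^esub>"
    using u xR uP by (simp add: 1 smash_pure_mult smash_hact_one)
  ultimately have "(\<one> \<ominus> x) \<otimes> ?p u = ?p \<one>\<^bsub>RsH\<^esub>" using xR uP by (metis R.minus_closed R.one_closed)
  also have "\<dots> = \<one>"
    using ring_hom_one[OF H.counit_ring_hom] by (simp add: RsH_simps p_pure)
  finally show "\<exists>w\<in>carrier R. (\<one> \<ominus> x) \<otimes> w = \<one>" using linear_mapD(3)[OF p uP] by blast
qed

section \<open>The ideal \<open>rjH\<close> and its comparison with \<open>rHj\<close>\<close>

abbreviation rjH where "rjH \<equiv> jacobson_H_core K H R act"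

lemma rHj_subset_rjH: "rHj \<subseteq> rjH"
  using rHj_stable rHj_subset_jacobson by (auto simp: jacobson_H_core_def rHj_iff)

lemma rjH_stable: "\<lbrakk>h \<in> carrier H; x \<in> rjH\<rbrakk> \<Longrightarrow> h \<cdot> x \<in> rjH"
  by (auto simp: jacobson_H_core_def act_simps simp flip: act_mult)

lemma rjH_subset: "rjH \<subseteq> jacobson_radical K R"
proof
  fix x assume "x \<in> rjH"
  then show "x \<in> jacobson_radical K R"
    using H.one_closed act_one[of x] by (force simp: jacobson_H_core_def)
qed

text \<open>In \<open>h \<cdot> (a x)\<close>, the sum of
  \<open>(h\<^sub>1 \<cdot> a) (h\<^sub>2 \<cdot> x)\<close>, every summand lies in the two-sided
  ideal \<open>r_j(R)\<close>; likewise for \<open>x a\<close>.\<close>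

lemma rjH_ideal:
  shows "left_ideal R rjH" and "\<lbrakk>x \<in> rjH; a \<in> carrier R\<rbrakk> \<Longrightarrow> x \<otimes> a \<in> rjH"
proof -
  note JR = R.jacobson_radical_ideal note JRd = left_idealD[OF JR(1)]
  note JRs = R.left_ideal_subspace[OF JR(1)]
  have rj: "x \<in> carrier R" "\<And>h. h \<in> carrier H \<Longrightarrow> h \<cdot> x \<in> jacobson_radical K R" if "x \<in> rjH" for x
    using that by (auto simp: jacobson_H_core_def)
  have bil: "bilinear_map K H H R (\<lambda>h k. (h \<cdot> a) \<otimes> (k \<cdot> b))"
    if "a \<in> carrier R" "b \<in> carrier R" for a b
    using that by (intro bilinear_mapI[OF VH VH VR])
      (simp_all add: act_simps R.l_distr R.r_distr R.smult_mult_left R.smult_mult_right)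
  have zero: "h \<cdot> \<zero> = \<zero>" if "h \<in> carrier H" for h
    by (rule linear_mapD(6)[OF bilinear_mapD(1)[OF act_bilinear that]])
  have mult: "a \<otimes> x \<in> rjH" if a: "a \<in> carrier R" and x: "x \<in> rjH" for a x
  proof -
    have "h \<cdot> (a \<otimes> x) \<in> jacobson_radical K R" if h: "h \<in> carrier H" for h
      unfolding act_prod[OF h a rj(1)[OF x]]
      by (rule H.sweedler_in_subspace[OF bil[OF a rj(1)[OF x]] VR JRs _ h])
        (simp add: JRd(5) rj[OF x] a act_simps)
    then show ?thesis using a rj[OF x] by (simp add: jacobson_H_core_def)
  qed
  show "x \<otimes> a \<in> rjH" if x: "x \<in> rjH" and a: "a \<in> carrier R"
  proof -
    have "h \<cdot> (x \<otimes> a) \<in> jacobson_radical K R" if h: "h \<in> carrier H" for h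
      unfolding act_prod[OF h rj(1)[OF x] a]
      by (rule H.sweedler_in_subspace[OF bil[OF rj(1)[OF x] a] VR JRs _ h])
        (simp add: JR(2) rj[OF x] a act_simps)
    then show ?thesis using a rj[OF x] by (simp add: jacobson_H_core_def)
  qed
  show "left_ideal R rjH"
    unfolding left_ideal_def
  proof (intro conjI ballI)
    show "\<zero> \<in> rjH" using JRd(3) by (simp add: jacobson_H_core_def zero)
    show "x \<oplus> y \<in> rjH" if "x \<in> rjH" "y \<in> rjH" for x y
      using rj[OF that(1)] rj[OF that(2)] JRd(4) by (simp add: jacobson_H_core_def act_simps)
  qed (auto simp: mult rj)
qed

text \<open>The span \<open>IM\<close> of all products from \<open>rjH\<close> and \<open>M\<close>
  is an \<open>R\<close>-\<open>H\<close>-submodule, so it is zero or \<open>M\<close>. In the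
  second case Nakayama's lemma over \<open>R\<close> applies, because \<open>rjH\<close> lies in
  \<open>r_j(R)\<close> and \<open>M\<close> has finitely many generators.\<close>

lemma rjH_subset_rHj:
  assumes fin: "vectorspace.fin_dim K H"
  shows "rjH \<subseteq> rHj"
proof
  fix x assume x: "x \<in> rjH"
  note rjR = left_idealD(2)[OF rjH_ideal(1)]
  have "ract x m = \<zero>\<^bsub>M\<^esub>"
    if M: "irreducible_RH_module K H \<Delta> R act M ract hact" and m: "m \<in> carrier M"
    for M :: "('a, ('e, 'c) tensor set) module" and ract hact m
  proof (rule ccontr)
    assume xm: "ract x m \<noteq> \<zero>\<^bsub>M\<^esub>"
    interpret M: irreducible_RH_module K H \<Delta> R act M ract hact by (rule M)
    note VM = M.vectorspace_axioms and RM = M.RH_module_axioms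
    \<comment> \<open>As the least subspace containing the products, \<open>IM\<close> is mapped
      into itself by a linear map as soon as the products are.\<close>
    define IM where "IM = \<Inter>{N. VectorSpace.subspace K N M \<and> (\<forall>a\<in>rjH. \<forall>m\<in>carrier M. ract a m \<in> N)}"
    have all: "VectorSpace.subspace K (carrier M) M \<and> (\<forall>a\<in>rjH. \<forall>m\<in>carrier M. ract a m \<in> carrier M)"
      using rjR by (auto intro!: subspaceI simp: VM M.act_simps)
    have IM: "VectorSpace.subspace K IM M"
    proof (rule subspaceI)
      show "IM \<subseteq> carrier M" unfolding IM_def using all by blast
    qed (auto simp: IM_def VM dest: subspaceD(2-4))
    note IMd = subspaceD[OF IM]
    have gen: "ract a m \<in> IM" if "a \<in> rjH" "m \<in> carrier M" for a m
      using that by (auto simp: IM_def)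
    have least: "IM \<subseteq> N"
      if "VectorSpace.subspace K N M" "\<And>a m. \<lbrakk>a \<in> rjH; m \<in> carrier M\<rbrakk> \<Longrightarrow> ract a m \<in> N"
      for N using that by (auto simp: IM_def)
    have closed: "f n \<in> IM" if f: "linear_map K M M f" and n: "n \<in> IM"
      and f_gen: "\<And>a m. \<lbrakk>a \<in> rjH; m \<in> carrier M\<rbrakk> \<Longrightarrow> f (ract a m) \<in> IM" for f n
    proof -
      have "VectorSpace.subspace K {n \<in> carrier M. f n \<in> IM} M"
        by (rule subspaceI[OF VM]) (auto simp: VM linear_mapD(4-6)[OF f] IMd)
      then have "IM \<subseteq> {n \<in> carrier M. f n \<in> IM}"
        by (rule least) (use f_gen rjR M.act_simps(1) in blast)
      then show ?thesis using n by blast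
    qed
    have r: "ract b n \<in> IM" if b: "b \<in> carrier R" and n: "n \<in> IM" for b n
    proof (rule closed[OF _ n])
      show "linear_map K M M (ract b)" using b by (intro linear_mapI[OF VM VM])
        (simp_all add: M.act_simps)
      show "ract b (ract a m) \<in> IM" if "a \<in> rjH" "m \<in> carrier M" for a m
        using that b gen[OF left_idealD(5)[OF rjH_ideal(1) b that(1)] that(2)] rjR
        by (simp add: M.act_mult)
    qed
    have h: "hact h n \<in> IM" if h: "h \<in> carrier H" and n: "n \<in> IM" for h n
    proof (rule closed[OF _ n])
      show "linear_map K M M (hact h)" using h by (intro linear_mapI[OF VM VM])
        (simp_all add: M.HM.act_simps)
      show "hact h (ract a m) \<in> IM" if a: "a \<in> rjH" and m: "m \<in> carrier M" for a m
        unfolding M.hact_ract[OF h rjR[OF a] m]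
        by (rule H.sweedler_in_subspace[OF M.hact_ract_bilinear[OF act_bilinear rjR[OF a] m]
          VM IM _ h])
          (simp add: gen rjH_stable a m M.HM.act_simps)
    qed
    have "ract x m \<in> IM" by (rule gen[OF x m])
    with xm M.no_proper_RH_submodule[OF IM r h] have IM_eq: "IM = carrier M" by blast
    obtain B where B: "finite B" "B \<subseteq> carrier H" "module.span K H B = carrier H"
      using fin unfolding H.fin_dim_def by blast
    have irr: "irreducible_module K RsH M (smash_act M ract hact)"
      by (rule irreducible_RH_imp_smash[OF M])
    interpret S: irreducible_module K RsH M "smash_act M ract hact" by (rule irr)
    have "carrier M = {\<zero>\<^bsub>M\<^esub>}"
    proof (rule M.Nakayama[OF R.unital_algebra_axioms irreducible_RH_unital[OF M]
      rjH_ideal(1) rjH_subset rjH_ideal(2)])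
      show "N = carrier M" if "VectorSpace.subspace K N M" "\<And>a m. \<lbrakk>a \<in> rjH; m \<in> carrier M\<rbrakk> \<Longrightarrow>
        ract a m \<in> N" for N
        using least[OF that] subspaceD(1)[OF that(1)] IM_eq by blast
      show "finite ((\<lambda>h. hact h m) ` B)" using B by blast
      show "(\<lambda>h. hact h m) ` B \<subseteq> carrier M" using B m by (auto simp: M.HM.act_simps)
      fix N assume N: "M.submodule_of N" and BN: "(\<lambda>h. hact h m) ` B \<subseteq> N"
      note Nd = subspaceD[OF N[THEN conjunct1]]
      \<comment> \<open>The generators over \<open>R\<close> are the vectors \<open>h m\<close> with
        \<open>h\<close> in a finite spanning set of \<open>H\<close>. The elements \<open>h\<close>
        with \<open>h m \<in> N\<close> form a subspace, so containing the spanning set means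
        containing \<open>H\<close>.\<close>
      let ?H = "{h \<in> carrier H. hact h m \<in> N}"
      have "VectorSpace.subspace K ?H H"
        by (rule subspaceI[OF VH]) (auto simp: M.HM.act_simps m Nd)
      then have "submodule K ?H H" by (simp add: VectorSpace.subspace_def)
      then have "module.span K H B \<subseteq> ?H"
        by (intro H.span_is_subset) (use B BN in auto)
      then have hN: "hact h m \<in> N" if "h \<in> carrier H" for h using that B(3) by blast
      have lin: "linear_map K RtH M (\<lambda>x. smash_act M ract hact x m)"
        by (rule bilinear_mapD(2)[OF smash_act_bilinear[OF RM] m])
      have in_N: "smash_act M ract hact t m \<in> N" if "t \<in> carrier RtH" for t
        by (rule tensor_linear_in_subspace[OF VR VH lin N[THEN conjunct1] _ that])
          (use N hN in \<open>auto simp: smash_act_pure[OF RM] m\<close>)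
      \<comment> \<open>The orbit of \<open>m\<close> under \<open>R # H\<close> contains
        \<open>m \<noteq> 0\<close>, so it is all of \<open>M\<close> by irreducibility; and it lies
        in \<open>N\<close>, since \<open>(a # h) m = a (h m)\<close>.\<close>
      let ?O = "(\<lambda>t. smash_act M ract hact t m) ` carrier RsH"
      have "smash_act M ract hact a n \<in> ?O" if "a \<in> carrier RsH" "n \<in> ?O" for a n
        using that m by (auto simp flip: S.act_mult)
      then have "?O = {\<zero>\<^bsub>M\<^esub>} \<or> ?O = carrier M"
        by (rule S.no_proper_submodule[OF S.orbit_subspace[OF m]])
      moreover have "m \<in> ?O"
        by (rule image_eqI[of _ _ "\<one> \<sharp> \<one>\<^bsub>H\<^esub>"])
          (simp_all add: smash_act_pure[OF RM] m M.hact_one irreducible_RH_unital[OF M]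
            RsH_simps smash_simps)
      moreover have "m \<noteq> \<zero>\<^bsub>M\<^esub>" using xm M.act_simps(6) rjR[OF x] by auto
      moreover have "?O \<subseteq> N" using in_N by (auto simp: RsH_simps)
      ultimately show "N = carrier M" using Nd(1) by blast
    qed
    then show False using xm M.act_simps(1)[OF rjR[OF x] m] by simp
  qed
  then show "x \<in> rHj" using rjR[OF x] by (simp add: H_jacobson_radical_def)
qed

end

theorem theorem4p3:
  fixes K :: "'k ring" and H :: "('k, 'h) module" and R :: "('k, 'r) module"
    and \<Delta> :: "'h \<Rightarrow> ('h, 'h) tensor" and \<epsilon> :: "'h \<Rightarrow> 'k" and S :: "'h \<Rightarrow> 'h"
    and act :: "'h \<Rightarrow> 'r \<Rightarrow> 'r"
  assumes "field K" and "hopf_algebra K H \<Delta> \<epsilon> S" and "module_algebra K H \<Delta> \<epsilon> S R act"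
  shows
    "let rj = jacobson_radical K;
         RH = smash_product K H \<Delta> R act;
         idl = smash_ideal K H R;
         rHj = H_jacobson_radical K H \<Delta> R act;
         rbar = jacobson_contraction K H \<Delta> R act;
         rjH = jacobson_H_core K H R act
     in
       (rbar = rHj \<and> rj (RH\<lparr>carrier := idl rHj\<rparr>) = idl rHj) \<and>
       ((rj RH = idl rHj \<longleftrightarrow> rj (RH\<lparr>carrier := idl rHj\<rparr>) = rj RH) \<and>
        (rj (RH\<lparr>carrier := idl rHj\<rparr>) = rj RH \<longleftrightarrow> rj (RH\<lparr>carrier := idl rbar\<rparr>) = rj RH)) \<and>
       (vectorspace.fin_dim K H \<longrightarrow>
        (rj RH = idl rHj \<longleftrightarrow> rj (RH\<lparr>carrier := idl rjH\<rparr>) = rj RH))"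
proof -
  interpret module_algebra K H \<Delta> \<epsilon> S R act by (rule assms(3))
  have "jacobson_contraction K H \<Delta> R act = rHj"
    using rHj_iff by (auto simp: jacobson_contraction_def)
  moreover have "rjH = rHj" if "vectorspace.fin_dim K H"
    using rjH_subset_rHj[OF that] rHj_subset_rjH by blast
  \<comment> \<open>After these identifications, every condition in (2) and (3) is the single
    equation between \<open>r_j(R # H)\<close> and \<open>r_Hj(R) # H\<close>, read in one direction
    or the other.\<close>
  ultimately show ?thesis
    using jacobson_radical_smash_rHj by (auto simp: Let_def)
qed

end
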